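(* Let $X$ be a separable infinite-dimensional Banach space which is elastic. Then $C[0,1]$ is isomorphic to a (closed linear) subspace of $X$.
   Context: A Banach space $X$ is called $K$-elastic (for a constant $K<\infty$) if whenever a Banach space $Y$ is isomorphic to a subspace of $X$, there is a linear isomorphism $T$ from $Y$ into $X$ with $\|y\|\le\|Ty\|\le K\|y\|$ for all $y\in Y$. $X$ is elastic if it is $K$-elastic for some $K<\infty$. $C[0,1]$ denotes the Banach space of continuous real functions on $[0,1]$ with the sup norm. *)

theory Defs
  imports "HOL-Analysis.Analysis"
begin

definition is_norm_on :: "'a::real_vector set \<Rightarrow> ('a \<Rightarrow> real) \<Rightarrow> bool" where
  "is_norm_on S N \<longleftrightarrow> subspace S \<and>
     (\<forall>x\<in>S. 0 \<le> N x) \<and> (\<forall>x\<in>S. N x = 0 \<longrightarrow> x = 0) \<and>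
     (\<forall>x\<in>S. \<forall>y\<in>S. N (x + y) \<le> N x + N y) \<and>
     (\<forall>c. \<forall>x\<in>S. N (c *\<^sub>R x) = \<bar>c\<bar> * N x)"

definition linear_on :: "'a::real_vector set \<Rightarrow> ('a \<Rightarrow> 'b::real_vector) \<Rightarrow> bool" where
  "linear_on S T \<longleftrightarrow> (\<forall>x\<in>S. \<forall>y\<in>S. T (x + y) = T x + T y) \<and>
     (\<forall>c. \<forall>x\<in>S. T (c *\<^sub>R x) = c *\<^sub>R T x)"

text \<open>K-elasticity of the Banach space 'a.  Every Banach space Y isomorphic to a subspace
  of X is (up to isometry) a closed subspace S of X carrying a norm N equivalent to the
  norm of X (transport the norm of Y along the isomorphism); conversely every such (S,N)
  is a Banach space isomorphic to S.\<close>
definition K_elastic :: "'a::banach itself \<Rightarrow> real \<Rightarrow> bool" where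
  "K_elastic _ K \<longleftrightarrow>
     (\<forall>(S::'a set) N. closed S \<and> subspace S \<and> is_norm_on S N \<and>
        (\<exists>a b. 0 < a \<and> (\<forall>x\<in>S. a * norm x \<le> N x \<and> N x \<le> b * norm x)) \<longrightarrow>
        (\<exists>T::'a \<Rightarrow> 'a. linear_on S T \<and>
           (\<forall>y\<in>S. N y \<le> norm (T y) \<and> norm (T y) \<le> K * N y)))"

definition elastic :: "'a::banach itself \<Rightarrow> bool" where
  "elastic t \<longleftrightarrow> (\<exists>K. K_elastic t K)"

definition C01 :: "(real \<Rightarrow> real) set" where
  "C01 = {f. continuous_on {0..1} f \<and> (\<forall>x. x \<notin> {0..1} \<longrightarrow> f x = 0)}"

definition linear_on_C01 :: "((real \<Rightarrow> real) \<Rightarrow> 'b::real_vector) \<Rightarrow> bool" where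
  "linear_on_C01 T \<longleftrightarrow> (\<forall>f\<in>C01. \<forall>g\<in>C01. T (\<lambda>x. f x + g x) = T f + T g) \<and>
     (\<forall>c. \<forall>f\<in>C01. T (\<lambda>x. c * f x) = c *\<^sub>R T f)"

definition supnorm01 :: "(real \<Rightarrow> real) \<Rightarrow> real" where
  "supnorm01 f = (SUP x\<in>{0..1}. \<bar>f x\<bar>)"

end

theory Submission
  imports Defs "HOL-Library.Sublist"
begin

text \<open>
  For a tree \<open>A\<close> of finite sequences, let \<open>C(A)\<close> be the space of finitely supported
  coefficients with norm \<open>\<parallel>a\<parallel> = sup\<^sub>t \<bar>\<Sum>\<^bsub>s \<le> t\<^esub> a\<^sub>s\<bar>\<close>, i.e. the span of the indicators of the sets of nodes
  above \<open>s\<close>. The full tree gives a space containing \<open>C\<close> of the Cantor set, hence \<open>C[0,1]\<close>.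

  Since \<open>X\<close> is separable, approximate embeddings of a finite part of a countable system form a tree on a
  countable set. If that tree had no infinite branch, it could be used as a clock: a system of vectors
  in \<open>X\<close> indexed by the clock whose chains behave like the target produces an infinite branch of it.
  So only systems along well-founded clocks have to be found, with constants that do not depend on the clock.

  This is done by two nested bar inductions. The outer one embeds \<open>C(A)\<close> for every well-founded spreading
  tree \<open>A\<close>. Its step is a \<open>c\<^sub>0\<close>-sum, which by boundedness reduces to components indexed by a well-founded
  clock, where the upper estimate is only asked for along chains. The inner induction is on
  the clock: systems already found are made independent of each other, so that the lower estimate holds
  for all of them simultaneously; then \<open>X\<close> gets the norm \<open>max (sup\<^sub>t \<bar>\<theta>\<^sub>t w\<bar>) (\<parallel>w\<parallel> / k)\<close>, in which chains
  are again uniformly good, and elasticity carries this back into \<open>X\<close> with a constant independent of \<open>k\<close>.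

  Independence comes from functionals \<open>\<theta>\<^sub>t\<close> that are chosen from the leaves downwards, such that \<open>\<theta>\<^sub>t\<close> is a
  cluster point of the \<open>\<theta>\<close> at the children of \<open>t\<close>. A child chosen late then has a functional that agrees with
  that of its parent on all vectors chosen before, and differences of two siblings make
  a late vector almost invisible to all functionals chosen before.
\<close>

section \<open>Hahn-Banach extension and pointwise cluster points of bounded functionals\<close>

section \<open>Functionals\<close>

text \<open>The obstacle is loss of constants: every gluing of systems costs a factor, so a plain
  induction would lose all control. Each stage therefore only provides approximate dual functionals
  and some finite upper constant. The renorming forgets that constant and returns lower constant
  \<open>1\<close> and upper constant \<open>3 * K\<close>, the same at every stage of both
  inductions.

  A lower estimate can be kept for infinitely many unrelated systems at once, since it only asks for
  functionals. No joint upper estimate is available for them, which is why it is requested along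
  chains only: beyond a clock node a chain meets the system of a single child, plus what is added at
  that child itself.

  A further vector is needed for the node \<open>[j]\<close> below an already embedded copy of what
  lies above it. A Riesz sequence offers infinitely many candidates for it, and differences of
  candidates can be made almost independent of the copy. The node is first treated as incomparable
  to the copy; restoring the order costs a factor 2, again removed by renorming.\<close>

lemma hahn_banach_graph:
  fixes G0 :: "('a::real_normed_vector \<times> real) set"
  assumes sub: "subspace G0" and bd: "\<And>x y. (x, y) \<in> G0 \<Longrightarrow> y \<le> C * norm x" and C: "0 \<le> C"
  shows "\<exists>g. linear g \<and> (\<forall>x y. (x, y) \<in> G0 \<longrightarrow> g x = y) \<and> (\<forall>x. \<bar>g x\<bar> \<le> C * norm x)"
proof -
  define M where "M = {G. subspace G \<and> G0 \<subseteq> G \<and> (\<forall>x y. (x, y) \<in> G \<longrightarrow> y \<le> C * norm x)}"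
  have G0M: "G0 \<in> M" using sub bd by (auto simp: M_def)
  have "\<exists>G\<in>M. \<forall>X\<in>M. G \<subseteq> X \<longrightarrow> X = G"
  proof (rule subset_Zorn_nonempty)
    show "M \<noteq> {}" using G0M by blast
    fix CC assume ne: "CC \<noteq> {}" and ch: "subset.chain M CC"
    then have CM: "CC \<subseteq> M" and tot: "\<And>X Y. X \<in> CC \<Longrightarrow> Y \<in> CC \<Longrightarrow> X \<subseteq> Y \<or> Y \<subseteq> X"
      by (simp_all add: subset_chain_def)
    have "subspace (\<Union>CC)"
    proof (rule subspaceI)
      show "0 \<in> \<Union>CC" using ne CM subspace_0 unfolding M_def by blast
      show "x + y \<in> \<Union>CC" if xy: "x \<in> \<Union>CC" "y \<in> \<Union>CC" for x y
      proof -
        obtain X where X: "X \<in> CC" "x \<in> X" using xy(1) by blast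
        obtain Y where Y: "Y \<in> CC" "y \<in> Y" using xy(2) by blast
        obtain Z where Z: "Z \<in> CC" "x \<in> Z" "y \<in> Z" using tot[OF X(1) Y(1)] X Y by blast
        then have "subspace Z" using CM by (auto simp: M_def)
        then have "x + y \<in> Z" using Z by (simp add: subspace_add)
        then show ?thesis using Z(1) by (rule UnionI[rotated])
      qed
      show "c *\<^sub>R x \<in> \<Union>CC" if "x \<in> \<Union>CC" for c x
        using that CM subspace_scale unfolding M_def by blast
    qed
    then show "\<Union>CC \<in> M" using ne CM unfolding M_def by blast
  qed
  then obtain G where GM: "G \<in> M" and max: "\<And>X. X \<in> M \<Longrightarrow> G \<subseteq> X \<Longrightarrow> X = G" by blast
  have sG: "subspace G" and G0G: "G0 \<subseteq> G" and bG: "\<And>x y. (x, y) \<in> G \<Longrightarrow> y \<le> C * norm x"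
    using GM by (auto simp: M_def)
  have add: "(x + x', y + y') \<in> G" if "(x, y) \<in> G" "(x', y') \<in> G" for x x' y y'
    using subspace_add[OF sG that] by simp
  have scale: "(c *\<^sub>R x, c * y) \<in> G" if "(x, y) \<in> G" for c x y
    using subspace_scale[OF sG that, of c] by simp
  have zero: "(0, 0) \<in> G" using subspace_0[OF sG] by (simp add: zero_prod_def)
  \<comment> \<open>The bound makes single-valuedness automatic: \<open>(0, y - y')\<close> and its
    negative both satisfy it. So any span of pairs that obeys the bound is the graph of a
    functional.\<close>
  have uniq: "y = y'" if "(x, y) \<in> G" "(x, y') \<in> G" for x y y'
  proof -
    have "(0, y - y') \<in> G" "(0, y' - y) \<in> G"
      using add[OF that(1) scale[OF that(2), of "-1"]] add[OF that(2) scale[OF that(1), of "-1"]] by auto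
    then show ?thesis using bG[of 0 "y - y'"] bG[of 0 "y' - y"] by simp
  qed
  have total: "\<exists>y. (x0, y) \<in> G" for x0
  proof (rule ccontr)
    assume no: "\<not> ?thesis"
    define L where "L = (\<lambda>(x, y). y - C * norm (x - x0)) ` G"
    have key: "y - C * norm (x - x0) \<le> C * norm (x' + x0) - y'" if "(x, y) \<in> G" "(x', y') \<in> G" for x y x' y'
    proof -
      have "y + y' \<le> C * norm (x + x')" using bG[OF add[OF that]] .
      also have "\<dots> \<le> C * (norm (x - x0) + norm (x' + x0))"
        using norm_triangle_ineq[of "x - x0" "x' + x0"] C by (intro mult_left_mono) auto
      finally show ?thesis by (simp add: algebra_simps)
    qed
    have Lne: "L \<noteq> {}" using zero by (auto simp: L_def)
    have bdd: "bdd_above L"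
      using key[OF _ zero] by (intro bdd_aboveI[of _ "C * norm x0"]) (auto simp: L_def)
    define r where "r = Sup L"
    have r1: "y - C * norm (x - x0) \<le> r" if "(x, y) \<in> G" for x y
      unfolding r_def using bdd that by (intro cSup_upper) (auto simp: L_def)
    have r2: "r \<le> C * norm (x + x0) - y" if "(x, y) \<in> G" for x y
      unfolding r_def using Lne key that by (intro cSup_least) (auto simp: L_def)
    define G' where "G' = span (insert (x0, r) G)"
    have "subspace G'" by (simp add: G'_def)
    moreover have GG': "G \<subseteq> G'" unfolding G'_def by (auto intro: span_base)
    moreover have "\<exists>t. (x - t *\<^sub>R x0, y - t * r) \<in> G" if "(x, y) \<in> G'" for x y
      using that sG by (simp add: G'_def span_breakdown_eq span_eq_iff[THEN iffD2])
    moreover have ext: "y + t * r \<le> C * norm (x + t *\<^sub>R x0)" if "(x, y) \<in> G" for x y t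
    proof -
      consider "t = 0" | "t > 0" | "t < 0" by linarith
      then show ?thesis
      proof cases
        case 1 then show ?thesis using bG[OF that] by simp
      next
        case 2
        have "r \<le> C * norm (inverse t *\<^sub>R x + x0) - inverse t * y" using r2[OF scale[OF that]] .
        then have "t * r \<le> t * (C * norm (inverse t *\<^sub>R x + x0) - inverse t * y)" using 2 by simp
        also have "\<dots> = C * norm (t *\<^sub>R (inverse t *\<^sub>R x + x0)) - y"
          using 2 by (simp add: right_diff_distrib)
        finally show ?thesis using 2 by (simp add: scaleR_add_right)
      next
        case 3
        define s where "s = - t"
        have s: "s > 0" "t = - s" using 3 by (auto simp: s_def)
        have "inverse s * y - C * norm (inverse s *\<^sub>R x - x0) \<le> r" using r1[OF scale[OF that]] .
        then have "s * (inverse s * y - C * norm (inverse s *\<^sub>R x - x0)) \<le> s * r" using s by simp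
        moreover have "s * (inverse s * y - C * norm (inverse s *\<^sub>R x - x0)) = y - C * norm (s *\<^sub>R (inverse s *\<^sub>R x - x0))"
          using s by (simp add: right_diff_distrib)
        ultimately show ?thesis using s by (simp add: scaleR_diff_right)
      qed
    qed
    have "y \<le> C * norm x" if "(x - t *\<^sub>R x0, y - t * r) \<in> G" for x y t
      using ext[OF that, of t] by simp
    ultimately have "G' \<in> M" using G0G unfolding M_def by blast
    then have "G' = G" using max GG' by blast
    moreover have "(x0, r) \<in> G'" by (simp add: G'_def span_base)
    ultimately show False using no by blast
  qed
  define g where "g x = (THE y. (x, y) \<in> G)" for x
  have g: "(x, g x) \<in> G" for x
    unfolding g_def using total[of x] uniq by (metis theI)
  have geq: "g x = y" if "(x, y) \<in> G" for x y using uniq[OF g that] .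
  show ?thesis
  proof (intro exI[of _ g] conjI allI impI)
    show "linear g"
      by (rule linearI) (use geq add scale g in auto)
    show "g x = y" if "(x, y) \<in> G0" for x y using geq that G0G by blast
    show "\<bar>g x\<bar> \<le> C * norm x" for x
      using bG[OF g[of x]] bG[OF scale[OF g[of x], of "-1"]] by simp
  qed
qed

text \<open>Tychonoff: the functions lie in a product of compact intervals, where the filter of
  cofinite subsets of \<open>Z\<close> has a cluster point. Infinitely many good indices, rather
  than one, leave room for choices that come late.\<close>

lemma pointwise_cluster:
  fixes g :: "nat \<Rightarrow> 'a \<Rightarrow> real"
  assumes inf: "infinite Z" and bd: "\<And>n x. n \<in> Z \<Longrightarrow> \<bar>g n x\<bar> \<le> B x"
  obtains h where "\<And>V e. finite V \<Longrightarrow> 0 < e \<Longrightarrow> infinite {n \<in> Z. \<forall>v\<in>V. \<bar>g n v - h v\<bar> < e}"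
proof -
  define K where "K = (\<Pi>\<^sub>E x\<in>(UNIV::'a set). {- B x .. B x})"
  have "compactin (product_topology (\<lambda>x::'a. (euclidean::real topology)) UNIV) K"
    unfolding K_def by (subst compactin_PiE) auto
  then have K: "compact K" by (simp add: euclidean_product_topology)
  define F where "F = filtermap g (inf cofinite (principal Z))"
  have nb: "inf cofinite (principal Z) \<noteq> bot"
    using inf by (auto simp: trivial_limit_def eventually_inf_principal eventually_cofinite)
  then have "F \<noteq> bot" by (simp add: F_def filtermap_bot_iff)
  moreover have "eventually (\<lambda>x. x \<in> K) F"
    unfolding F_def eventually_filtermap eventually_inf_principal
    using bd by (auto simp: K_def abs_le_iff minus_le_iff intro!: always_eventually)
  ultimately obtain h where h: "inf (nhds h) F \<noteq> bot"
    using K unfolding compact_filter by blast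
  show ?thesis
  proof
    fix V :: "'a set" and e :: real assume V: "finite V" and e: "0 < e"
    show "infinite {n \<in> Z. \<forall>v\<in>V. \<bar>g n v - h v\<bar> < e}"
    proof
      assume fin: "finite {n \<in> Z. \<forall>v\<in>V. \<bar>g n v - h v\<bar> < e}"
      define U where "U = {k. \<forall>v\<in>V. \<bar>k v - h v\<bar> < e}"
      have "U = (\<Inter>v\<in>V. {k. \<bar>k v - h v\<bar> < e})" by (auto simp: U_def)
      moreover have "open {k::'a \<Rightarrow> real. \<bar>k v - h v\<bar> < e}" for v
        by (intro open_Collect_less continuous_intros) (auto intro: continuous_on_product_coordinates)
      ultimately have "open U" using V by (auto intro: open_INT)
      moreover have "h \<in> U" using e by (auto simp: U_def)
      ultimately have "eventually (\<lambda>k. k \<in> U) (nhds h)" by (rule eventually_nhds_in_open)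
      moreover have "eventually (\<lambda>k. k \<notin> U) F"
        unfolding F_def eventually_filtermap eventually_inf_principal eventually_cofinite
        using fin by (auto simp: U_def elim!: rev_finite_subset)
      ultimately have "eventually (\<lambda>k. False) (inf (nhds h) F)"
        unfolding eventually_inf by blast
      then show False using h by (simp add: trivial_limit_def)
    qed
  qed
qed

text \<open>Each linearity identity and each bound concerns finitely many vectors, so it can be read
  off, up to a small error, from one \<open>g n\<close> that is close to \<open>h\<close> on
  them.\<close>

lemma cluster_linear_functional:
  fixes g :: "nat \<Rightarrow> 'a::real_normed_vector \<Rightarrow> real"
  assumes inf: "infinite Z" and lin: "\<And>n. n \<in> Z \<Longrightarrow> linear (g n)"
    and bd: "\<And>n x. n \<in> Z \<Longrightarrow> \<bar>g n x\<bar> \<le> C * norm x"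
  shows "\<exists>h. linear h \<and> (\<forall>x. \<bar>h x\<bar> \<le> C * norm x) \<and>
    (\<forall>V e. finite V \<longrightarrow> 0 < e \<longrightarrow> infinite {n \<in> Z. \<forall>v\<in>V. \<bar>g n v - h v\<bar> < e})"
proof -
  obtain h where h: "\<And>V e. finite V \<Longrightarrow> 0 < e \<Longrightarrow> infinite {n \<in> Z. \<forall>v\<in>V. \<bar>g n v - h v\<bar> < e}"
    using pointwise_cluster[of Z g "\<lambda>x. C * norm x"] inf bd by blast
  have ex: "\<exists>n\<in>Z. \<forall>v\<in>V. \<bar>g n v - h v\<bar> < e" if "finite V" "0 < e" for V e
    using h[OF that] by (metis (mono_tags, lifting) Collect_empty_eq finite.emptyI)
  have zero: "r = 0" if "\<And>e. 0 < e \<Longrightarrow> \<bar>r\<bar> \<le> M * e" for r M :: real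
  proof (rule ccontr)
    assume r: "r \<noteq> 0"
    have "\<bar>r\<bar> \<le> M * (\<bar>r\<bar> / (2 * (\<bar>M\<bar> + 1)))" using r by (intro that) auto
    also have "\<dots> \<le> (\<bar>M\<bar> + 1) * (\<bar>r\<bar> / (2 * (\<bar>M\<bar> + 1)))" by (intro mult_right_mono) auto
    also have "\<dots> = \<bar>r\<bar> / 2" by (simp add: field_simps)
    finally show False using r by simp
  qed
  show ?thesis
  proof (intro exI[of _ h] conjI allI impI)
    show "linear h"
    proof (rule linearI)
      fix x y
      have "h (x + y) - (h x + h y) = 0"
      proof (rule zero)
        fix e :: real assume e: "0 < e"
        obtain n where n: "n \<in> Z" "\<forall>v\<in>{x, y, x + y}. \<bar>g n v - h v\<bar> < e" using ex[OF _ e, of "{x, y, x + y}"] by blast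
        then show "\<bar>h (x + y) - (h x + h y)\<bar> \<le> 3 * e" using linear_add[OF lin[OF n(1)], of x y] by auto
      qed
      then show "h (x + y) = h x + h y" by simp
    next
      fix c x
      have "h (c *\<^sub>R x) - c * h x = 0"
      proof (rule zero)
        fix e :: real assume e: "0 < e"
        obtain n where n: "n \<in> Z" "\<forall>v\<in>{x, c *\<^sub>R x}. \<bar>g n v - h v\<bar> < e" using ex[OF _ e, of "{x, c *\<^sub>R x}"] by blast
        have "\<bar>c * (g n x - h x)\<bar> \<le> \<bar>c\<bar> * e" using n(2) by (simp add: abs_mult mult_left_mono)
        then show "\<bar>h (c *\<^sub>R x) - c * h x\<bar> \<le> (1 + \<bar>c\<bar>) * e"
          using n linear_scale[OF lin[OF n(1)], of c x] by (auto simp: algebra_simps)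
      qed
      then show "h (c *\<^sub>R x) = c *\<^sub>R h x" by simp
    qed
    fix x
    show "\<bar>h x\<bar> \<le> C * norm x"
    proof (rule field_le_epsilon)
      fix e :: real assume e: "0 < e"
      obtain n where n: "n \<in> Z" "\<forall>v\<in>{x}. \<bar>g n v - h v\<bar> < e" using ex[OF _ e, of "{x}"] by blast
      then show "\<bar>h x\<bar> \<le> C * norm x + e" using bd[OF n(1), of x] by auto
    qed
  qed (rule h)
qed

section \<open>Branch sums, two-sided estimates, and the renorming provided by elasticity\<close>

section \<open>Estimates along forest orders\<close>

definition bsum :: "('i \<Rightarrow> 'i \<Rightarrow> bool) \<Rightarrow> 'i set \<Rightarrow> ('i \<Rightarrow> real) \<Rightarrow> 'i \<Rightarrow> real" where
  "bsum R S a t = (\<Sum>s\<in>{s\<in>S. R s t}. a s)"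

definition lower_est :: "('i \<Rightarrow> 'i \<Rightarrow> bool) \<Rightarrow> real \<Rightarrow> ('i \<Rightarrow> 'a::real_normed_vector) \<Rightarrow> 'i set \<Rightarrow> bool" where
  "lower_est R L x S \<longleftrightarrow> (\<forall>a. \<forall>t\<in>S. \<bar>bsum R S a t\<bar> \<le> L * norm (\<Sum>s\<in>S. a s *\<^sub>R x s))"

text \<open>A bound \<open>B\<close> takes the place of the supremum of the branch sums. This keeps
  the empty set harmless and allows crude bounds to be inserted.\<close>

definition upper_est :: "('i \<Rightarrow> 'i \<Rightarrow> bool) \<Rightarrow> real \<Rightarrow> ('i \<Rightarrow> 'a::real_normed_vector) \<Rightarrow> 'i set \<Rightarrow> bool" where
  "upper_est R U x S \<longleftrightarrow> (\<forall>a B. 0 \<le> B \<longrightarrow> (\<forall>t\<in>S. \<bar>bsum R S a t\<bar> \<le> B)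
     \<longrightarrow> norm (\<Sum>s\<in>S. a s *\<^sub>R x s) \<le> U * B)"

text \<open>This generality covers the prefix order, its copies on coded nodes, disjoint unions of
  trees and the ancestor relation of the full tree.\<close>

definition forest_order :: "('i \<Rightarrow> 'i \<Rightarrow> bool) \<Rightarrow> bool" where
  "forest_order R \<longleftrightarrow> (\<forall>s. R s s) \<and> (\<forall>s t. R s t \<longrightarrow> R t s \<longrightarrow> s = t) \<and>
     (\<forall>r s t. R r s \<longrightarrow> R s t \<longrightarrow> R r t) \<and> (\<forall>r s t. R r t \<longrightarrow> R s t \<longrightarrow> R r s \<or> R s r)"

lemma lower_estD: "lower_est R L x S \<Longrightarrow> t \<in> S \<Longrightarrow> \<bar>bsum R S a t\<bar> \<le> L * norm (\<Sum>s\<in>S. a s *\<^sub>R x s)"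
  by (simp add: lower_est_def)

lemma upper_estD: "upper_est R U x S \<Longrightarrow> 0 \<le> B \<Longrightarrow> (\<And>t. t \<in> S \<Longrightarrow> \<bar>bsum R S a t\<bar> \<le> B)
   \<Longrightarrow> norm (\<Sum>s\<in>S. a s *\<^sub>R x s) \<le> U * B"
  by (simp add: upper_est_def)

lemma forest_orderD:
  assumes "forest_order R"
  shows "R s s" "R s t \<Longrightarrow> R t s \<Longrightarrow> s = t" "R r s \<Longrightarrow> R s t \<Longrightarrow> R r t" "R r t \<Longrightarrow> R s t \<Longrightarrow> R r s \<or> R s r"
  using assms unfolding forest_order_def by blast+

lemma forest_order_prefix: "forest_order (prefix :: 'b list \<Rightarrow> 'b list \<Rightarrow> bool)"
  unfolding forest_order_def by (auto intro: prefix_order.antisym prefix_order.trans dest: prefix_same_cases)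

lemma finite_chain_max:
  assumes fo: "forest_order R" and "finite X" "X \<noteq> {}" "\<And>r s. r \<in> X \<Longrightarrow> s \<in> X \<Longrightarrow> R r s \<or> R s r"
  shows "\<exists>m\<in>X. \<forall>s\<in>X. R s m"
  using assms(2-4)
proof (induction X rule: finite_ne_induct)
  case (singleton x)
  then show ?case using forest_orderD(1)[OF fo] by simp
next
  case (insert x F)
  then obtain m where m: "m \<in> F" "\<forall>s\<in>F. R s m" by blast
  show ?case
  proof (cases "R x m")
    case True then show ?thesis using m by blast
  next
    case False
    then have "R m x" using insert.prems[of x m] m(1) by blast
    then have "\<forall>s\<in>insert x F. R s x" using m forest_orderD(1,3)[OF fo] by blast
    then show ?thesis by blast
  qed
qed

text \<open>The elements of \<open>S\<close> below \<open>t\<close> form a finite chain, and its top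
  sees the same elements. So a node outside \<open>S\<close> adds no branch sum except possibly 0,
  and functionals attached to such nodes are controlled by the estimate on \<open>S\<close>.\<close>

lemma bsum_cases:
  assumes fo: "forest_order R" and fin: "finite S"
  obtains "\<And>a. bsum R S a t = 0" | m where "m \<in> S" "R m t" "\<And>a. bsum R S a t = bsum R S a m"
proof (cases "{s \<in> S. R s t} = {}")
  case True
  then show ?thesis using that(1) unfolding bsum_def by (metis sum.empty)
next
  case False
  then obtain m where m: "m \<in> S" "R m t" "\<forall>s\<in>{s \<in> S. R s t}. R s m"
    using finite_chain_max[OF fo, of "{s \<in> S. R s t}"] fin forest_orderD(4)[OF fo] by auto
  then have "{s \<in> S. R s m} = {s \<in> S. R s t}" using forest_orderD(3)[OF fo] by blast
  then show ?thesis using that(2) m by (simp add: bsum_def)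
qed

lemma bsum_bound:
  assumes "forest_order R" "finite S" "\<And>s. s \<in> S \<Longrightarrow> \<bar>bsum R S a s\<bar> \<le> B" "0 \<le> B"
  shows "\<bar>bsum R S a t\<bar> \<le> B"
  using assms by (metis abs_zero bsum_cases)

text \<open>A coefficient is the branch sum at \<open>s\<close> minus the one at the predecessor of
  \<open>s\<close> in \<open>S\<close>, whence the factor 2.\<close>

lemma coeff_bound:
  assumes fo: "forest_order R" and fin: "finite S" and B: "\<And>s. s \<in> S \<Longrightarrow> \<bar>bsum R S a s\<bar> \<le> B" and s: "s \<in> S"
  shows "\<bar>a s\<bar> \<le> 2 * B"
proof -
  define X where "X = {r \<in> S. R r s \<and> r \<noteq> s}"
  have "bsum R S a s = sum a (insert s X)" unfolding bsum_def using s forest_orderD(1)[OF fo] by (intro sum.cong) (auto simp: X_def)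
  moreover have finX: "finite X" and "s \<notin> X" using fin by (auto simp: X_def)
  ultimately have eq: "bsum R S a s = a s + sum a X" by simp
  have "\<bar>sum a X\<bar> \<le> B"
  proof (cases "X = {}")
    case True then show ?thesis using B[OF s] by auto
  next
    case False
    have "R r q \<or> R q r" if "r \<in> X" "q \<in> X" for r q
      using forest_orderD(4)[OF fo, of r s q] that by (simp add: X_def)
    then obtain m where m: "m \<in> X" "\<forall>r\<in>X. R r m"
      using finite_chain_max[OF fo finX False] by blast
    have ms: "R m s" "m \<noteq> s" using m(1) by (auto simp: X_def)
    have below: "R r s \<and> r \<noteq> s" if "R r m" for r
      using that ms forest_orderD(2)[OF fo, of s m] forest_orderD(3)[OF fo, of r m s] by auto
    have "{r \<in> S. R r m} = X"
    proof
      show "{r \<in> S. R r m} \<subseteq> X" using below by (auto simp: X_def)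
      show "X \<subseteq> {r \<in> S. R r m}" using m(2) by (auto simp: X_def)
    qed
    then have "bsum R S a m = sum a X" by (simp add: bsum_def)
    moreover have "m \<in> S" using m(1) by (simp add: X_def)
    ultimately show ?thesis using B[of m] by simp
  qed
  then show ?thesis using eq B[OF s] by linarith
qed

text \<open>Prepares perturbation arguments: errors are measured by the largest branch sum M, and
  are absorbed at the node where M is attained.\<close>

lemma bsum_attained:
  assumes fo: "forest_order R" and S: "finite S" and t: "t \<in> S"
  obtains t0 where "t0 \<in> S" "\<And>s. s \<in> S \<Longrightarrow> \<bar>bsum R S a s\<bar> \<le> \<bar>bsum R S a t0\<bar>"
    "\<And>s. s \<in> S \<Longrightarrow> \<bar>a s\<bar> \<le> 2 * \<bar>bsum R S a t0\<bar>"
proof -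
  have "Max ((\<lambda>s. \<bar>bsum R S a s\<bar>) ` S) \<in> (\<lambda>s. \<bar>bsum R S a s\<bar>) ` S" using S t by (intro Max_in) auto
  then obtain t0 where t0: "t0 \<in> S" "Max ((\<lambda>s. \<bar>bsum R S a s\<bar>) ` S) = \<bar>bsum R S a t0\<bar>" by blast
  have "\<bar>bsum R S a s\<bar> \<le> \<bar>bsum R S a t0\<bar>" if "s \<in> S" for s
    unfolding t0(2)[symmetric] using that S by (intro Max_ge) auto
  with coeff_bound[OF fo S this] t0(1) show ?thesis using that by blast
qed

lemma bsum_reindex:
  assumes "inj_on h S" "\<And>s t. s \<in> S \<Longrightarrow> t \<in> S \<Longrightarrow> R' (h s) (h t) \<longleftrightarrow> R s t" "t \<in> S"
  shows "bsum R' (h ` S) (\<lambda>s. a (inv_into S h s)) (h t) = bsum R S a t"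
proof -
  have "{s \<in> h ` S. R' s (h t)} = h ` {s \<in> S. R s t}" using assms by auto
  then have "bsum R' (h ` S) (\<lambda>s. a (inv_into S h s)) (h t) = (\<Sum>s\<in>{s \<in> S. R s t}. a (inv_into S h (h s)))"
    using assms(1) by (simp add: bsum_def sum.reindex inj_on_subset)
  also have "\<dots> = bsum R S a t" unfolding bsum_def using assms(1) by (intro sum.cong) auto
  finally show ?thesis .
qed

lemma sum_reindex_inv:
  assumes "inj_on h S"
  shows "(\<Sum>s\<in>h ` S. a (inv_into S h s) *\<^sub>R x s) = (\<Sum>s\<in>S. a s *\<^sub>R x (h s))"
  using assms by (simp add: sum.reindex)

lemma lower_est_reindex:
  assumes "inj_on h S" "\<And>s t. s \<in> S \<Longrightarrow> t \<in> S \<Longrightarrow> R' (h s) (h t) \<longleftrightarrow> R s t" "lower_est R' L x (h ` S)"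
  shows "lower_est R L (\<lambda>s. x (h s)) S"
  unfolding lower_est_def
proof (intro allI ballI)
  fix a t assume "t \<in> S"
  then show "\<bar>bsum R S a t\<bar> \<le> L * norm (\<Sum>s\<in>S. a s *\<^sub>R x (h s))"
    using lower_estD[OF assms(3), of "h t" "\<lambda>s. a (inv_into S h s)"] bsum_reindex[where h = h and S = S and R' = R' and R = R and a = a, OF assms(1,2)]
      sum_reindex_inv[OF assms(1), of a x] by auto
qed

lemma upper_est_reindex:
  assumes "inj_on h S" "\<And>s t. s \<in> S \<Longrightarrow> t \<in> S \<Longrightarrow> R' (h s) (h t) \<longleftrightarrow> R s t" "upper_est R' U x (h ` S)"
  shows "upper_est R U (\<lambda>s. x (h s)) S"
  unfolding upper_est_def
proof (intro allI impI)
  fix a B assume B: "0 \<le> (B::real)" "\<forall>t\<in>S. \<bar>bsum R S a t\<bar> \<le> B"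
  have "norm (\<Sum>s\<in>h ` S. a (inv_into S h s) *\<^sub>R x s) \<le> U * B"
    using B bsum_reindex[where h = h and S = S and R' = R' and R = R and a = a, OF assms(1,2)] by (intro upper_estD[OF assms(3)]) auto
  then show "norm (\<Sum>s\<in>S. a s *\<^sub>R x (h s)) \<le> U * B" using sum_reindex_inv[OF assms(1), of a x] by simp
qed

text \<open>On an antichain each branch sum is a single coefficient, so the upper estimate turns
  into that of the basis of \<open>c_0\<close>.\<close>

lemma upper_est_antichain:
  assumes inj: "inj_on h S" and R': "\<And>t. R' t t" and "\<And>s t. s \<in> S \<Longrightarrow> t \<in> S \<Longrightarrow> R' (h s) (h t) \<Longrightarrow> s = t"
    and "upper_est R' U x (h ` S)" and "0 \<le> B" and "\<And>s. s \<in> S \<Longrightarrow> \<bar>a s\<bar> \<le> B"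
  shows "norm (\<Sum>s\<in>S. a s *\<^sub>R x (h s)) \<le> U * B"
proof -
  have "upper_est (=) U (\<lambda>s. x (h s)) S"
    using assms(3) R' by (intro upper_est_reindex[OF inj _ assms(4)]) auto
  then show ?thesis
  proof (rule upper_estD[OF _ \<open>0 \<le> B\<close>])
    fix t assume t: "t \<in> S"
    then have "{s \<in> S. s = t} = {t}" by auto
    then show "\<bar>bsum (=) S a t\<bar> \<le> B" using assms(6)[OF t] by (simp add: bsum_def)
  qed
qed

lemma upper_est_singleton:
  assumes "R s s" "norm (x s) \<le> U"
  shows "upper_est R U x {s}"
  unfolding upper_est_def
proof (intro allI impI)
  fix a B assume B: "0 \<le> (B::real)" "\<forall>t\<in>{s}. \<bar>bsum R {s} a t\<bar> \<le> B"
  have "{r \<in> {s}. R r s} = {s}" using assms by auto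
  then have "\<bar>a s\<bar> \<le> B" using B by (simp add: bsum_def)
  then have "\<bar>a s\<bar> * norm (x s) \<le> B * U" using assms B by (intro mult_mono) auto
  then show "norm (\<Sum>s\<in>{s}. a s *\<^sub>R x s) \<le> U * B" by (simp add: mult.commute)
qed

lemma norm_le_of_upper_est:
  assumes "upper_est R U x {s}" "R s s"
  shows "norm (x s) \<le> U"
proof -
  have "{r \<in> {s}. R r s} = {s}" using assms by auto
  then show ?thesis using upper_estD[OF assms(1), of 1 "\<lambda>_. 1"] by (simp add: bsum_def)
qed

text \<open>The new norm is equivalent to the old one on the whole space, so elasticity applies with
  the subspace \<open>UNIV\<close>. The equivalence constants depend on \<open>k\<close> and
  \<open>C\<close>, the distortion of the resulting map only on \<open>K\<close>. Elasticity enters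
  the construction only through this lemma.\<close>

lemma renorming:
  fixes \<Theta> :: "('a::banach \<Rightarrow> real) set"
  assumes el: "K_elastic TYPE('a) K" and lin_all: "\<forall>\<theta>\<in>\<Theta>. linear \<theta>"
    and bd_all: "\<forall>\<theta>\<in>\<Theta>. \<forall>w. \<bar>\<theta> w\<bar> \<le> C * norm w" and k: "0 < k" and K: "0 \<le> K"
  shows "\<exists>T :: 'a \<Rightarrow> 'a. linear T \<and> (\<forall>\<theta>\<in>\<Theta>. \<forall>w. \<bar>\<theta> w\<bar> \<le> norm (T w)) \<and>
    (\<forall>w B. 0 \<le> B \<longrightarrow> (\<forall>\<theta>\<in>\<Theta>. \<bar>\<theta> w\<bar> \<le> B) \<longrightarrow> norm w \<le> k * B \<longrightarrow> norm (T w) \<le> K * B)"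
proof -
  have lin: "linear \<theta>" if "\<theta> \<in> \<Theta>" for \<theta> using lin_all that by blast
  have bd: "\<bar>\<theta> w\<bar> \<le> C * norm w" if "\<theta> \<in> \<Theta>" for \<theta> w using bd_all that by blast
  \<comment> \<open>The zero functional makes the supremum range over a nonempty set even if
    \<open>\<Theta>\<close> is empty.\<close>
  define N where "N w = max (SUP \<theta>\<in>insert (\<lambda>_. 0) \<Theta>. \<bar>\<theta> w\<bar>) (norm w / k)" for w :: 'a
  have bdd: "bdd_above ((\<lambda>\<theta>. \<bar>\<theta> w\<bar>) ` insert (\<lambda>_. 0) \<Theta>)" for w
    by (rule bdd_aboveI[of _ "\<bar>C\<bar> * norm w"]) (auto intro!: order_trans[OF bd] mult_right_mono)
  have N_le: "N w \<le> B \<longleftrightarrow> 0 \<le> B \<and> (\<forall>\<theta>\<in>\<Theta>. \<bar>\<theta> w\<bar> \<le> B) \<and> norm w \<le> k * B" for w B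
  proof -
    have "N w \<le> B \<longleftrightarrow> (SUP \<theta>\<in>insert (\<lambda>_. 0) \<Theta>. \<bar>\<theta> w\<bar>) \<le> B \<and> norm w / k \<le> B" by (simp add: N_def)
    also have "(SUP \<theta>\<in>insert (\<lambda>_. 0) \<Theta>. \<bar>\<theta> w\<bar>) \<le> B \<longleftrightarrow> (\<forall>\<theta>\<in>insert (\<lambda>_. 0) \<Theta>. \<bar>\<theta> w\<bar> \<le> B)"
      by (rule cSUP_le_iff[OF _ bdd]) simp
    finally show ?thesis using k by (auto simp: field_simps)
  qed
  have N0: "0 \<le> N w" and N\<theta>: "\<And>\<theta>. \<theta> \<in> \<Theta> \<Longrightarrow> \<bar>\<theta> w\<bar> \<le> N w" and Nn: "norm w \<le> k * N w" for w
    using N_le[of w "N w"] by auto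
  have Nsc: "N (c *\<^sub>R x) \<le> \<bar>c\<bar> * N x" for c x
    unfolding N_le using N0[of x] N\<theta>[of _ x] Nn[of x]
    by (auto simp: linear_scale[OF lin] abs_mult mult_left_mono mult.left_commute[of k])
  have Nsc_eq: "N (c *\<^sub>R x) = \<bar>c\<bar> * N x" for c x
  proof (cases "c = 0")
    case True
    then show ?thesis using Nsc[of 0 x] N0[of 0] by simp
  next
    case False
    have "N x \<le> \<bar>inverse c\<bar> * N (c *\<^sub>R x)" using Nsc[of "inverse c" "c *\<^sub>R x"] False by simp
    then have "\<bar>c\<bar> * N x \<le> N (c *\<^sub>R x)" using False by (simp add: field_simps)
    then show ?thesis using Nsc[of c x] by simp
  qed
  have "is_norm_on UNIV N"
    unfolding is_norm_on_def
  proof (intro conjI ballI allI impI)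
    show "x = 0" if "N x = 0" for x using Nn[of x] that by simp
    show "N (x + y) \<le> N x + N y" for x y
      unfolding N_le
    proof (intro conjI ballI)
      fix \<theta> assume "\<theta> \<in> \<Theta>"
      then show "\<bar>\<theta> (x + y)\<bar> \<le> N x + N y" using N\<theta>[of \<theta> x] N\<theta>[of \<theta> y] by (simp add: linear_add[OF lin])
    next
      show "norm (x + y) \<le> k * (N x + N y)"
        using Nn[of x] Nn[of y] norm_triangle_ineq[of x y] by (simp add: distrib_left)
    qed (use N0 in auto)
  qed (use N0 Nsc_eq in auto)
  moreover have "0 < 1 / k \<and> (\<forall>x\<in>UNIV. 1 / k * norm x \<le> N x \<and> N x \<le> (\<bar>C\<bar> + 1 / k) * norm x)"
  proof (intro conjI ballI)
    fix x :: 'a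
    show "1 / k * norm x \<le> N x" using Nn[of x] k by (simp add: field_simps)
    show "N x \<le> (\<bar>C\<bar> + 1 / k) * norm x"
      unfolding N_le
    proof (intro conjI ballI)
      fix \<theta> assume "\<theta> \<in> \<Theta>"
      then have "\<bar>\<theta> x\<bar> \<le> C * norm x" by (rule bd)
      also have "\<dots> \<le> (\<bar>C\<bar> + 1 / k) * norm x" using k by (intro mult_right_mono) (auto simp: add_increasing2)
      finally show "\<bar>\<theta> x\<bar> \<le> (\<bar>C\<bar> + 1 / k) * norm x" .
    next
      have "norm x \<le> (k * \<bar>C\<bar>) * norm x + norm x" using k by simp
      also have "\<dots> = k * ((\<bar>C\<bar> + 1 / k) * norm x)" using k by (simp add: field_simps)
      finally show "norm x \<le> k * ((\<bar>C\<bar> + 1 / k) * norm x)" .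
    qed (use k in auto)
  qed (use k in auto)
  ultimately obtain T :: "'a \<Rightarrow> 'a" where T: "linear_on UNIV T" "\<And>y. N y \<le> norm (T y) \<and> norm (T y) \<le> K * N y"
    using el unfolding K_elastic_def by (metis UNIV_I closed_UNIV subspace_UNIV)
  show ?thesis
  proof (intro exI[of _ T] conjI ballI allI impI)
    show "linear T" using T(1) by (intro linearI) (auto simp: linear_on_def)
    show "\<bar>\<theta> w\<bar> \<le> norm (T w)" if "\<theta> \<in> \<Theta>" for \<theta> w using N\<theta>[OF that, of w] T(2)[of w] by linarith
    fix w B assume "0 \<le> B" "\<forall>\<theta>\<in>\<Theta>. \<bar>\<theta> w\<bar> \<le> B" "norm w \<le> k * B"
    then have "N w \<le> B" unfolding N_le by auto
    then show "norm (T w) \<le> K * B" using T(2)[of w] K by (meson mult_left_mono order_trans)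
  qed
qed

text \<open>The lower estimate is exactly the bound that allows Hahn-Banach to extend the assignment
  of \<open>of_bool (R s t)\<close> to \<open>x s\<close>.\<close>

lemma lower_est_functional:
  assumes fo: "forest_order R" and est: "\<And>S. finite S \<Longrightarrow> S \<subseteq> V \<Longrightarrow> lower_est R L x S"
    and L: "0 \<le> L" and t: "t \<in> V"
  obtains f where "linear f" "\<And>w. \<bar>f w\<bar> \<le> L * norm w" "\<And>s. s \<in> V \<Longrightarrow> f (x s) = of_bool (R s t)"
proof -
  define h where "h s = (x s, of_bool (R s t) :: real)" for s
  have bd: "r \<le> L * norm w" if wr0: "(w, r) \<in> span (h ` V)" for w r
  proof -
    obtain T c where T: "finite T" "T \<subseteq> h ` V" "(w, r) = (\<Sum>v\<in>T. c v *\<^sub>R v)"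
      using wr0 unfolding span_explicit by auto
    obtain S where S: "S \<subseteq> V" "inj_on h S" "T = h ` S" using T(2) by (meson subset_image_inj)
    have finS: "finite S" using T(1) S finite_image_iff by blast
    \<comment> \<open>\<open>t\<close> may be absent from \<open>S\<close>. It joins with
      coefficient 0, because the lower estimate only speaks of nodes in the set.\<close>
    define a where "a s = (if s \<in> S then c (h s) else 0)" for s
    have wr: "(w, r) = (\<Sum>s\<in>S. c (h s) *\<^sub>R h s)" using T(3) S by (simp add: sum.reindex)
    have "w = (\<Sum>s\<in>S. c (h s) *\<^sub>R x s)"
      using arg_cong[OF wr, of fst] by (simp add: h_def fst_sum)
    also have "\<dots> = (\<Sum>s\<in>insert t S. a s *\<^sub>R x s)"
      using finS by (intro sum.mono_neutral_cong_left) (auto simp: a_def)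
    finally have w: "w = (\<Sum>s\<in>insert t S. a s *\<^sub>R x s)" .
    have "r = (\<Sum>s\<in>S. c (h s) * of_bool (R s t))"
      using arg_cong[OF wr, of snd] by (simp add: h_def snd_sum)
    also have "\<dots> = bsum R (insert t S) a t"
      unfolding bsum_def using finS by (intro sum.mono_neutral_cong) (auto simp: a_def)
    finally have "r = bsum R (insert t S) a t" .
    moreover have "\<bar>bsum R (insert t S) a t\<bar> \<le> L * norm w"
      unfolding w using S t finS by (intro lower_estD[OF est]) auto
    ultimately show ?thesis by linarith
  qed
  obtain f where f: "linear f" "\<And>x y. (x, y) \<in> span (h ` V) \<Longrightarrow> f x = y" "\<And>w. \<bar>f w\<bar> \<le> L * norm w"
    using hahn_banach_graph[OF subspace_span bd L] by blast
  show ?thesis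
  proof
    show "f (x s) = of_bool (R s t)" if "s \<in> V" for s
      using f(2)[of "x s" "of_bool (R s t)"] that by (simp add: h_def span_base)
  qed (use f in auto)
qed

lemma separating_functional:
  fixes E :: "'a::real_normed_vector set"
  assumes E: "closed E" "subspace E" and b: "b \<notin> E"
  obtains f where "linear f" "\<And>w. \<bar>f w\<bar> \<le> (1 / infdist b E) * norm w" "f b = 1" "\<And>e. e \<in> E \<Longrightarrow> f e = 0"
proof -
  have d: "0 < infdist b E"
    using E b by (metis empty_iff in_closed_iff_infdist_zero infdist_nonneg less_le subspace_0)
  define G0 where "G0 = span (insert (b, 1::real) (E \<times> {0}))"
  have sub: "subspace G0" by (simp add: G0_def)
  have eq: "span (E \<times> {0::real}) = E \<times> {0}" using E(2) by (intro span_eq_iff[THEN iffD2] subspace_Times) auto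
  have mem: "w - t *\<^sub>R b \<in> E" if "(w, t) \<in> G0" for w t
    using that unfolding G0_def span_breakdown_eq eq by auto
  have bd: "t \<le> (1 / infdist b E) * norm w" if wt: "(w, t) \<in> G0" for w t
  proof (cases "t \<le> 0")
    case True
    have "0 \<le> (1 / infdist b E) * norm w" using d by simp
    then show ?thesis using True by linarith
  next
    case False
    define e where "e = w - t *\<^sub>R b"
    have e: "w = e + t *\<^sub>R b" "e \<in> E" using mem[OF wt] by (auto simp: e_def)
    have "infdist b E \<le> dist b (- inverse t *\<^sub>R e)"
      by (rule infdist_le[OF subspace_scale[OF E(2) e(2)]])
    then have "t * infdist b E \<le> t * norm (b + inverse t *\<^sub>R e)"
      using False by (simp add: dist_norm)
    also have "\<dots> = norm (t *\<^sub>R (b + inverse t *\<^sub>R e))" using False by simp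
    also have "\<dots> = norm w" using False e by (simp add: scaleR_add_right add.commute)
    finally show ?thesis using d by (simp add: field_simps)
  qed
  obtain f where f: "linear f" "\<And>x y. (x, y) \<in> G0 \<Longrightarrow> f x = y" "\<And>w. \<bar>f w\<bar> \<le> (1 / infdist b E) * norm w"
    using hahn_banach_graph[OF sub bd] d by auto
  show ?thesis
  proof
    show "f b = 1" using f(2) by (simp add: G0_def span_base)
    show "f e = 0" if "e \<in> E" for e using f(2) that by (simp add: G0_def span_base)
  qed (use f in auto)
qed

lemma continuous_on_functional:
  fixes f :: "'a::real_normed_vector \<Rightarrow> real"
  assumes "linear f" "\<And>w. \<bar>f w\<bar> \<le> C * norm w"
  shows "continuous_on S f"
proof -
  have "bounded_linear f"
    using assms by (intro bounded_linear_intro[where K = C]) (auto simp: linear_add linear_scale mult.commute)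
  then show ?thesis by (rule linear_continuous_on)
qed

text \<open>The functional that vanishes on \<open>span B\<close> and is 1 at \<open>b\<close> gives
  the \<open>b\<close>-coordinate continuously, so the larger span is a continuous preimage of the
  smaller one.\<close>

lemma closed_span_finite:
  fixes B :: "'a::real_normed_vector set"
  assumes "finite B"
  shows "closed (span B)"
  using assms
proof (induction B rule: finite_induct)
  case empty
  then show ?case by simp
next
  case (insert b B)
  show ?case
  proof (cases "b \<in> span B")
    case True
    then show ?thesis using insert by (simp add: span_redundant)
  next
    case False
    obtain f where f: "linear f" "\<And>w. \<bar>f w\<bar> \<le> (1 / infdist b (span B)) * norm w" "f b = 1"
      "\<And>e. e \<in> span B \<Longrightarrow> f e = 0"
      using separating_functional[OF insert.IH subspace_span False] by metis
    have "span (insert b B) = (\<lambda>w. w - f w *\<^sub>R b) -` span B"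
    proof (rule set_eqI)
      fix w
      show "w \<in> span (insert b B) \<longleftrightarrow> w \<in> (\<lambda>w. w - f w *\<^sub>R b) -` span B"
      proof
        assume "w \<in> span (insert b B)"
        then obtain k where k: "w - k *\<^sub>R b \<in> span B" by (auto simp: span_breakdown_eq)
        then have "f (w - k *\<^sub>R b) = 0" by (rule f(4))
        then have "f w = k" using f(1,3) by (simp add: linear_diff linear_scale)
        then show "w \<in> (\<lambda>w. w - f w *\<^sub>R b) -` span B" using k by simp
      qed (auto simp: span_breakdown_eq)
    qed
    moreover have "continuous_on UNIV (\<lambda>w. w - f w *\<^sub>R b)"
      by (intro continuous_intros continuous_on_functional[OF f(1,2)])
    ultimately show ?thesis using insert.IH by (simp add: continuous_on_closed_vimage)
  qed
qed

text \<open>Riesz lemma together with its functionals. The vector is chosen with distance to the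
  earlier span more than half its norm, which bounds its functional by 2. The relation is
  triangular: \<open>f n\<close> is not controlled on later vectors.\<close>

lemma riesz_sequence:
  assumes infdim: "\<not> (\<exists>B :: 'a::real_normed_vector set. finite B \<and> span B = UNIV)"
  obtains r :: "nat \<Rightarrow> 'a::real_normed_vector" and f where "\<And>n. norm (r n) = 1" "\<And>n. linear (f n)"
    "\<And>n w. \<bar>f n w\<bar> \<le> 2 * norm w" "\<And>n. f n (r n) = (1::real)" "\<And>m n. m < n \<Longrightarrow> f n (r m) = 0"
proof -
  define P where "P = (\<lambda>(r :: nat \<Rightarrow> 'a) n v. norm v = 1 \<and> (\<exists>f. linear f \<and> (\<forall>w. \<bar>f w\<bar> \<le> 2 * norm w)
    \<and> f v = (1::real) \<and> (\<forall>m<n. f (r m) = 0)))"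
  have "\<exists>r. \<forall>n. P r n (r n)"
  proof (rule dependent_wellorder_choice)
    show "P f n v = P g n v" if "\<And>m. m < n \<Longrightarrow> f m = g m" for f g n v
      unfolding P_def using that by simp
    fix n and r :: "nat \<Rightarrow> 'a"
    define E where "E = span (r ` {..<n})"
    have clE: "closed E" unfolding E_def by (intro closed_span_finite) simp
    have sE: "subspace E" unfolding E_def by simp
    have "E \<noteq> UNIV" using infdim unfolding E_def by blast
    then obtain x where x: "x \<notin> E" by blast
    have d: "0 < infdist x E"
      using clE sE x by (metis empty_iff in_closed_iff_infdist_zero infdist_nonneg less_le subspace_0)
    have "\<exists>e\<in>E. dist x e < 2 * infdist x E"
    proof (rule ccontr)
      assume "\<not> ?thesis"
      then have "2 * infdist x E \<le> (INF e\<in>E. dist x e)"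
        using subspace_0[OF sE] by (intro cINF_greatest) (auto simp: not_less)
      also have "\<dots> = infdist x E" using subspace_0[OF sE] by (intro infdist_notempty[symmetric]) auto
      finally have "2 * infdist x E \<le> infdist x E" .
      then show False using d by simp
    qed
    then obtain e where e: "e \<in> E" "dist x e < 2 * infdist x E" by blast
    define c where "c = norm (x - e)"
    have c: "0 < c" "c \<le> 2 * infdist x E" using e x by (auto simp: c_def dist_norm)
    obtain f where f: "linear f" "\<And>w. \<bar>f w\<bar> \<le> (1 / infdist x E) * norm w" "f x = 1" "\<And>e. e \<in> E \<Longrightarrow> f e = 0"
      using separating_functional[OF clE sE x] by metis
    define v where "v = inverse c *\<^sub>R (x - e)"
    define g where "g w = c * f w" for w
    have "norm v = 1" using c by (simp add: v_def c_def)
    moreover have "linear g" unfolding g_def using f(1)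
      by (intro linearI) (auto simp: linear_add linear_scale distrib_left)
    moreover have "\<bar>g w\<bar> \<le> 2 * norm w" for w
    proof -
      have "\<bar>g w\<bar> \<le> c * ((1 / infdist x E) * norm w)"
        unfolding g_def abs_mult using c f(2)[of w] by (intro mult_mono) auto
      also have "\<dots> \<le> (2 * infdist x E) * ((1 / infdist x E) * norm w)"
        using c d by (intro mult_right_mono) auto
      finally show ?thesis using d by simp
    qed
    moreover have "g v = 1"
      unfolding g_def v_def using f(1) f(3) f(4)[OF e(1)] c by (simp add: linear_scale linear_diff)
    moreover have "\<forall>m<n. g (r m) = 0"
      unfolding g_def using f(4) by (auto simp: E_def span_base)
    ultimately show "\<exists>v. P r n v" unfolding P_def by blast
  qed
  then obtain r where "\<And>n. P r n (r n)" by blast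
  then obtain f where "\<And>n. norm (r n) = 1 \<and> linear (f n) \<and> (\<forall>w. \<bar>f n w\<bar> \<le> 2 * norm w)
    \<and> f n (r n) = (1::real) \<and> (\<forall>m<n. f n (r m) = 0)" unfolding P_def by metis
  then show ?thesis using that by blast
qed

section \<open>Well-founded and spreading trees, and functionals coherent along them\<close>

section \<open>Trees of finite sequences and admissible functionals\<close>

definition tree :: "nat list set \<Rightarrow> bool" where
  "tree A \<longleftrightarrow> (\<forall>u v. u @ v \<in> A \<longrightarrow> u \<in> A)"

definition no_branch :: "nat list set \<Rightarrow> bool" where
  "no_branch A \<longleftrightarrow> (\<nexists>f :: nat \<Rightarrow> nat. \<forall>n. map f [0..<n] \<in> A)"

text \<open>A node with one child then has infinitely many, so functionals at the children have
  cluster points, and a node can be exchanged for one with larger entries inside the tree.\<close>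

definition spreading :: "nat list set \<Rightarrow> bool" where
  "spreading A \<longleftrightarrow> (\<forall>u v. u \<in> A \<longrightarrow> list_all2 (\<le>) u v \<longrightarrow> v \<in> A)"

lemma treeD: "tree A \<Longrightarrow> u @ v \<in> A \<Longrightarrow> u \<in> A"
  by (auto simp: tree_def)

lemma tree_prefix: "tree A \<Longrightarrow> v \<in> A \<Longrightarrow> prefix u v \<Longrightarrow> u \<in> A"
  by (auto simp: tree_def prefix_def)

lemma spreadingD: "spreading A \<Longrightarrow> u \<in> A \<Longrightarrow> list_all2 (\<le>) u v \<Longrightarrow> v \<in> A"
  by (auto simp: spreading_def)

lemma spreading_infinite_children:
  assumes "spreading A" "u @ [n] \<in> A"
  shows "infinite {m. u @ [m] \<in> A}"
proof
  have "u @ [m] \<in> A" if "n \<le> m" for m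
    using spreadingD[OF assms, of "u @ [m]"] that by (simp add: list_all2_appendI list_all2_refl)
  then have "{n..} \<subseteq> {m. u @ [m] \<in> A}" by auto
  moreover assume "finite {m. u @ [m] \<in> A}"
  ultimately show False using infinite_Ici finite_subset by blast
qed

lemma branch_of_chain:
  fixes g :: "nat \<Rightarrow> nat list"
  assumes tr: "tree A" and g: "\<And>k. g k \<in> A" "\<And>k. \<exists>n. g (Suc k) = g k @ [n]"
  shows "\<not> no_branch A"
proof -
  have len: "k \<le> length (g k)" for k
  proof (induction k)
    case (Suc k)
    then show ?case using g(2)[of k] by auto
  qed simp
  have pre: "prefix (g k) (g (k + j))" for k j
  proof (induction j)
    case (Suc j)
    obtain n where "g (Suc (k + j)) = g (k + j) @ [n]" using g(2) by blast
    then show ?case using Suc by (simp add: prefix_order.trans[of _ "g (k + j)"])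
  qed simp
  define f where "f i = g (Suc i) ! i" for i
  have "map f [0..<n] = take n (g n)" for n
  proof (rule nth_equalityI)
    show "length (map f [0..<n]) = length (take n (g n))" using len[of n] by simp
    fix i assume i: "i < length (map f [0..<n])"
    then have "prefix (g (Suc i)) (g n)" using pre[of "Suc i" "n - Suc i"] by simp
    then obtain w where "g n = g (Suc i) @ w" by (auto simp: prefix_def)
    then show "map f [0..<n] ! i = take n (g n) ! i"
      using i len[of "Suc i"] by (simp add: f_def nth_append)
  qed
  then have "map f [0..<n] \<in> A" for n
    using tree_prefix[OF tr g(1)[of n] take_is_prefix[of n]] by simp
  then show ?thesis unfolding no_branch_def by blast
qed

lemma bar_induction [consumes 3, case_names step]:
  assumes nb: "no_branch A" and tr: "tree A" and u: "u \<in> A"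
    and step: "\<And>u. u \<in> A \<Longrightarrow> (\<And>n. u @ [n] \<in> A \<Longrightarrow> P (u @ [n])) \<Longrightarrow> P u"
  shows "P u"
proof (rule ccontr)
  assume "\<not> P u"
  have "\<exists>g. \<forall>k. (g k \<in> A \<and> \<not> P (g k)) \<and> (\<exists>n. g (Suc k) = g k @ [n])"
  proof (rule dependent_nat_choice)
    show "\<exists>v. v \<in> A \<and> \<not> P v" using u \<open>\<not> P u\<close> by blast
    show "\<exists>w. (w \<in> A \<and> \<not> P w) \<and> (\<exists>n. w = v @ [n])" if "v \<in> A \<and> \<not> P v" for v k
      using that step[of v] by blast
  qed
  then show False using branch_of_chain[OF tr] nb by blast
qed

definition spread :: "nat list set \<Rightarrow> nat list set" where
  "spread C = {v. \<exists>u\<in>C. list_all2 (\<le>) u v}"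

lemma tree_spread: "tree C \<Longrightarrow> tree (spread C)"
  unfolding tree_def spread_def by (auto simp: list_all2_append2)

lemma spreading_spread: "spreading (spread C)"
  unfolding spreading_def spread_def by (auto intro: list_all2_trans[OF order_trans])

text \<open>Koenig's lemma: along a branch \<open>f\<close> of \<open>spread C\<close>, the
  sequences of \<open>C\<close> below \<open>f\<close> have every length, and they form a finitely
  branching tree since entry \<open>i\<close> is at most \<open>f i\<close>. Its branch lies in
  \<open>C\<close>.\<close>

lemma no_branch_spread:
  assumes tr: "tree C" and nb: "no_branch C"
  shows "no_branch (spread C)"
  unfolding no_branch_def
proof (rule notI, elim exE)
  fix f assume f: "\<forall>n. map f [0..<n] \<in> spread C"
  define good where "good s \<longleftrightarrow> (\<forall>n\<ge>length s. \<exists>u\<in>C. prefix s u \<and> length u = n \<and> (\<forall>i<n. u ! i \<le> f i))" for s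
  have "\<exists>g. \<forall>k. good (g k) \<and> (\<exists>n. g (Suc k) = g k @ [n])"
  proof (rule dependent_nat_choice)
    have "good []" unfolding good_def
    proof (intro allI impI)
      fix n
      obtain u where "u \<in> C" "list_all2 (\<le>) u (map f [0..<n])" using f unfolding spread_def by blast
      then show "\<exists>u\<in>C. prefix [] u \<and> length u = n \<and> (\<forall>i<n. u ! i \<le> f i)"
        by (auto simp: list_all2_conv_all_nth)
    qed
    then show "\<exists>s. good s" by blast
    fix s and k :: nat assume s: "good s"
    show "\<exists>t. good t \<and> (\<exists>n. t = s @ [n])"
    proof (rule ccontr)
      assume no: "\<not> ?thesis"
      have "\<forall>j. \<exists>n\<ge>length (s @ [j]). \<not> (\<exists>u\<in>C. prefix (s @ [j]) u \<and> length u = n \<and> (\<forall>i<n. u ! i \<le> f i))"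
        using no unfolding good_def by blast
      then obtain N where N: "\<And>j. Suc (length s) \<le> N j"
        "\<And>j. \<not> (\<exists>u\<in>C. prefix (s @ [j]) u \<and> length u = N j \<and> (\<forall>i<N j. u ! i \<le> f i))"
        unfolding length_append by (simp, metis)
      \<comment> \<open>If every candidate entry \<open>j\<close> failed, at some length
        \<open>N j\<close>, a witness longer than all these lengths would still pass through some
        \<open>j\<close>; cut off at \<open>N j\<close> it contradicts that failure.\<close>
      define M where "M = Suc (length s) + (\<Sum>j\<le>f (length s). N j)"
      have NM: "N j \<le> M" if "j \<le> f (length s)" for j
        using member_le_sum[of j "{..f (length s)}" N] that unfolding M_def by simp
      have "length s \<le> M" by (simp add: M_def)
      then obtain u where u: "u \<in> C" "prefix s u" "length u = M" "\<forall>i<M. u ! i \<le> f i"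
        using s unfolding good_def by blast
      define j where "j = u ! length s"
      have jf: "j \<le> f (length s)" using u(4) by (simp add: j_def M_def)
      have lt: "length s < length u" using u(3) by (simp add: M_def)
      have tk: "take (Suc (length s)) u = s @ [j]"
        using u(2) lt by (auto simp: take_Suc_conv_app_nth j_def prefix_def)
      have "prefix (s @ [j]) (take (N j) u)"
        using take_is_prefix[of "Suc (length s)" "take (N j) u"] tk N(1)[of j] by (simp add: take_take min_absorb1)
      moreover have "take (N j) u \<in> C" by (rule tree_prefix[OF tr u(1) take_is_prefix])
      ultimately have "take (N j) u \<in> C \<and> prefix (s @ [j]) (take (N j) u) \<and> length (take (N j) u) = N j \<and> (\<forall>i<N j. take (N j) u ! i \<le> f i)"
        using u(3,4) NM[OF jf] by simp
      then show False using N(2) by blast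
    qed
  qed
  then obtain g where g: "\<And>k. good (g k)" "\<And>k. \<exists>n. g (Suc k) = g k @ [n]" by blast
  have "g k \<in> C" for k
    using g(1)[of k] tree_prefix[OF tr] unfolding good_def by blast
  then show False using branch_of_chain[where g = g, OF tr _ g(2)] nb by blast
qed

definition subtree :: "nat list set \<Rightarrow> nat list \<Rightarrow> nat list set" where
  "subtree A s = {u. s @ u \<in> A}"

lemma tree_subtree: "tree A \<Longrightarrow> tree (subtree A s)"
  unfolding tree_def subtree_def by (metis append.assoc mem_Collect_eq)

lemma spreading_subtree: "spreading A \<Longrightarrow> spreading (subtree A s)"
  unfolding spreading_def subtree_def by (simp add: list_all2_appendI list_all2_refl)

lemma no_branch_subtree:
  assumes tr: "tree A" and nb: "no_branch A"
  shows "no_branch (subtree A s)"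
  unfolding no_branch_def
proof (rule notI, elim exE)
  fix f assume f: "\<forall>n. map f [0..<n] \<in> subtree A s"
  have "\<not> no_branch A"
  proof (rule branch_of_chain[OF tr])
    show "s @ map f [0..<k] \<in> A" for k using f by (auto simp: subtree_def)
    show "\<exists>n. s @ map f [0..<Suc k] = (s @ map f [0..<k]) @ [n]" for k by simp
  qed
  then show False using nb by blast
qed

text \<open>\<open>\<theta> u\<close> is a functional relative to the root, whose own functional has
  been subtracted. The subtraction doubles norms, so 4 fits the Riesz functionals of norm at most 2.
  The condition on siblings is triangular because a Riesz sequence gives no more.\<close>

definition admissible :: "nat list set \<Rightarrow> (nat list \<Rightarrow> 'a::real_normed_vector) \<Rightarrow> (nat list \<Rightarrow> 'a \<Rightarrow> real) \<Rightarrow> bool" where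
  "admissible A x \<theta> \<longleftrightarrow> (\<forall>u. linear (\<theta> u)) \<and> (\<forall>u w. \<bar>\<theta> u w\<bar> \<le> 4 * norm w) \<and> (\<forall>w. \<theta> [] w = 0)
     \<and> (\<forall>u\<in>A - {[]}. \<theta> u (x u) = 1)
     \<and> (\<forall>u n n'. n' < n \<longrightarrow> u @ [n] \<in> A \<longrightarrow> u @ [n'] \<in> A \<longrightarrow> \<theta> (u @ [n]) (x (u @ [n'])) = 0)
     \<and> (\<forall>u n V e. u @ [n] \<in> A \<longrightarrow> finite V \<longrightarrow> 0 < e \<longrightarrow>
          infinite {m. u @ [m] \<in> A \<and> (\<forall>v\<in>V. \<bar>\<theta> (u @ [m]) v - \<theta> u v\<bar> < e)})"

lemma admissibleD:
  assumes "admissible A x \<theta>"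
  shows "linear (\<theta> u)" "\<bar>\<theta> u w\<bar> \<le> 4 * norm w" "\<theta> [] w = 0" "u \<in> A \<Longrightarrow> u \<noteq> [] \<Longrightarrow> \<theta> u (x u) = 1"
    "n' < n \<Longrightarrow> u @ [n] \<in> A \<Longrightarrow> u @ [n'] \<in> A \<Longrightarrow> \<theta> (u @ [n]) (x (u @ [n'])) = 0"
    "u @ [n] \<in> A \<Longrightarrow> finite V \<Longrightarrow> 0 < e \<Longrightarrow>
          infinite {m. u @ [m] \<in> A \<and> (\<forall>v\<in>V. \<bar>\<theta> (u @ [m]) v - \<theta> u v\<bar> < e)}"
  using assms unfolding admissible_def by auto

lemma admissible_trivial: "A \<subseteq> {[]} \<Longrightarrow> admissible A x (\<lambda>_ _. 0)"
  unfolding admissible_def by (auto intro: linear_zero)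

text \<open>Refers to \<open>\<Phi>\<close> only at \<open>v\<close> and its children, so that
  functionals constructed separately above the children of a node can be glued.\<close>

definition coherent_at :: "nat list set \<Rightarrow> (nat list \<Rightarrow> 'a::real_normed_vector) \<Rightarrow> (nat list \<Rightarrow> 'a \<Rightarrow> real) \<Rightarrow> nat list \<Rightarrow> bool" where
  "coherent_at A x \<Phi> v \<longleftrightarrow> linear (\<Phi> v) \<and> (\<forall>w. \<bar>\<Phi> v w\<bar> \<le> 1 * norm w)
     \<and> (\<forall>w\<in>A - {[]}. \<Phi> v (x w) = of_bool (prefix w v))
     \<and> (\<forall>n V e. v @ [n] \<in> A \<longrightarrow> finite V \<longrightarrow> 0 < e \<longrightarrow>
          infinite {m. v @ [m] \<in> A \<and> (\<forall>z\<in>V. \<bar>\<Phi> (v @ [m]) z - \<Phi> v z\<bar> < e)})"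

text \<open>Leaves receive Hahn-Banach functionals, inner nodes cluster points of those at their
  children. The values on the system survive: for fixed \<open>w\<close>, all children
  \<open>u @ [n]\<close> except possibly \<open>w\<close> itself decide \<open>prefix w\<close> as
  \<open>u\<close> does. Independent Hahn-Banach extensions at all nodes would have the same values
  there, but no limit relation on other vectors.\<close>

lemma coherent_functionals:
  fixes x :: "nat list \<Rightarrow> 'a::real_normed_vector"
  assumes tr: "tree A" and nb: "no_branch A" and sp: "spreading A"
    and est: "\<And>S. finite S \<Longrightarrow> S \<subseteq> A - {[]} \<Longrightarrow> lower_est prefix 1 x S" and u: "u \<in> A"
  shows "\<exists>\<Phi>. \<forall>v. prefix u v \<longrightarrow> v \<in> A \<longrightarrow> coherent_at A x \<Phi> v"
  using nb tr u
proof (induction u rule: bar_induction)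
  case (step u)
  show ?case
  proof (cases "\<exists>n. u @ [n] \<in> A")
    case False
    have "\<exists>f. linear f \<and> (\<forall>w. \<bar>f w\<bar> \<le> 1 * norm w) \<and> (\<forall>w\<in>A - {[]}. f (x w) = of_bool (prefix w u))"
    proof (cases "u = []")
      case True
      then show ?thesis by (intro exI[of _ "\<lambda>_. 0"]) (auto intro: linear_zero)
    next
      case False
      then have "u \<in> A - {[]}" using step by blast
      then show ?thesis
        by (rule lower_est_functional[OF forest_order_prefix est, rotated 3]) auto
    qed
    then obtain f where f: "linear f" "\<forall>w. \<bar>f w\<bar> \<le> 1 * norm w" "\<forall>w\<in>A - {[]}. f (x w) = of_bool (prefix w u)"
      by blast
    have only: "v = u" if uv: "prefix u v" "v \<in> A" for v
    proof (rule ccontr)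
      assume "v \<noteq> u"
      then obtain n w where "v = u @ n # w" using uv(1) by (metis append.right_neutral list.exhaust prefixE)
      then have "(u @ [n]) @ w \<in> A" using uv(2) by simp
      then show False using treeD[OF tr] False by blast
    qed
    have "coherent_at A x (\<lambda>_. f) u" unfolding coherent_at_def using f False by blast
    then show ?thesis using only by (intro exI[of _ "\<lambda>_. f"]) blast
  next
    case True
    define Z where "Z = {n. u @ [n] \<in> A}"
    have inf: "infinite Z" unfolding Z_def using True spreading_infinite_children[OF sp] by blast
    have "\<forall>n\<in>Z. \<exists>\<Phi>. \<forall>v. prefix (u @ [n]) v \<longrightarrow> v \<in> A \<longrightarrow> coherent_at A x \<Phi> v" using step by (simp add: Z_def)
    then obtain \<Psi> where \<Psi>: "\<And>n v. n \<in> Z \<Longrightarrow> prefix (u @ [n]) v \<Longrightarrow> v \<in> A \<Longrightarrow> coherent_at A x (\<Psi> n) v" by metis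
    have Zself: "n \<in> Z \<Longrightarrow> coherent_at A x (\<Psi> n) (u @ [n])" for n by (rule \<Psi>) (auto simp: Z_def)
    obtain h where h: "linear h" "\<And>w. \<bar>h w\<bar> \<le> 1 * norm w"
      "\<And>V e. finite V \<Longrightarrow> 0 < e \<Longrightarrow> infinite {n \<in> Z. \<forall>v\<in>V. \<bar>\<Psi> n (u @ [n]) v - h v\<bar> < e}"
      using cluster_linear_functional[of Z "\<lambda>n. \<Psi> n (u @ [n])" 1, OF inf] Zself
      unfolding coherent_at_def by blast
    have hx: "h (x w) = of_bool (prefix w u)" if w: "w \<in> A - {[]}" for w
    proof (rule ccontr)
      define d where "d = \<bar>h (x w) - of_bool (prefix w u)\<bar>"
      assume "h (x w) \<noteq> of_bool (prefix w u)"
      then have d: "0 < d" by (simp add: d_def)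
      have "infinite ({n \<in> Z. \<forall>v\<in>{x w}. \<bar>\<Psi> n (u @ [n]) v - h v\<bar> < d} - {n. u @ [n] = w})"
        using h(3)[OF _ d, of "{x w}"] by (intro Diff_infinite_finite) (auto simp: finite_nat_set_iff_bounded_le)
      from infinite_imp_nonempty[OF this]
      obtain n where n: "n \<in> Z" "\<bar>\<Psi> n (u @ [n]) (x w) - h (x w)\<bar> < d" "u @ [n] \<noteq> w" by auto
      have "\<Psi> n (u @ [n]) (x w) = of_bool (prefix w (u @ [n]))" using Zself[OF n(1)] w unfolding coherent_at_def by blast
      moreover have "prefix w (u @ [n]) \<longleftrightarrow> prefix w u" using n(3) by (auto simp: prefix_snoc)
      ultimately have "\<Psi> n (u @ [n]) (x w) = of_bool (prefix w u)" by (simp only:)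
      then show False using n(2) by (simp add: d_def abs_minus_commute)
    qed
    \<comment> \<open>\<open>v ! length u\<close> is the label of the child of \<open>u\<close>
      below \<open>v\<close>, hence selects the family to be used at \<open>v\<close>.\<close>
    define \<Phi> where "\<Phi> v = (if v = u then h else \<Psi> (v ! length u) v)" for v
    have \<Phi>n: "\<Phi> v = \<Psi> n v" if "prefix (u @ [n]) v" for v n
      using that by (auto simp: \<Phi>_def prefix_def nth_append)
    have "coherent_at A x \<Phi> v" if v: "prefix u v" "v \<in> A" for v
    proof (cases "v = u")
      case True
      have "\<Phi> u = h" by (simp add: \<Phi>_def)
      moreover have "\<Phi> (u @ [m]) = \<Psi> m (u @ [m])" for m by (rule \<Phi>n) simp
      ultimately show ?thesis using True h hx unfolding Z_def coherent_at_def by auto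
    next
      case False
      then obtain n w where nw: "v = u @ n # w" using v(1) by (metis append.right_neutral list.exhaust prefixE)
      then have pre: "prefix (u @ [n]) v" by simp
      have nZ: "n \<in> Z" using tree_prefix[OF tr v(2) pre] by (simp add: Z_def)
      have "\<Phi> v = \<Psi> n v" "\<And>m. \<Phi> (v @ [m]) = \<Psi> n (v @ [m])" using \<Phi>n pre by auto
      then show ?thesis using \<Psi>[OF nZ pre v(2)] by (simp add: coherent_at_def)
    qed
    then show ?thesis by blast
  qed
qed

text \<open>Subtracting \<open>\<Phi> []\<close> changes nothing on the system, since no nonempty
  node is a prefix of the root. It serves the vectors of other components: there a functional is
  compared with its parent again and again, and this comparison has to end at 0.\<close>

lemma admissible_of_lower_est:
  fixes x :: "nat list \<Rightarrow> 'a::real_normed_vector"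
  assumes tr: "tree A" and nb: "no_branch A" and sp: "spreading A"
    and est: "\<And>S. finite S \<Longrightarrow> S \<subseteq> A - {[]} \<Longrightarrow> lower_est prefix 1 x S"
  shows "\<exists>\<theta>. admissible A x \<theta>"
proof (cases "[] \<in> A")
  case False
  then have "A = {}" using treeD[OF tr, of "[]"] by auto
  then show ?thesis using admissible_trivial[of A x] by blast
next
  case True
  obtain \<Phi> where coh: "\<And>v. v \<in> A \<Longrightarrow> coherent_at A x \<Phi> v"
    using coherent_functionals[OF tr nb sp est True] by auto
  have \<Phi>: "\<And>v. v \<in> A \<Longrightarrow> linear (\<Phi> v)" "\<And>v w. v \<in> A \<Longrightarrow> \<bar>\<Phi> v w\<bar> \<le> norm w"
     "\<And>v w. v \<in> A \<Longrightarrow> w \<in> A \<Longrightarrow> w \<noteq> [] \<Longrightarrow> \<Phi> v (x w) = of_bool (prefix w v)"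
     "\<And>v n V e. v \<in> A \<Longrightarrow> v @ [n] \<in> A \<Longrightarrow> finite V \<Longrightarrow> 0 < e \<Longrightarrow>
          infinite {m. v @ [m] \<in> A \<and> (\<forall>z\<in>V. \<bar>\<Phi> (v @ [m]) z - \<Phi> v z\<bar> < e)}"
    using coh unfolding coherent_at_def by auto
  define \<theta> where "\<theta> u w = (if u \<in> A then \<Phi> u w - \<Phi> [] w else 0)" for u w
  have "admissible A x \<theta>"
    unfolding admissible_def
  proof (intro conjI allI ballI impI)
    show "linear (\<theta> u)" for u
      unfolding \<theta>_def using \<Phi>(1)[of u] \<Phi>(1)[OF True]
      by (cases "u \<in> A") (auto intro: linear_zero linear_compose_sub)
    show "\<bar>\<theta> u w\<bar> \<le> 4 * norm w" for u w
      unfolding \<theta>_def using \<Phi>(2)[of u w] \<Phi>(2)[OF True, of w] by auto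
    show "\<theta> [] w = 0" for w by (simp add: \<theta>_def)
    show "\<theta> u (x u) = 1" if "u \<in> A - {[]}" for u
      using that \<Phi>(3)[of u u] \<Phi>(3)[OF True, of u] by (simp add: \<theta>_def)
    show "\<theta> (u @ [n]) (x (u @ [n'])) = 0" if "n' < n" "u @ [n] \<in> A" "u @ [n'] \<in> A" for u n n'
      using that \<Phi>(3)[of "u @ [n]" "u @ [n']"] \<Phi>(3)[OF True, of "u @ [n']"] by (simp add: \<theta>_def)
    fix u n and V :: "'a set" and e :: real assume un: "u @ [n] \<in> A" and "finite V" "0 < e"
    then have uA: "u \<in> A" using treeD[OF tr] by blast
    have "{m. u @ [m] \<in> A \<and> (\<forall>v\<in>V. \<bar>\<theta> (u @ [m]) v - \<theta> u v\<bar> < e)}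
      = {m. u @ [m] \<in> A \<and> (\<forall>v\<in>V. \<bar>\<Phi> (u @ [m]) v - \<Phi> u v\<bar> < e)}"
      using uA by (auto simp: \<theta>_def)
    then show "infinite {m. u @ [m] \<in> A \<and> (\<forall>v\<in>V. \<bar>\<theta> (u @ [m]) v - \<theta> u v\<bar> < e)}"
      using \<Phi>(4)[OF uA un \<open>finite V\<close> \<open>0 < e\<close>] by simp
  qed
  then show ?thesis by blast
qed

text \<open>A cluster point \<open>h\<close> of the \<open>f n\<close> vanishes at every
  \<open>r m\<close>, because \<open>f n\<close> does for \<open>n > m\<close>. So
  \<open>f n - h\<close> keeps the triangular relations and clusters at 0.\<close>

lemma admissible_riesz:
  fixes r :: "nat \<Rightarrow> 'a::real_normed_vector"
  assumes f: "\<And>n. linear (f n)" "\<And>n w. \<bar>f n w\<bar> \<le> 2 * norm w" "\<And>n. f n (r n) = (1::real)"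
    "\<And>m n. m < n \<Longrightarrow> f n (r m) = 0"
  shows "\<exists>\<theta>. admissible {u. length u \<le> 1} (\<lambda>u. r (hd u)) \<theta>"
proof -
  obtain h where h: "linear h" "\<And>w. \<bar>h w\<bar> \<le> 2 * norm w"
      "\<And>V e. finite V \<Longrightarrow> 0 < e \<Longrightarrow> infinite {n \<in> UNIV. \<forall>v\<in>V. \<bar>f n v - h v\<bar> < e}"
    using cluster_linear_functional[of UNIV f 2, OF infinite_UNIV_nat] f(1,2) by blast
  have hr: "h (r m) = 0" for m
  proof (rule ccontr)
    assume "h (r m) \<noteq> 0"
    then have d: "0 < \<bar>h (r m)\<bar>" by simp
    have "infinite ({n \<in> UNIV. \<forall>v\<in>{r m}. \<bar>f n v - h v\<bar> < \<bar>h (r m)\<bar>} - {..m})"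
      using h(3)[OF _ d, of "{r m}"] by (intro Diff_infinite_finite) auto
    from infinite_imp_nonempty[OF this]
    obtain n where n: "\<bar>f n (r m) - h (r m)\<bar> < \<bar>h (r m)\<bar>" "n \<notin> {..m}" by auto
    then show False using f(4) by simp
  qed
  define \<theta> where "\<theta> u w = (if u = [] then 0 else f (hd u) w - h w)" for u :: "nat list" and w
  have "admissible {u. length u \<le> 1} (\<lambda>u. r (hd u)) \<theta>"
    unfolding admissible_def
  proof (intro conjI allI ballI impI)
    show "linear (\<theta> u)" for u
      unfolding \<theta>_def using f(1)[of "hd u"] h(1) by (cases "u = []") (auto intro: linear_zero linear_compose_sub)
    show "\<bar>\<theta> u w\<bar> \<le> 4 * norm w" for u w
      unfolding \<theta>_def using f(2)[of "hd u" w] h(2)[of w] by auto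
    show "\<theta> [] w = 0" for w by (simp add: \<theta>_def)
    show "\<theta> u (r (hd u)) = 1" if "u \<in> {u. length u \<le> 1} - {[]}" for u
      using that by (simp add: \<theta>_def f(3) hr)
    show "\<theta> (u @ [n]) (r (hd (u @ [n']))) = 0" if "n' < n" "u @ [n] \<in> {u. length u \<le> 1}" for u n n'
      using that by (simp add: \<theta>_def f(4) hr)
    fix u :: "nat list" and n and V :: "'a set" and e :: real
    assume "u @ [n] \<in> {u. length u \<le> 1}" "finite V" "0 < e"
    then show "infinite {m. u @ [m] \<in> {u. length u \<le> 1} \<and> (\<forall>v\<in>V. \<bar>\<theta> (u @ [m]) v - \<theta> u v\<bar> < e)}"
      using h(3)[of V e] by (simp add: \<theta>_def)
  qed
  then show ?thesis by blast
qed

section \<open>Recursive choice of sibling differences nearly biorthogonal to the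
  functionals\<close>

section \<open>Selecting nearly biorthogonal subsystems\<close>

text \<open>Pigeonhole on values rounded to multiples of \<open>e\<close>. Finitely many old
  functionals become nearly constant along infinitely many new vectors, hence small on differences
  of these.\<close>

lemma infinite_oscillation:
  fixes G :: "(nat \<Rightarrow> real) set"
  assumes Z: "infinite Z" and fin: "finite G" and bd: "\<forall>g\<in>G. \<forall>n\<in>Z. \<bar>g n\<bar> \<le> M" and e: "0 < e"
  shows "\<exists>Z'\<subseteq>Z. infinite Z' \<and> (\<forall>g\<in>G. \<forall>m\<in>Z'. \<forall>n\<in>Z'. \<bar>g m - g n\<bar> < e)"
proof -
  define F where "F n = restrict (\<lambda>g. \<lfloor>g n / e\<rfloor>) G" for n
  have "F ` Z \<subseteq> (\<Pi>\<^sub>E g\<in>G. {\<lfloor>- M / e\<rfloor>..\<lfloor>M / e\<rfloor>})"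
  proof (intro image_subsetI PiE_I)
    fix n g assume "n \<in> Z" "g \<in> G"
    then have "- M \<le> g n" "g n \<le> M" using bd by (auto simp: abs_le_iff minus_le_iff)
    then have "- M / e \<le> g n / e" "g n / e \<le> M / e" 
      using e divide_right_mono[of "- M" "g n" e] divide_right_mono[of "g n" M e] by simp_all
    then show "F n g \<in> {\<lfloor>- M / e\<rfloor>..\<lfloor>M / e\<rfloor>}"
      using \<open>g \<in> G\<close> floor_mono by (simp only: F_def restrict_apply if_True atLeastAtMost_iff) blast
  qed (simp add: F_def)
  then have "finite (F ` Z)" by (rule finite_subset) (intro finite_PiE fin, simp)
  then obtain n0 where n0: "infinite {n \<in> Z. F n = F n0}" using pigeonhole_infinite[OF Z] by blast
  show ?thesis
  proof (intro exI[of _ "{n \<in> Z. F n = F n0}"] conjI ballI)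
    fix g m n assume gmn: "g \<in> G" "m \<in> {n \<in> Z. F n = F n0}" "n \<in> {n \<in> Z. F n = F n0}"
    have "F m g = F n g" using gmn by simp
    then have "\<lfloor>g m / e\<rfloor> = \<lfloor>g n / e\<rfloor>" using gmn(1) by (simp add: F_def)
    then have "\<bar>g m / e - g n / e\<bar> < 1" by linarith
    then have "\<bar>(g m - g n) / e\<bar> < 1" by (simp add: diff_divide_distrib)
    then show "\<bar>g m - g n\<bar> < e" using e by (simp add: abs_divide)
  qed (use n0 in auto)
qed

text \<open>\<open>list_encode\<close> grows when an entry is put in front. With the list reversed,
  it grows when a child label is appended, so a recursion along codes meets parents before children.
  The codes also number the geometric error weights.\<close>

definition node_code :: "'c::countable \<times> nat list \<Rightarrow> nat" where
  "node_code s = prod_encode (to_nat (fst s), list_encode (rev (snd s)))"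

lemma inj_node_code: "inj node_code"
  by (rule injI) (auto simp: node_code_def list_encode_eq prod_eq_iff)

lemma node_code_butlast:
  assumes "u \<noteq> []"
  shows "node_code (i, butlast u) < node_code (i, u)"
proof -
  have "triangle m < triangle n" if "m < n" for m n
    using that by (rule lift_Suc_mono_less[of triangle, rotated]) simp
  then have mono: "prod_encode (a, b) < prod_encode (a, c)" if "b < c" for a b c
    using that by (simp add: prod_encode_def)
  obtain v n where u: "u = v @ [n]" using assms by (metis rev_exhaust)
  have "list_encode (rev v) < list_encode (rev u)" by (simp add: u le_prod_encode_2 less_Suc_eq_le)
  then show ?thesis unfolding node_code_def by (simp add: u mono)
qed

text \<open>\<open>p\<close> copies the tree into itself level by level, and \<open>p' u\<close> is
  a sibling of \<open>p u\<close> that \<open>p\<close> never takes. The vectors finally used are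
  \<open>x (p u) - x (p' u)\<close>.\<close>

definition selecting :: "nat list set \<Rightarrow> (nat list \<Rightarrow> nat list) \<Rightarrow> (nat list \<Rightarrow> nat list) \<Rightarrow> bool" where
  "selecting A p p' \<longleftrightarrow> p [] = [] \<and> (\<forall>u\<in>A. p u \<in> A) \<and> (\<forall>u\<in>A. u \<noteq> [] \<longrightarrow> p' u \<in> A) \<and>
    (\<forall>u n. u @ [n] \<in> A \<longrightarrow> (\<exists>k k'. p (u @ [n]) = p u @ [k] \<and> p' (u @ [n]) = p u @ [k'])) \<and>
    (\<forall>u n m. u @ [n] \<in> A \<longrightarrow> u @ [m] \<in> A \<longrightarrow> p (u @ [n]) \<noteq> p' (u @ [m]) \<and>
      (n \<noteq> m \<longrightarrow> p (u @ [n]) \<noteq> p (u @ [m]) \<and> p' (u @ [n]) \<noteq> p' (u @ [m])))"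

lemma selectingD:
  assumes "selecting A p p'"
  shows "p [] = []" "u \<in> A \<Longrightarrow> p u \<in> A" "u \<in> A \<Longrightarrow> u \<noteq> [] \<Longrightarrow> p' u \<in> A"
    "u @ [n] \<in> A \<Longrightarrow> \<exists>k. p (u @ [n]) = p u @ [k]" "u @ [n] \<in> A \<Longrightarrow> \<exists>k. p' (u @ [n]) = p u @ [k]"
    "u @ [n] \<in> A \<Longrightarrow> u @ [m] \<in> A \<Longrightarrow> p (u @ [n]) \<noteq> p' (u @ [m])"
    "u @ [n] \<in> A \<Longrightarrow> u @ [m] \<in> A \<Longrightarrow> p (u @ [n]) = p (u @ [m]) \<Longrightarrow> n = m"
    "u @ [n] \<in> A \<Longrightarrow> u @ [m] \<in> A \<Longrightarrow> p' (u @ [n]) = p' (u @ [m]) \<Longrightarrow> n = m"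
  using assms unfolding selecting_def by blast+

lemma selecting_length:
  assumes sel: "selecting A p p'" and tr: "tree A"
  shows "u \<in> A \<Longrightarrow> length (p u) = length u"
proof (induction u rule: rev_induct)
  case Nil
  then show ?case using selectingD(1)[OF sel] by simp
next
  case (snoc n u)
  then show ?case using selectingD(4)[OF sel snoc.prems] treeD[OF tr snoc.prems] by auto
qed

lemma selecting_inj:
  assumes sel: "selecting A p p'" and tr: "tree A"
  shows "u \<in> A \<Longrightarrow> v \<in> A \<Longrightarrow> p u = p v \<Longrightarrow> u = v"
proof (induction u arbitrary: v rule: rev_induct)
  case Nil
  then show ?case using selectingD(1)[OF sel] selecting_length[OF sel tr, of v] by simp
next
  case (snoc n u)
  have "v \<noteq> []" using snoc.prems selecting_length[OF sel tr, of v] selecting_length[OF sel tr, of "u @ [n]"] by auto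
  then obtain w m where v: "v = w @ [m]" by (metis rev_exhaust)
  have uw: "u \<in> A" "w \<in> A" using snoc.prems v treeD[OF tr] by auto
  have "p u = p w"
    using selectingD(4)[OF sel snoc.prems(1)] selectingD(4)[OF sel, of w m] snoc.prems v by auto
  then have "u = w" using snoc.IH uw by blast
  then show ?case using selectingD(7)[OF sel, of u n m] snoc.prems v by auto
qed

lemma selecting_take:
  assumes sel: "selecting A p p'" and tr: "tree A"
  shows "u \<in> A \<Longrightarrow> p (take n u) = take n (p u)"
proof (induction u rule: rev_induct)
  case Nil
  then show ?case using selectingD(1)[OF sel] by simp
next
  case (snoc m u)
  have u: "u \<in> A" by (rule treeD[OF tr snoc.prems])
  show ?case
    using selectingD(4)[OF sel snoc.prems] snoc.IH[OF u] selecting_length[OF sel tr u]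
    by (cases "n \<le> length u") auto
qed

lemma selecting_prefix:
  assumes sel: "selecting A p p'" and tr: "tree A" and u: "u \<in> A" and v: "v \<in> A"
  shows "prefix (p u) (p v) \<longleftrightarrow> prefix u v"
proof
  assume "prefix (p u) (p v)"
  then have "p u = take (length u) (p v)"
    using selecting_length[OF sel tr u] by (auto simp: prefix_def)
  also have "\<dots> = p (take (length u) v)" using selecting_take[OF sel tr v] by simp
  finally have "u = take (length u) v"
    using selecting_inj[OF sel tr u] tree_prefix[OF tr v take_is_prefix] by blast
  then show "prefix u v" by (metis take_is_prefix)
next
  assume "prefix u v"
  then have "u = take (length u) v" by (auto simp: prefix_def)
  then have "p u = take (length u) (p v)" using selecting_take[OF sel tr v, of "length u"] by simp
  then show "prefix (p u) (p v)" by (metis take_is_prefix)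
qed

text \<open>If \<open>p' u\<close> were a proper prefix of \<open>p' v\<close>, it would be a prefix
  of the parent of \<open>p' v\<close>. That parent is a value of \<open>p\<close>, so
  \<open>p' u\<close> would be one too, which \<open>p'\<close> avoids.\<close>

lemma selecting_antichain:
  assumes sel: "selecting A p p'" and tr: "tree A" and u: "u \<in> A" "u \<noteq> []" and v: "v \<in> A" "v \<noteq> []"
    and pre: "prefix (p' u) (p' v)"
  shows "u = v"
proof -
  obtain u0 n where un: "u = u0 @ [n]" using u(2) by (metis rev_exhaust)
  obtain v0 m where vm: "v = v0 @ [m]" using v(2) by (metis rev_exhaust)
  have u0: "u0 \<in> A" and v0: "v0 \<in> A" using treeD[OF tr] u v un vm by auto
  obtain k where k: "p' u = p u0 @ [k]" using selectingD(5)[OF sel] u un by blast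
  obtain l where l: "p' v = p v0 @ [l]" using selectingD(5)[OF sel] v vm by blast
  have len: "length (p u0) = length u0" "length (p v0) = length v0"
    using selecting_length[OF sel tr] u0 v0 by auto
  show ?thesis
  proof (cases "length u0 = length v0")
    case True
    then have eq: "p u0 = p v0" "k = l" using pre len unfolding k l by (auto simp: prefix_def)
    then have "u0 = v0" using selecting_inj[OF sel tr u0 v0] by blast
    then show ?thesis using selectingD(8)[OF sel, of u0 n m] k l eq u(1) v(1) un vm by auto
  next
    case False
    have "length (p' u) \<le> length (p' v)" using pre by (rule prefix_length_le)
    then have lt: "length u0 < length v0" using False len k l by simp
    define w where "w = take (Suc (length u0)) v0"
    have w: "w \<in> A" "w \<noteq> []" unfolding w_def using tree_prefix[OF tr v0 take_is_prefix] lt by auto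
    have "p w = take (Suc (length u0)) (p v0)" unfolding w_def by (rule selecting_take[OF sel tr v0])
    also have "\<dots> = take (Suc (length u0)) (p' v)" using l len lt by simp
    also have "\<dots> = p' u" using pre k len by (auto simp: prefix_def)
    finally have pw: "p w = p' u" .
    obtain w0 q where wq: "w = w0 @ [q]" using w(2) by (metis rev_exhaust)
    obtain j where "p w = p w0 @ [j]" using selectingD(4)[OF sel] w wq by blast
    then have "p w0 = p u0" using pw k by simp
    then have "w0 = u0" using selecting_inj[OF sel tr _ u0] treeD[OF tr] w wq by blast
    then show ?thesis using selectingD(6)[OF sel, of u0 q n] pw w(1) u(1) wq un by auto
  qed
qed

text \<open>The recursion along \<open>node_code\<close> treats all components at once. A new pair
  of siblings comes so late that its functional nearly agrees with that of its parent on all earlier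
  differences, and that all earlier functionals nearly agree on its two vectors. To evaluate a
  functional on a difference, one passes from the node to its parent repeatedly, until reaching the
  node of the difference (value 1), the root (value 0), or a node chosen before the difference
  (value nearly 0).\<close>

lemma selection:
  fixes A :: "'c::countable \<Rightarrow> nat list set" and x :: "'c \<Rightarrow> nat list \<Rightarrow> 'a::real_normed_vector"
  assumes adm: "\<And>i. admissible (A i) (x i) (\<theta> i)" and tr: "\<And>i. tree (A i)" and sp: "\<And>i. spreading (A i)"
    and bd: "\<And>i u. u \<in> A i \<Longrightarrow> u \<noteq> [] \<Longrightarrow> norm (x i u) \<le> M"
  shows "\<exists>p p'. (\<forall>i. selecting (A i) (p i) (p' i)) \<and>
    (\<forall>i u j v. u \<in> A i \<longrightarrow> u \<noteq> [] \<longrightarrow> v \<in> A j \<longrightarrow> v \<noteq> [] \<longrightarrow>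
      \<bar>\<theta> i (p i u) (x j (p j v) - x j (p' j v)) - of_bool (j = i \<and> prefix v u)\<bar> \<le> (1/8) * (1/2) ^ node_code (j, v))"
proof -
  define \<delta> where "\<delta> k = (1/2::real) ^ k" for k :: nat
  have \<delta>0: "0 < \<delta> k" and \<delta>1: "\<delta> k \<le> 1" for k by (auto simp: \<delta>_def power_le_one)
  have \<delta>mono: "\<delta> l \<le> \<delta> k" if "k \<le> l" for k l using that by (simp add: \<delta>_def power_decreasing)
  define nd where "nd = {(i, u). u \<in> A i \<and> u \<noteq> []}"
  define base where "base f i u = (if butlast u = [] then [] else fst (f (node_code (i, butlast u))))"
    for f :: "nat \<Rightarrow> nat list \<times> nat list" and i :: 'c and u
  define y where "y f s = x (fst s) (fst (f (node_code s))) - x (fst s) (snd (f (node_code s)))"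
    for f :: "nat \<Rightarrow> nat list \<times> nat list" and s
  define indep where "indep f k i b c c' t \<longleftrightarrow> last (fst (f (node_code t))) < c' \<and> last (snd (f (node_code t))) < c' \<and>
      \<bar>\<theta> (fst t) (fst (f (node_code t))) (x i (b @ [c]) - x i (b @ [c']))\<bar> \<le> (1/16) * \<delta> k \<and>
      \<bar>\<theta> i (b @ [c]) (y f t) - \<theta> i b (y f t)\<bar> \<le> (1/16) * \<delta> k * \<delta> (node_code t)"
    for f :: "nat \<Rightarrow> nat list \<times> nat list" and k i b c c' t
  define P where "P f k r \<longleftrightarrow> (\<forall>i u. k = node_code (i, u) \<longrightarrow> (i, u) \<in> nd \<longrightarrow>
     (\<exists>c c'. r = (base f i u @ [c], base f i u @ [c']) \<and> fst r \<in> A i \<and> snd r \<in> A i \<and> list_all2 (\<le>) u (fst r) \<and> c' < c \<and>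
       (\<forall>t\<in>nd. node_code t < k \<longrightarrow> indep f k i (base f i u) c c' t)))"
    for f :: "nat \<Rightarrow> nat list \<times> nat list" and k and r
  have "\<exists>f. \<forall>k. P f k (f k)"
  proof (rule dependent_wellorder_choice)
    fix f g :: "nat \<Rightarrow> nat list \<times> nat list" and k r
    assume fg: "\<And>m. m < k \<Longrightarrow> f m = g m"
    have "base f i u = base g i u" if "k = node_code (i, u)" "(i, u) \<in> nd" for i u
      using that fg node_code_butlast[of u i] by (auto simp: base_def nd_def)
    moreover have "indep f k i b c c' t = indep g k i b c c' t" if "node_code t < k" for i b c c' t
      using fg that by (simp add: indep_def y_def)
    ultimately show "P f k r = P g k r"
      unfolding P_def using fg by (intro iff_allI imp_cong refl iff_exI conj_cong ball_cong) auto
  next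
    fix k and f :: "nat \<Rightarrow> nat list \<times> nat list"
    assume IH: "\<And>m. m < k \<Longrightarrow> P f m (f m)"
    show "\<exists>r. P f k r"
    proof (cases "\<exists>s\<in>nd. k = node_code s")
      case False
      then show ?thesis unfolding P_def by blast
    next
      case True
      then obtain i u where k: "k = node_code (i, u)" and nd: "(i, u) \<in> nd" by auto
      have u: "u \<in> A i" "u \<noteq> []" using nd by (auto simp: nd_def)
      have uniq: "i' = i \<and> u' = u" if "k = node_code (i', u')" for i' u'
        using injD[OF inj_node_code, of "(i', u')" "(i, u)"] that k by simp
      define b where "b = base f i u"
      have bu: "butlast u \<in> A i" using treeD[OF tr, of "butlast u" "[last u]"] u by simp
      have b: "b \<in> A i \<and> list_all2 (\<le>) (butlast u) b"
      proof (cases "butlast u = []")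
        case True
        then show ?thesis using bu by (simp add: b_def base_def)
      next
        case False
        then have "(i, butlast u) \<in> nd" using bu by (simp add: nd_def)
        moreover have "node_code (i, butlast u) < k" unfolding k by (rule node_code_butlast[OF u(2)])
        ultimately show ?thesis
          using IH[of "node_code (i, butlast u)"] False unfolding P_def b_def base_def by auto
      qed
      \<comment> \<open>Selected nodes dominate the original ones, so by spreading \<open>b\<close>
        has a child in \<open>A i\<close>; otherwise the recursion could be stuck at a leaf.\<close>
      have snocle: "list_all2 (\<le>) u (b @ [c])" if "last u \<le> c" for c
        using list_all2_appendI[of "(\<le>)" "butlast u" b "[last u]" "[c]"] b that u(2) by simp
      have child: "b @ [last u] \<in> A i" using spreadingD[OF sp u(1) snocle[of "last u"]] by simp
      define W where "W = {t \<in> nd. node_code t < k}"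
      have "W \<subseteq> node_code -` {..<k}" by (auto simp: W_def)
      then have finW: "finite W" by (rule finite_subset) (intro finite_vimageI inj_node_code, simp)
      \<comment> \<open>The cluster property at \<open>b\<close> enters here, for the finitely many
        differences chosen so far. The set is infinite, so it still allows labels above
        \<open>q\<close> and a passage to small oscillation.\<close>
      define Z where "Z = {m. b @ [m] \<in> A i \<and> (\<forall>v\<in>y f ` W. \<bar>\<theta> i (b @ [m]) v - \<theta> i b v\<bar> < (1/16) * \<delta> k * \<delta> k)}"
      define q where "q = last u + (\<Sum>t\<in>W. last (fst (f (node_code t))) + last (snd (f (node_code t))))"
      have qW: "last (fst (f (node_code t))) + last (snd (f (node_code t))) \<le> q" if "t \<in> W" for t
        unfolding q_def using member_le_sum[OF that, of "\<lambda>t. last (fst (f (node_code t))) + last (snd (f (node_code t)))"] finW by simp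
      have "infinite Z" unfolding Z_def
        using \<delta>0[of k] finW by (intro admissibleD(6)[OF adm child]) auto
      then have Z1: "infinite (Z - {..q})" by (intro Diff_infinite_finite) auto
      define G where "G = (\<lambda>t n. \<theta> (fst t) (fst (f (node_code t))) (x i (b @ [n]))) ` W"
      have finG: "finite G" unfolding G_def using finW by simp
      have bdG: "\<bar>g n\<bar> \<le> 4 * M" if gn: "g \<in> G" "n \<in> Z - {..q}" for g n
      proof -
        obtain t where t: "g = (\<lambda>n. \<theta> (fst t) (fst (f (node_code t))) (x i (b @ [n])))" using gn(1) by (auto simp: G_def)
        have "norm (x i (b @ [n])) \<le> M" using gn(2) by (intro bd) (auto simp: Z_def)
        then show ?thesis unfolding t using admissibleD(2)[OF adm] by (meson mult_left_mono order_trans zero_le_numeral)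
      qed
      obtain Z' where Z': "Z' \<subseteq> Z - {..q}" "infinite Z'"
        "\<And>g m n. g \<in> G \<Longrightarrow> m \<in> Z' \<Longrightarrow> n \<in> Z' \<Longrightarrow> \<bar>g m - g n\<bar> < (1/16) * \<delta> k"
        using infinite_oscillation[OF Z1 finG, of "4 * M" "(1/16) * \<delta> k"] bdG \<delta>0[of k] by (metis half_gt_zero mult_pos_pos zero_less_divide_1_iff zero_less_numeral)
      obtain c' where c': "c' \<in> Z'" using Z'(2) infinite_imp_nonempty by blast
      obtain c where c: "c \<in> Z'" "c' < c" using Z'(2) unfolding infinite_nat_iff_unbounded by blast
      have cZ: "c \<in> Z" "c' \<in> Z" "q < c" "q < c'" using c c' Z'(1) by auto
      have "P f k (b @ [c], b @ [c'])"
        unfolding P_def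
      proof (intro allI impI)
        fix i' u' assume "k = node_code (i', u')" "(i', u') \<in> nd"
        then have iu: "i' = i" "u' = u" using uniq by auto
        show "\<exists>d d'. (b @ [c], b @ [c']) = (base f i' u' @ [d], base f i' u' @ [d']) \<and>
          fst (b @ [c], b @ [c']) \<in> A i' \<and> snd (b @ [c], b @ [c']) \<in> A i' \<and> list_all2 (\<le>) u' (fst (b @ [c], b @ [c'])) \<and> d' < d \<and>
          (\<forall>t\<in>nd. node_code t < k \<longrightarrow> indep f k i' (base f i' u') d d' t)"
          unfolding iu
        proof (rule exI[of _ c], rule exI[of _ c'], intro conjI ballI impI)
          show "(b @ [c], b @ [c']) = (base f i u @ [c], base f i u @ [c'])" by (simp add: b_def)
          show "fst (b @ [c], b @ [c']) \<in> A i" "snd (b @ [c], b @ [c']) \<in> A i" using cZ by (auto simp: Z_def)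
          show "list_all2 (\<le>) u (fst (b @ [c], b @ [c']))" using snocle[of c] cZ(3) by (simp add: q_def)
          show "c' < c" by (rule c)
          fix t assume "t \<in> nd" "node_code t < k"
          then have tW: "t \<in> W" by (simp add: W_def)
          have "(\<lambda>n. \<theta> (fst t) (fst (f (node_code t))) (x i (b @ [n]))) \<in> G" using tW by (auto simp: G_def)
          from Z'(3)[OF this c(1) c']
          have "\<bar>\<theta> (fst t) (fst (f (node_code t))) (x i (b @ [c]) - x i (b @ [c']))\<bar> \<le> (1/16) * \<delta> k"
            by (simp add: linear_diff[OF admissibleD(1)[OF adm]])
          moreover have "\<bar>\<theta> i (b @ [c]) (y f t) - \<theta> i b (y f t)\<bar> \<le> (1/16) * \<delta> k * \<delta> k"
            using cZ(1) tW by (auto simp: Z_def less_imp_le)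
          moreover have "(1/16) * \<delta> k * \<delta> k \<le> (1/16) * \<delta> k * \<delta> (node_code t)"
            using \<delta>0[of k] \<delta>mono[of "node_code t" k] \<open>node_code t < k\<close> by (intro mult_left_mono) auto
          ultimately show "indep f k i (base f i u) c c' t"
            unfolding indep_def b_def[symmetric] using qW[OF tW] cZ by linarith
        qed
      qed
      then show ?thesis by blast
    qed
  qed
  then obtain f where f: "\<And>k. P f k (f k)" by blast
  define p where "p i u = (if u = [] then [] else fst (f (node_code (i, u))))" for i :: 'c and u
  define p' where "p' i u = snd (f (node_code (i, u)))" for i :: 'c and u
  have base_p: "base f i u = p i (butlast u)" for i u by (simp add: base_def p_def)
  have y_p: "y f (i, u) = x i (p i u) - x i (p' i u)" if "u \<noteq> []" for i u
    using that by (simp add: y_def p_def p'_def)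
  have step: "\<exists>c c'. p i u = p i (butlast u) @ [c] \<and> p' i u = p i (butlast u) @ [c'] \<and> p i u \<in> A i \<and> p' i u \<in> A i \<and> c' < c \<and>
      (\<forall>j v. v \<in> A j \<longrightarrow> v \<noteq> [] \<longrightarrow> node_code (j, v) < node_code (i, u) \<longrightarrow> last (p j v) < c' \<and> last (p' j v) < c' \<and>
          \<bar>\<theta> j (p j v) (x i (p i u) - x i (p' i u))\<bar> \<le> (1/16) * \<delta> (node_code (i, u)) \<and>
          \<bar>\<theta> i (p i u) (x j (p j v) - x j (p' j v)) - \<theta> i (p i (butlast u)) (x j (p j v) - x j (p' j v))\<bar>
             \<le> (1/16) * \<delta> (node_code (i, u)) * \<delta> (node_code (j, v)))"
    if iu: "u \<in> A i" "u \<noteq> []" for i u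
  proof -
    have nd: "(i, u) \<in> nd" using iu by (simp add: nd_def)
    have ff: "f (node_code (j, v)) = (p j v, p' j v)" if "v \<noteq> []" for j v
      using that by (simp add: p_def p'_def)
    obtain c c' where cc: "(p i u, p' i u) = (p i (butlast u) @ [c], p i (butlast u) @ [c'])"
        "p i u \<in> A i" "p' i u \<in> A i" "c' < c"
      and all: "\<And>t. t \<in> nd \<Longrightarrow> node_code t < node_code (i, u) \<Longrightarrow> indep f (node_code (i, u)) i (p i (butlast u)) c c' t"
      using f[of "node_code (i, u)", unfolded P_def, rule_format, OF refl nd]
      unfolding ff[OF iu(2)] base_p fst_conv snd_conv by blast
    show ?thesis
    proof (rule exI[of _ c], rule exI[of _ c'], intro conjI allI impI)
      fix j v assume v: "v \<in> A j" "v \<noteq> []" and lt: "node_code (j, v) < node_code (i, u)"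
      have "(j, v) \<in> nd" using v by (simp add: nd_def)
      have pu: "p i (butlast u) @ [c] = p i u" "p i (butlast u) @ [c'] = p' i u" using cc(1) by simp_all
      from all[OF \<open>(j, v) \<in> nd\<close> lt, unfolded indep_def pu ff[OF v(2)] y_p[OF v(2)] fst_conv snd_conv]
      show "last (p j v) < c'" "last (p' j v) < c'"
        "\<bar>\<theta> j (p j v) (x i (p i u) - x i (p' i u))\<bar> \<le> (1/16) * \<delta> (node_code (i, u))"
        "\<bar>\<theta> i (p i u) (x j (p j v) - x j (p' j v)) - \<theta> i (p i (butlast u)) (x j (p j v) - x j (p' j v))\<bar>
             \<le> (1/16) * \<delta> (node_code (i, u)) * \<delta> (node_code (j, v))" by blast+
    qed (use cc in simp_all)
  qed
  show ?thesis
  proof (rule exI[of _ p], rule exI[of _ p'], intro conjI allI impI)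
    fix i
    have last_less: "last (p i u) < last (p' i v) \<and> last (p' i u) < last (p' i v) \<and> last (p' i v) < last (p i v)"
      if "u \<in> A i" "u \<noteq> []" "v \<in> A i" "v \<noteq> []" "node_code (i, u) < node_code (i, v)" for u v
      using step[OF that(3,4)] that by fastforce
    have last_self: "last (p' i u) < last (p i u)" if "u \<in> A i" "u \<noteq> []" for u
      using step[OF that] by fastforce
    show "selecting (A i) (p i) (p' i)"
      unfolding selecting_def
    proof (intro conjI allI ballI impI)
      show "p i [] = []" by (simp add: p_def)
      show "p i u \<in> A i" if "u \<in> A i" for u
        using step[of u i] that by (cases "u = []") (auto simp: p_def)
      show "p' i u \<in> A i" if "u \<in> A i" "u \<noteq> []" for u using step[OF that] by blast
      show "\<exists>k k'. p i (u @ [n]) = p i u @ [k] \<and> p' i (u @ [n]) = p i u @ [k']" if "u @ [n] \<in> A i" for u n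
        using step[OF that] by auto
      fix u n m assume nm: "u @ [n] \<in> A i" "u @ [m] \<in> A i"
      consider "n = m" | "node_code (i, u @ [n]) < node_code (i, u @ [m])" | "node_code (i, u @ [m]) < node_code (i, u @ [n])"
        using injD[OF inj_node_code, of "(i, u @ [n])" "(i, u @ [m])"] by fastforce
      note cs = this
      show "p i (u @ [n]) \<noteq> p' i (u @ [m])"
        using cs last_self[OF nm(1)] last_less[OF nm(1) _ nm(2)] last_less[OF nm(2) _ nm(1)] by cases force+
      show "p i (u @ [n]) \<noteq> p i (u @ [m])" if "n \<noteq> m"
        using cs that last_less[OF nm(1) _ nm(2)] last_less[OF nm(2) _ nm(1)] by cases force+
      show "p' i (u @ [n]) \<noteq> p' i (u @ [m])" if "n \<noteq> m"
        using cs that last_less[OF nm(1) _ nm(2)] last_less[OF nm(2) _ nm(1)] by cases force+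
    qed
  next
    fix i u j v assume u: "u \<in> A i" "u \<noteq> []" and v: "v \<in> A j" "v \<noteq> []"
    let ?y = "x j (p j v) - x j (p' j v)" and ?l = "node_code (j, v)"
    \<comment> \<open>The factor \<open>2 - \<delta>\<close> is what the induction preserves: a
      comparison with the parent adds \<open>\<delta>\<close> of the new code, and twice that is at
      most \<open>\<delta>\<close> of the parent's smaller code.\<close>
    have "\<bar>\<theta> i (p i u) ?y - of_bool (j = i \<and> prefix v u)\<bar> \<le> (1/16) * \<delta> ?l * (2 - \<delta> (node_code (i, u)))"
      using u
    proof (induction u rule: rev_induct)
      case Nil
      then show ?case by simp
    next
      case (snoc n u)
      let ?k = "node_code (i, u @ [n])"
      have one: "1 \<le> 2 - \<delta> ?k" using \<delta>1[of ?k] by simp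
      consider "?k = ?l" | "?k < ?l" | "?l < ?k" by linarith
      then show ?case
      proof cases
        case 1
        then have eq: "j = i" "v = u @ [n]" using injD[OF inj_node_code, of "(i, u @ [n])" "(j, v)"] by auto
        obtain c c' where cc: "p i (u @ [n]) = p i u @ [c]" "p' i (u @ [n]) = p i u @ [c']"
          "p i (u @ [n]) \<in> A i" "p' i (u @ [n]) \<in> A i" "c' < c"
          using step[OF snoc.prems] by auto
        \<comment> \<open>The smaller label of the pair was given to \<open>p'\<close> so that the
          triangular relation applies here.\<close>
        have "\<theta> i (p i (u @ [n])) (x i (p' i (u @ [n]))) = 0"
          using admissibleD(5)[OF adm cc(5)] cc by simp
        moreover have "\<theta> i (p i (u @ [n])) (x i (p i (u @ [n]))) = 1"
          using admissibleD(4)[OF adm cc(3)] cc by simp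
        ultimately show ?thesis unfolding eq using \<delta>0[of ?k] \<delta>1[of ?k]
          by (simp add: linear_diff[OF admissibleD(1)[OF adm]])
      next
        case 2
        have small: "\<bar>\<theta> i (p i (u @ [n])) ?y\<bar> \<le> (1/16) * \<delta> ?l"
          using step[OF v] snoc.prems 2 by blast
        have "\<not> (j = i \<and> prefix v (u @ [n]))"
        proof
          assume "j = i \<and> prefix v (u @ [n])"
          then have "node_code (j, v) \<le> node_code (i, u @ [n])"
          proof (induction "u @ [n]" arbitrary: u n rule: measure_induct_rule[where f = length])
            case (less u n)
            show ?case
            proof (cases "v = u @ [n]")
              case False
              then have pre: "prefix v u" using less.prems by (simp add: prefix_snoc)
              then have "u \<noteq> []" using v(2) by auto
              then obtain w m where "u = w @ [m]" by (metis rev_exhaust)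
              then have "node_code (j, v) \<le> node_code (i, u)" using less pre by auto
              then show ?thesis using node_code_butlast[of "u @ [n]" i] by simp
            qed (use less in auto)
          qed
          then show False using 2 by simp
        qed
        then have z: "(of_bool (j = i \<and> prefix v (u @ [n])) :: real) = 0" by (simp only: of_bool_eq)
        have "(1/16) * \<delta> ?l * 1 \<le> (1/16) * \<delta> ?l * (2 - \<delta> ?k)"
          using \<delta>0[of ?l] by (intro mult_left_mono[OF one]) simp
        then show ?thesis unfolding z diff_zero using small by linarith
      next
        case 3
        have near: "\<bar>\<theta> i (p i (u @ [n])) ?y - \<theta> i (p i u) ?y\<bar> \<le> (1/16) * \<delta> ?k * \<delta> ?l"
          using step[OF snoc.prems] v 3 by auto
        have ne: "\<not> (j = i \<and> v = u @ [n])" using 3 by auto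
        show ?thesis
        proof (cases "u = []")
          case True
          then have "\<not> (j = i \<and> prefix v (u @ [n]))" using ne v(2) by (auto simp: prefix_Cons)
          then have z: "(of_bool (j = i \<and> prefix v (u @ [n])) :: real) = 0" by (simp only: of_bool_eq)
          have "\<theta> i (p i u) ?y = 0" using True admissibleD(3)[OF adm] by (simp add: p_def)
          moreover have "(1/16) * \<delta> ?k * \<delta> ?l \<le> (1/16) * \<delta> ?l * (2 - \<delta> ?k)"
            using mult_left_mono[of "\<delta> ?k" "2 - \<delta> ?k" "(1/16) * \<delta> ?l"] \<delta>0[of ?l] \<delta>1[of ?k] by (simp add: mult.commute mult.left_commute)
          ultimately show ?thesis unfolding z diff_zero using near by linarith
        next
          case False
          have uA: "u \<in> A i" using treeD[OF tr snoc.prems(1)] .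
          have IH: "\<bar>\<theta> i (p i u) ?y - of_bool (j = i \<and> prefix v u)\<bar> \<le> (1/16) * \<delta> ?l * (2 - \<delta> (node_code (i, u)))"
            using snoc.IH uA False by blast
          have same: "(j = i \<and> prefix v (u @ [n])) = (j = i \<and> prefix v u)" using ne by (auto simp: prefix_snoc)
          have "Suc (node_code (i, u)) \<le> ?k" using node_code_butlast[of "u @ [n]" i] by simp
          then have "\<delta> ?k \<le> \<delta> (Suc (node_code (i, u)))" by (rule \<delta>mono)
          then have "2 - \<delta> (node_code (i, u)) + \<delta> ?k \<le> 2 - \<delta> ?k" by (simp add: \<delta>_def)
          then have "(1/16) * \<delta> ?l * (2 - \<delta> (node_code (i, u)) + \<delta> ?k) \<le> (1/16) * \<delta> ?l * (2 - \<delta> ?k)"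
            using \<delta>0[of ?l] by (intro mult_left_mono) auto
          moreover have "(1/16) * \<delta> ?l * (2 - \<delta> (node_code (i, u)) + \<delta> ?k)
             = (1/16) * \<delta> ?l * (2 - \<delta> (node_code (i, u))) + (1/16) * \<delta> ?k * \<delta> ?l" by algebra
          ultimately show ?thesis using near IH unfolding same by linarith
        qed
      qed
    qed
    also have "\<dots> \<le> (1/16) * \<delta> ?l * 2" using \<delta>0[of ?l] \<delta>0[of "node_code (i, u)"] by (intro mult_left_mono) auto
    finally show "\<bar>\<theta> i (p i u) ?y - of_bool (j = i \<and> prefix v u)\<bar> \<le> (1/8) * (1/2) ^ ?l"
      by (simp add: \<delta>_def)
  qed
qed

section \<open>Inner induction: systems along the chains of a well-founded clock\<close>

section \<open>Chains of components\<close>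

lemma lower_est_cong: "(\<And>s. s \<in> S \<Longrightarrow> x s = x' s) \<Longrightarrow> lower_est R L x S \<Longrightarrow> lower_est R L x' S"
  unfolding lower_est_def by (metis (mono_tags, lifting) sum.cong)

lemma upper_est_cong: "(\<And>s. s \<in> S \<Longrightarrow> x s = x' s) \<Longrightarrow> upper_est R U x S \<Longrightarrow> upper_est R U x' S"
  unfolding upper_est_def by (metis (mono_tags, lifting) sum.cong)

lemma upper_est_empty: "0 \<le> U \<Longrightarrow> upper_est R U x {}"
  by (simp add: upper_est_def)

text \<open>No branch meets both parts, so the branch sums of each part already occur in the union,
  and the triangle inequality adds the constants.\<close>

lemma upper_est_union:
  assumes "finite S" "finite T" "S \<inter> T = {}" "\<And>s t. s \<in> S \<Longrightarrow> t \<in> T \<Longrightarrow> \<not> R s t \<and> \<not> R t s"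
    and "upper_est R U x S" "upper_est R U' x T"
  shows "upper_est R (U + U') x (S \<union> T)"
  unfolding upper_est_def
proof (intro allI impI)
  fix a B assume B: "0 \<le> (B::real)" "\<forall>t\<in>S \<union> T. \<bar>bsum R (S \<union> T) a t\<bar> \<le> B"
  have "{s \<in> S \<union> T. R s t} = {s \<in> S. R s t}" if "t \<in> S" for t using that assms(4) by blast
  then have "bsum R (S \<union> T) a t = bsum R S a t" if "t \<in> S" for t using that by (simp only: bsum_def)
  then have b1: "\<bar>bsum R S a t\<bar> \<le> B" if "t \<in> S" for t using B(2) that by (metis UnI1)
  have "norm (\<Sum>s\<in>S. a s *\<^sub>R x s) \<le> U * B"
    by (rule upper_estD[OF assms(5) B(1) b1])
  moreover
  have "{s \<in> S \<union> T. R s t} = {s \<in> T. R s t}" if "t \<in> T" for t using that assms(4) by blast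
  then have "bsum R (S \<union> T) a t = bsum R T a t" if "t \<in> T" for t using that by (simp only: bsum_def)
  then have b2: "\<bar>bsum R T a t\<bar> \<le> B" if "t \<in> T" for t using B(2) that by (metis UnI2)
  have "norm (\<Sum>s\<in>T. a s *\<^sub>R x s) \<le> U' * B"
    by (rule upper_estD[OF assms(6) B(1) b2])
  ultimately show "norm (\<Sum>s\<in>S \<union> T. a s *\<^sub>R x s) \<le> (U + U') * B"
    using norm_triangle_ineq[of "\<Sum>s\<in>S. a s *\<^sub>R x s" "\<Sum>s\<in>T. a s *\<^sub>R x s"]
    by (simp add: sum.union_disjoint assms(1-3) distrib_right)
qed

text \<open>Coefficients are at most 2 M for the largest branch sum M, and the errors sum to at most
  1/4, so \<open>\<theta> t\<close> recovers branch sums up to M/2. Hence the functionals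
  \<open>2 * \<theta> t\<close> reach 2 (M - M/2) = M and stay below 2 (M + M/2) = 3 M. The constant
  \<open>U\<close> only becomes the scale \<open>k\<close> of the new norm and leaves no trace in
  the result.\<close>

lemma near_biorthogonal_renorming:
  fixes y :: "'i \<Rightarrow> 'a::banach"
  assumes el: "K_elastic TYPE('a) K" and K: "1 \<le> K" and fo: "forest_order R"
    and lin: "\<And>t. t \<in> N \<Longrightarrow> linear (\<theta> t)" and bd: "\<And>t w. t \<in> N \<Longrightarrow> \<bar>\<theta> t w\<bar> \<le> C * norm w"
    and near: "\<And>s t. s \<in> N \<Longrightarrow> t \<in> N \<Longrightarrow> \<bar>\<theta> t (y s) - of_bool (R s t)\<bar> \<le> \<epsilon> s"
    and small: "\<And>S. finite S \<Longrightarrow> S \<subseteq> N \<Longrightarrow> sum \<epsilon> S \<le> 1/4"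
    and up: "\<And>S. S \<in> \<G> \<Longrightarrow> finite S \<and> S \<subseteq> N \<and> upper_est R U y S" and U: "0 < U"
  obtains x :: "'i \<Rightarrow> 'a" where "\<And>S. finite S \<Longrightarrow> S \<subseteq> N \<Longrightarrow> lower_est R 1 x S"
    "\<And>S. S \<in> \<G> \<Longrightarrow> upper_est R (3 * K) x S"
proof -
  define \<Theta> where "\<Theta> = (\<lambda>t w. 2 * \<theta> t w) ` N"
  have \<Theta>lin: "linear \<phi>" if "\<phi> \<in> \<Theta>" for \<phi>
    using that lin unfolding \<Theta>_def by (auto intro!: linearI simp: linear_add linear_scale)
  have \<Theta>bd: "\<bar>\<phi> w\<bar> \<le> (2 * C) * norm w" if "\<phi> \<in> \<Theta>" for \<phi> w
    using that bd[of _ w] unfolding \<Theta>_def by (auto simp: abs_mult)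
  obtain T :: "'a \<Rightarrow> 'a" where T: "linear T" "\<And>\<phi> w. \<phi> \<in> \<Theta> \<Longrightarrow> \<bar>\<phi> w\<bar> \<le> norm (T w)"
    "\<And>w B. 0 \<le> B \<Longrightarrow> (\<And>\<phi>. \<phi> \<in> \<Theta> \<Longrightarrow> \<bar>\<phi> w\<bar> \<le> B) \<Longrightarrow> norm w \<le> U * B \<Longrightarrow> norm (T w) \<le> K * B"
    using renorming[OF el, of \<Theta> "2 * C" U] \<Theta>lin \<Theta>bd U K by auto
  have Tsum: "(\<Sum>s\<in>S. a s *\<^sub>R T (y s)) = T (\<Sum>s\<in>S. a s *\<^sub>R y s)" for S a
    using T(1) by (simp add: linear_sum linear_scale)
  have approx: "\<bar>\<theta> t (\<Sum>s\<in>S. a s *\<^sub>R y s) - bsum R S a t\<bar> \<le> M / 2"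
    if S: "finite S" "S \<subseteq> N" and t: "t \<in> N" and M: "\<And>s. s \<in> S \<Longrightarrow> \<bar>a s\<bar> \<le> 2 * M" "0 \<le> M" for S a t M
  proof -
    have eps0: "0 \<le> \<epsilon> s" if "s \<in> N" for s using near[OF that that] by linarith
    have "bsum R S a t = (\<Sum>s\<in>S. a s * of_bool (R s t))"
      unfolding bsum_def using S(1) by (intro sum.mono_neutral_cong_left) auto
    then have "\<theta> t (\<Sum>s\<in>S. a s *\<^sub>R y s) - bsum R S a t = (\<Sum>s\<in>S. a s * (\<theta> t (y s) - of_bool (R s t)))"
      using lin[OF t] by (simp add: linear_sum linear_scale right_diff_distrib sum_subtractf)
    also have "\<bar>\<dots>\<bar> \<le> (\<Sum>s\<in>S. \<bar>a s\<bar> * \<bar>\<theta> t (y s) - of_bool (R s t)\<bar>)"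
      unfolding abs_mult[symmetric] by (rule sum_abs)
    also have "\<dots> \<le> (\<Sum>s\<in>S. (2 * M) * \<epsilon> s)"
      using M S t by (intro sum_mono mult_mono near) auto
    also have "\<dots> = (2 * M) * sum \<epsilon> S" by (simp add: sum_distrib_left)
    also have "\<dots> \<le> (2 * M) * (1/4)" using small[OF S] M(2) by (intro mult_left_mono) auto
    finally show ?thesis by simp
  qed
  show ?thesis
  proof
    fix S assume S: "finite S" "S \<subseteq> N"
    show "lower_est R 1 (\<lambda>s. T (y s)) S"
      unfolding lower_est_def
    proof (intro allI ballI)
      fix a t assume t: "t \<in> S"
      obtain t0 where t0: "t0 \<in> S" and Mub: "\<And>s. s \<in> S \<Longrightarrow> \<bar>bsum R S a s\<bar> \<le> \<bar>bsum R S a t0\<bar>"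
        and coeff: "\<And>s. s \<in> S \<Longrightarrow> \<bar>a s\<bar> \<le> 2 * \<bar>bsum R S a t0\<bar>"
        using bsum_attained[OF fo S(1) t] by blast
      let ?M = "\<bar>bsum R S a t0\<bar>"
      have "\<bar>\<theta> t0 (\<Sum>s\<in>S. a s *\<^sub>R y s) - bsum R S a t0\<bar> \<le> ?M / 2"
        using S t0 coeff by (intro approx) auto
      then have "?M \<le> \<bar>2 * \<theta> t0 (\<Sum>s\<in>S. a s *\<^sub>R y s)\<bar>" by (simp add: abs_if split: if_splits)
      also have "\<dots> \<le> norm (T (\<Sum>s\<in>S. a s *\<^sub>R y s))"
        using T(2)[of "\<lambda>w. 2 * \<theta> t0 w"] t0 S by (auto simp: \<Theta>_def)
      finally show "\<bar>bsum R S a t\<bar> \<le> 1 * norm (\<Sum>s\<in>S. a s *\<^sub>R T (y s))"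
        unfolding Tsum using Mub[OF t] by linarith
    qed
  next
    fix S assume "S \<in> \<G>"
    then have S: "finite S" "S \<subseteq> N" "upper_est R U y S" using up by auto
    show "upper_est R (3 * K) (\<lambda>s. T (y s)) S"
      unfolding upper_est_def Tsum
    proof (intro allI impI)
      fix a B assume B: "0 \<le> (B::real)" "\<forall>t\<in>S. \<bar>bsum R S a t\<bar> \<le> B"
      have "norm (T (\<Sum>s\<in>S. a s *\<^sub>R y s)) \<le> K * (3 * B)"
      proof (rule T(3))
        have "norm (\<Sum>s\<in>S. a s *\<^sub>R y s) \<le> U * B" using upper_estD[OF S(3)] B by blast
        also have "\<dots> \<le> U * (3 * B)" using U B by (intro mult_left_mono) auto
        finally show "norm (\<Sum>s\<in>S. a s *\<^sub>R y s) \<le> U * (3 * B)" .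
        fix \<phi> assume "\<phi> \<in> \<Theta>"
        then obtain t where t: "t \<in> N" "\<phi> = (\<lambda>w. 2 * \<theta> t w)" by (auto simp: \<Theta>_def)
        have "\<bar>\<theta> t (\<Sum>s\<in>S. a s *\<^sub>R y s) - bsum R S a t\<bar> \<le> B / 2"
          using S t B coeff_bound[OF fo S(1)] by (intro approx) auto
        \<comment> \<open>\<open>t\<close> runs through all of \<open>N\<close>, whereas
          \<open>B\<close> is only assumed to bound the branch sums at nodes of
          \<open>S\<close>.\<close>
        moreover have "\<bar>bsum R S a t\<bar> \<le> B" using bsum_bound[OF fo S(1)] B by blast
        ultimately show "\<bar>\<phi> (\<Sum>s\<in>S. a s *\<^sub>R y s)\<bar> \<le> 3 * B" unfolding t(2) by (simp add: abs_if split: if_splits)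
      qed (use B in simp)
      then show "norm (T (\<Sum>s\<in>S. a s *\<^sub>R y s)) \<le> 3 * K * B" by (simp add: mult.assoc mult.left_commute)
    qed
  qed
qed

lemma sum_geometric_codes:
  fixes S :: "('c::countable \<times> nat list) set"
  assumes "finite S"
  shows "(\<Sum>s\<in>S. (1/8) * (1/2::real) ^ node_code s) \<le> 1/4"
proof -
  have "(\<Sum>s\<in>S. (1/8) * (1/2::real) ^ node_code s) = (1/8) * (\<Sum>n\<in>node_code ` S. (1/2::real) ^ n)"
    using inj_on_subset[OF inj_node_code, of S] by (simp add: sum.reindex sum_distrib_left)
  also have "(\<Sum>n\<in>node_code ` S. (1/2::real) ^ n) \<le> (\<Sum>n. (1/2) ^ n)"
    using assms by (intro sum_le_suminf) (auto simp: summable_geometric)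
  also have "(\<Sum>n. (1/2::real) ^ n) = 2" by (simp add: suminf_geometric)
  finally show ?thesis by simp
qed

definition comp_le :: "'c \<times> nat list \<Rightarrow> 'c \<times> nat list \<Rightarrow> bool" where
  "comp_le s t \<longleftrightarrow> fst s = fst t \<and> prefix (snd s) (snd t)"

lemma forest_order_comp_le: "forest_order comp_le"
proof -
  note fo = forest_orderD[OF forest_order_prefix[where 'b = nat]]
  show ?thesis
    unfolding forest_order_def comp_le_def
  proof (intro conjI allI impI)
    fix r s t :: "'c \<times> nat list"
    show "fst s = fst s" "prefix (snd s) (snd s)" by auto
    show "s = t" if "fst s = fst t \<and> prefix (snd s) (snd t)" "fst t = fst s \<and> prefix (snd t) (snd s)"
      using that fo(2)[of "snd s" "snd t"] by (simp add: prod_eq_iff)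
    show "fst r = fst t" if "fst r = fst s \<and> prefix (snd r) (snd s)" "fst s = fst t \<and> prefix (snd s) (snd t)"
      using that by simp
    show "prefix (snd r) (snd t)" if "fst r = fst s \<and> prefix (snd r) (snd s)" "fst s = fst t \<and> prefix (snd s) (snd t)"
      using that fo(3)[of "snd r" "snd s" "snd t"] by simp
    show "fst r = fst s \<and> prefix (snd r) (snd s) \<or> fst s = fst r \<and> prefix (snd s) (snd r)"
      if "fst r = fst t \<and> prefix (snd r) (snd t)" "fst s = fst t \<and> prefix (snd s) (snd t)"
      using that fo(4)[of "snd r" "snd t" "snd s"] by auto
  qed
qed

text \<open>The vectors at \<open>p\<close> carry the order of \<open>S\<close> and contribute
  \<open>U * B\<close>. Those at \<open>p'\<close> form an antichain with coefficients up to
  \<open>2 * B\<close> and contribute twice as much.\<close>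

lemma selected_upper_est:
  fixes x :: "'c::countable \<Rightarrow> nat list \<Rightarrow> 'a::real_normed_vector"
  assumes sel: "\<And>i. selecting (A i) (p i) (p' i)" and tr: "\<And>i. tree (A i)"
    and S: "finite S" "\<And>i u. (i, u) \<in> S \<Longrightarrow> u \<in> A i \<and> u \<noteq> []"
    and up: "upper_est comp_le U (\<lambda>s. x (fst s) (snd s)) ((\<lambda>s. (fst s, p (fst s) (snd s))) ` S)"
      "upper_est comp_le U (\<lambda>s. x (fst s) (snd s)) ((\<lambda>s. (fst s, p' (fst s) (snd s))) ` S)"
  shows "upper_est comp_le (3 * U) (\<lambda>s. x (fst s) (p (fst s) (snd s)) - x (fst s) (p' (fst s) (snd s))) S"
  unfolding upper_est_def
proof (intro allI impI)
  fix a B assume B: "0 \<le> (B::real)" "\<forall>t\<in>S. \<bar>bsum comp_le S a t\<bar> \<le> B"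
  let ?h = "\<lambda>s. (fst s, p (fst s) (snd s))" and ?h' = "\<lambda>s. (fst s, p' (fst s) (snd s))"
  have mem: "snd s \<in> A (fst s)" "snd s \<noteq> []" if "s \<in> S" for s using S(2)[of "fst s" "snd s"] that by auto
  have inj: "inj_on ?h S"
  proof (rule inj_onI)
    fix s t assume st: "s \<in> S" "t \<in> S" "?h s = ?h t"
    then have "fst s = fst t" "p (fst s) (snd s) = p (fst s) (snd t)" by auto
    then show "s = t"
      using selecting_inj[OF sel tr, of "snd s" "fst s" "snd t"] mem[OF st(1)] mem[OF st(2)] by (simp add: prod_eq_iff)
  qed
  have inj': "inj_on ?h' S"
  proof (rule inj_onI)
    fix s t assume st: "s \<in> S" "t \<in> S" "?h' s = ?h' t"
    then have "fst s = fst t" "p' (fst s) (snd s) = p' (fst s) (snd t)" by auto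
    then show "s = t"
      using selecting_antichain[OF sel tr, of "snd s" "fst s" "snd t"] mem[OF st(1)] mem[OF st(2)] by (simp add: prod_eq_iff)
  qed
  have "upper_est comp_le U (\<lambda>s. (\<lambda>s. x (fst s) (snd s)) (?h s)) S"
    using selecting_prefix[OF sel tr] mem by (intro upper_est_reindex[OF inj _ up(1)]) (auto simp: comp_le_def)
  then have 1: "norm (\<Sum>s\<in>S. a s *\<^sub>R x (fst s) (p (fst s) (snd s))) \<le> U * B"
    using upper_estD[OF _ B(1)] B(2) by fastforce
  have 2: "norm (\<Sum>s\<in>S. a s *\<^sub>R (\<lambda>s. x (fst s) (snd s)) (?h' s)) \<le> U * (2 * B)"
  proof (rule upper_est_antichain[OF inj' _ _ up(2)])
    show "comp_le t t" for t :: "'c \<times> nat list" by (simp add: comp_le_def)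
    show "s = t" if st: "s \<in> S" "t \<in> S" "comp_le (?h' s) (?h' t)" for s t
    proof -
      have "fst s = fst t" "prefix (p' (fst s) (snd s)) (p' (fst s) (snd t))" using st(3) by (auto simp: comp_le_def)
      then show ?thesis
        using selecting_antichain[OF sel tr, of "snd s" "fst s" "snd t"] mem[OF st(1)] mem[OF st(2)] by (simp add: prod_eq_iff)
    qed
    show "\<bar>a s\<bar> \<le> 2 * B" if "s \<in> S" for s
      using coeff_bound[OF forest_order_comp_le S(1), of a B s] B that by blast
  qed (use B in simp)
  have "norm (\<Sum>s\<in>S. a s *\<^sub>R (x (fst s) (p (fst s) (snd s)) - x (fst s) (p' (fst s) (snd s))))
    = norm ((\<Sum>s\<in>S. a s *\<^sub>R x (fst s) (p (fst s) (snd s))) - (\<Sum>s\<in>S. a s *\<^sub>R (\<lambda>s. x (fst s) (snd s)) (?h' s)))"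
    by (simp add: scaleR_diff_right sum_subtractf)
  also have "\<dots> \<le> U * B + U * (2 * B)" using 1 2 norm_triangle_ineq4 by (smt (verit))
  also have "U * B + U * (2 * B) = 3 * U * B" by algebra
  finally show "norm (\<Sum>s\<in>S. a s *\<^sub>R (x (fst s) (p (fst s) (snd s)) - x (fst s) (p' (fst s) (snd s)))) \<le> 3 * U * B" .
qed

text \<open>The root carries no vector. For a subtree at a child of the root, that vector is added
  when the whole tree is embedded.\<close>

definition embedded :: "nat list set \<Rightarrow> real \<Rightarrow> (nat list \<Rightarrow> 'a::real_normed_vector) \<Rightarrow> bool" where
  "embedded A U x \<longleftrightarrow> (\<forall>S. finite S \<longrightarrow> S \<subseteq> A - {[]} \<longrightarrow> lower_est prefix 1 x S \<and> upper_est prefix U x S)"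

text \<open>A component \<open>(c, b)\<close> belongs to a node \<open>c\<close> of the clock. With \<open>j = length c - 1\<close>, it carries the part of \<open>A\<close>
  strictly above the \<open>j\<close>-th child of the root if \<open>b\<close> holds, and otherwise a sequence of candidates for
  the vector at that child, of which a good set uses at most one.\<close>

definition ctree :: "nat list set \<Rightarrow> nat list \<times> bool \<Rightarrow> nat list set" where
  "ctree A c = (if snd c then subtree A [length (fst c) - 1] else {u. length u \<le> 1})"

text \<open>Because the prefix is strict, nothing is left to embed at a leaf of the clock, and the
  induction needs no separate base case.\<close>

definition snodes :: "nat list set \<Rightarrow> nat list set \<Rightarrow> nat list \<Rightarrow> ((nat list \<times> bool) \<times> nat list) set" where
  "snodes A C d = {(c, u). fst c \<in> C \<and> strict_prefix d (fst c) \<and> u \<in> ctree A c \<and> u \<noteq> []}"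

text \<open>Sets on which an upper estimate is maintained. The components marked
  \<open>False\<close> are restricted because a Riesz sequence comes with no upper estimate beyond
  the norms of its vectors.\<close>

definition good_set :: "((nat list \<times> bool) \<times> nat list) set \<Rightarrow> bool" where
  "good_set S \<longleftrightarrow> finite S \<and> (\<exists>e. \<forall>s\<in>S. prefix (fst (fst s)) e) \<and>
     (\<forall>c u v. ((c, False), u) \<in> S \<longrightarrow> ((c, False), v) \<in> S \<longrightarrow> u = v)"

lemma good_setD:
  assumes "good_set S"
  shows "finite S" "\<exists>e. \<forall>s\<in>S. prefix (fst (fst s)) e"
    "((c, False), u) \<in> S \<Longrightarrow> ((c, False), v) \<in> S \<Longrightarrow> u = v"
proof -
  note good = assms[unfolded good_set_def]
  show "finite S" using good by (elim conjE)
  show "\<exists>e. \<forall>s\<in>S. prefix (fst (fst s)) e" using good by (elim conjE)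
  have "\<forall>c u v. ((c, False), u) \<in> S \<longrightarrow> ((c, False), v) \<in> S \<longrightarrow> u = v" using good by (elim conjE)
  then show "((c, False), u) \<in> S \<Longrightarrow> ((c, False), v) \<in> S \<Longrightarrow> u = v" by (elim allE) (rule mp[OF mp])
qed

definition chain_embedded :: "nat list set \<Rightarrow> nat list set \<Rightarrow> real \<Rightarrow> nat list \<Rightarrow>
    ((nat list \<times> bool) \<times> nat list \<Rightarrow> 'a::real_normed_vector) \<Rightarrow> bool" where
  "chain_embedded A C U d x \<longleftrightarrow> (\<forall>S. finite S \<longrightarrow> S \<subseteq> snodes A C d \<longrightarrow> lower_est comp_le 1 x S) \<and>
     (\<forall>S. S \<subseteq> snodes A C d \<longrightarrow> good_set S \<longrightarrow> upper_est comp_le U x S)"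

lemma tree_ctree: "tree A \<Longrightarrow> tree (ctree A c)"
  by (auto simp: ctree_def tree_subtree) (auto simp: tree_def)

lemma spreading_ctree: "spreading A \<Longrightarrow> spreading (ctree A c)"
  by (auto simp: ctree_def spreading_subtree) (auto simp: spreading_def dest: list_all2_lengthD)

lemma no_branch_ctree:
  assumes "tree A" "no_branch A"
  shows "no_branch (ctree A c)"
proof -
  have "no_branch {u. length u \<le> 1}"
    unfolding no_branch_def
  proof (rule notI, elim exE)
    fix f assume "\<forall>n. map f [0..<n] \<in> {u. length u \<le> 1}"
    then have "map f [0..<2] \<in> {u. length u \<le> 1}" by blast
    then show False by simp
  qed
  then show ?thesis using no_branch_subtree[OF assms] by (auto simp: ctree_def)
qed

lemma chain_embedded_norm:
  assumes "chain_embedded A C U d x" "s \<in> snodes A C d"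
  shows "norm (x s) \<le> U"
proof (rule norm_le_of_upper_est[where R = comp_le])
  have "good_set {s}" by (auto simp: good_set_def)
  then show "upper_est comp_le U x {s}" using assms by (simp add: chain_embedded_def)
qed (simp add: comp_le_def)

lemma embedded_norm:
  assumes "embedded A U x" "u \<in> A" "u \<noteq> []"
  shows "norm (x u) \<le> U"
proof (rule norm_le_of_upper_est[where R = prefix])
  show "upper_est prefix U x {u}" using assms by (simp add: embedded_def)
qed simp

text \<open>Only the components at the clock nodes \<open>d @ [i]\<close> are new; the ones beyond
  are taken from the systems \<open>X i\<close>. Functionals exist within each component, and the
  selection makes all components independent. A good set follows one branch, so it splits into at
  most one new Riesz vector, part of one copy of \<open>xa\<close> and part of one
  \<open>X i\<close>, each with constant \<open>3 * K\<close>. Differences triple this, and the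
  three pieces give \<open>9 * (3 * K)\<close>, which the renorming resets to
  \<open>3 * K\<close>.\<close>

lemma chain_step:
  fixes xa :: "nat list \<Rightarrow> 'a::banach" and X :: "nat \<Rightarrow> (nat list \<times> bool) \<times> nat list \<Rightarrow> 'a"
  assumes el: "K_elastic TYPE('a) K" and K: "1 \<le> K"
    and infdim: "\<not> (\<exists>B :: 'a set. finite B \<and> span B = UNIV)"
    and A: "tree A" "no_branch A" "spreading A"
    and X: "\<And>i. d @ [i] \<in> C \<Longrightarrow> chain_embedded A C (3 * K) (d @ [i]) (X i)" and trC: "tree C"
    and xa: "embedded (subtree A [length d]) (3 * K) xa"
  shows "\<exists>x :: (nat list \<times> bool) \<times> nat list \<Rightarrow> 'a. chain_embedded A C (3 * K) d x"
proof -
  obtain r :: "nat \<Rightarrow> 'a" and f where r: "\<And>n. norm (r n) = 1" and f: "\<And>n. linear (f n)"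
    "\<And>n w. \<bar>f n w\<bar> \<le> 2 * norm w" "\<And>n. f n (r n) = (1::real)" "\<And>m n. m < n \<Longrightarrow> f n (r m) = 0"
    using riesz_sequence[OF infdim] by blast
  define first where "first c \<longleftrightarrow> length (fst c) = Suc (length d)" for c :: "nat list \<times> bool"
  define raw where "raw c u = (if first c then (if snd c then xa u else r (hd u)) else X (fst c ! length d) (c, u))"
    for c :: "nat list \<times> bool" and u :: "nat list"
  \<comment> \<open>Pairs that are not components beyond \<open>d\<close> receive the bare root, so
    that the selection can run over the whole countable index type.\<close>
  define A' where "A' c = (if fst c \<in> C \<and> strict_prefix d (fst c) then ctree A c else {[]})" for c :: "nat list \<times> bool"
  have nodes: "(c, u) \<in> snodes A C d \<longleftrightarrow> u \<in> A' c \<and> u \<noteq> []" for c u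
    by (auto simp: snodes_def A'_def)
  have deeper: "(c, u) \<in> snodes A C (d @ [fst c ! length d]) \<and> d @ [fst c ! length d] \<in> C"
    if cu: "(c, u) \<in> snodes A C d" "\<not> first c" for c u
  proof -
    have c: "fst c \<in> C" "strict_prefix d (fst c)" using cu by (auto simp: snodes_def)
    then obtain n w where w: "fst c = d @ n # w" by (auto elim: strict_prefixE')
    then have "w \<noteq> []" using cu(2) by (auto simp: first_def)
    then have "strict_prefix (d @ [n]) (fst c)" using w by (auto simp: strict_prefix_def)
    moreover have "d @ [n] \<in> C" using treeD[OF trC, of "d @ [n]" w] c w by simp
    ultimately show ?thesis using cu w by (auto simp: snodes_def)
  qed
  have trA': "tree (A' c)" for c using tree_ctree[OF A(1)] by (auto simp: A'_def tree_def)
  have spA': "spreading (A' c)" for c using spreading_ctree[OF A(3)] by (auto simp: A'_def spreading_def)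
  have "\<exists>\<theta>. admissible (A' c) (raw c) \<theta>" for c
  proof (cases "fst c \<in> C \<and> strict_prefix d (fst c)")
    case False
    then have "A' c \<subseteq> {[]}" by (auto simp: A'_def)
    then show ?thesis using admissible_trivial by blast
  next
    case True
    then have A'c: "A' c = ctree A c" by (simp add: A'_def)
    consider "first c" "\<not> snd c" | "first c" "snd c" | "\<not> first c" by blast
    then show ?thesis
    proof cases
      case 1
      then have "A' c = {u. length u \<le> 1}" "raw c = (\<lambda>u. r (hd u))" unfolding A'c by (auto simp: ctree_def raw_def)
      moreover have "\<exists>\<theta>. admissible {u. length u \<le> 1} (\<lambda>u. r (hd u)) \<theta>"
        by (rule admissible_riesz[where f = f]) (use f in auto)
      ultimately show ?thesis by (simp only:)
    next
      case 2
      then have eq: "A' c = subtree A [length d]" "raw c = xa" unfolding A'c by (auto simp: ctree_def raw_def first_def)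
      show ?thesis unfolding eq
        using xa A by (intro admissible_of_lower_est tree_subtree no_branch_subtree spreading_subtree) (auto simp: embedded_def)
    next
      case 3
      show ?thesis
      proof (rule admissible_of_lower_est[OF trA' _ spA'])
        show "no_branch (A' c)" unfolding A'c by (rule no_branch_ctree[OF A(1,2)])
        fix S assume S: "finite S" "S \<subseteq> A' c - {[]}"
        show "lower_est prefix 1 (raw c) S"
        proof (cases "S = {}")
          case True
          then show ?thesis by (simp add: lower_est_def)
        next
          case False
          define i where "i = fst c ! length d"
          have sub: "Pair c ` S \<subseteq> snodes A C (d @ [i])" and "d @ [i] \<in> C"
            using deeper[OF _ 3] S(2) False unfolding nodes i_def by fastforce+
          then have "lower_est comp_le 1 (X i) (Pair c ` S)"
            using X[of i] S(1) unfolding chain_embedded_def by blast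
          then have "lower_est prefix 1 (\<lambda>u. X i (c, u)) S"
            by (intro lower_est_reindex[where h = "Pair c" and R' = comp_le]) (auto simp: comp_le_def inj_on_def)
          moreover have "raw c = (\<lambda>u. X i (c, u))" using 3 by (auto simp: raw_def i_def)
          ultimately show ?thesis by simp
        qed
      qed
    qed
  qed
  then obtain \<theta> where adm: "\<And>c. admissible (A' c) (raw c) (\<theta> c)" by metis
  have bd: "norm (raw c u) \<le> 3 * K" if cu: "u \<in> A' c" "u \<noteq> []" for c u
  proof -
    have sn: "(c, u) \<in> snodes A C d" using cu by (simp add: nodes)
    consider "first c" "\<not> snd c" | "first c" "snd c" | "\<not> first c" by blast
    then show ?thesis
    proof cases
      case 1 then show ?thesis using K r by (simp add: raw_def)
    next
      case 2
      then have "u \<in> subtree A [length d]" using sn by (auto simp: snodes_def ctree_def first_def)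
      then show ?thesis using embedded_norm[OF xa _ cu(2)] 2 by (simp add: raw_def)
    next
      case 3
      then show ?thesis using chain_embedded_norm[OF X] deeper[OF sn 3] by (simp add: raw_def)
    qed
  qed
  obtain p p' where sel: "\<And>i. selecting (A' i) (p i) (p' i)"
    and near: "\<And>i u j v. u \<in> A' i \<Longrightarrow> u \<noteq> [] \<Longrightarrow> v \<in> A' j \<Longrightarrow> v \<noteq> [] \<Longrightarrow>
      \<bar>\<theta> i (p i u) (raw j (p j v) - raw j (p' j v)) - of_bool (j = i \<and> prefix v u)\<bar> \<le> (1/8) * (1/2) ^ node_code (j, v)"
    using selection[where A = A' and x = raw and \<theta> = \<theta> and M = "3 * K", OF adm trA' spA' bd] by blast
  define y where "y s = raw (fst s) (p (fst s) (snd s)) - raw (fst s) (p' (fst s) (snd s))" for s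
  have up: "upper_est comp_le (9 * (3 * K)) y S" if S: "S \<subseteq> snodes A C d" "good_set S" for S
  proof -
    let ?h = "\<lambda>s. (fst s, p (fst s) (snd s))" and ?h' = "\<lambda>s. (fst s, p' (fst s) (snd s))"
    let ?raw = "\<lambda>s. raw (fst s) (snd s)"
    have fin: "finite S" by (rule good_setD(1)[OF S(2)])
    obtain e where e': "\<forall>s\<in>S. prefix (fst (fst s)) e" using good_setD(2)[OF S(2)] by metis
    have e: "prefix (fst (fst s)) e" if "s \<in> S" for s using e' that by (rule bspec)
    have one: "u = v" if "((c, False), u) \<in> S" "((c, False), v) \<in> S" for c u v
      by (rule good_setD(3)[OF S(2) that])
    have memS: "u \<in> A' c \<and> u \<noteq> []" if "(c, u) \<in> S" for c u using S(1) that nodes by blast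
    have sel1: "p c u \<in> A' c \<and> p c u \<noteq> []" if "(c, u) \<in> S" for c u
      using selectingD(2)[OF sel] selecting_length[OF sel trA'] memS[OF that] by (metis length_0_conv)
    have sel2: "p' c u \<in> A' c \<and> p' c u \<noteq> []" if "(c, u) \<in> S" for c u
    proof -
      have "u \<in> A' c" "u \<noteq> []" using memS[OF that] by auto
      moreover obtain v n where "u = v @ [n]" using \<open>u \<noteq> []\<close> by (metis rev_exhaust)
      ultimately show ?thesis using selectingD(3)[OF sel, of u c] selectingD(5)[OF sel, of v n c] by auto
    qed
    have img: "upper_est comp_le (3 * K) ?raw (g ` T)"
      if g: "\<And>s. s \<in> S \<Longrightarrow> g s \<in> snodes A C d \<and> fst (g s) = fst s"
        and T: "T = {s \<in> S. first (fst s) \<and> \<not> snd (fst s)} \<or> T = {s \<in> S. first (fst s) \<and> snd (fst s)} \<or> T = {s \<in> S. \<not> first (fst s)}"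
      for g and T
    proof -
      have TS: "T \<subseteq> S" using T by blast
      \<comment> \<open>The branch \<open>e\<close> has one prefix of each length, so a good set
        meets only one clock node directly beyond \<open>d\<close>.\<close>
      have fc: "fst (fst s) = take (Suc (length d)) e" if "s \<in> S" "first (fst s)" for s
        using e[OF that(1)] that(2) by (auto simp: first_def prefix_def)
      from T show ?thesis
      proof (elim disjE)
        assume T0: "T = {s \<in> S. first (fst s) \<and> \<not> snd (fst s)}"
        have "s = t" if st: "s \<in> T" "t \<in> T" for s t
        proof -
          obtain c b u c' b' u' where eq: "s = ((c, b), u)" "t = ((c', b'), u')" by (metis surj_pair)
          then have "c = c'" "b = False" "b' = False" using st fc[of s] fc[of t] unfolding T0 by auto
          then show ?thesis using one st eq unfolding T0 by auto
        qed
        then consider "T = {}" | s where "T = {s}" by blast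
        then show ?thesis
        proof cases
          case 1 then show ?thesis using K by (simp add: upper_est_empty)
        next
          case (2 s)
          then have "g s \<in> snodes A C d" using g TS by blast
          then have "norm (?raw (g s)) \<le> 3 * K" using bd nodes by (metis prod.collapse)
          then show ?thesis using 2 by (simp add: upper_est_singleton comp_le_def)
        qed
      next
        assume T1: "T = {s \<in> S. first (fst s) \<and> snd (fst s)}"
        have same: "fst s = (take (Suc (length d)) e, True)" if "s \<in> g ` T" for s
        proof -
          obtain t where t: "t \<in> T" "s = g t" using \<open>s \<in> g ` T\<close> by blast
          then have "fst (fst t) = take (Suc (length d)) e" "snd (fst t)" "fst s = fst t" using fc g TS unfolding T1 by auto
          then show ?thesis by (simp add: prod_eq_iff)
        qed
        have fs: "first (fst s) \<and> s \<in> snodes A C d" if "s \<in> g ` T" for s using that g TS unfolding T1 by auto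
        have "snd ` g ` T \<subseteq> subtree A [length d] - {[]}"
        proof
          fix u assume "u \<in> snd ` g ` T"
          then obtain s where s: "s \<in> g ` T" "u = snd s" by blast
          have "s = (fst s, u)" using s by simp
          then have "(fst s, u) \<in> snodes A C d" using fs[OF s(1)] by simp
          then show "u \<in> subtree A [length d] - {[]}"
            using same[OF s(1)] fs[OF s(1)] by (auto simp: snodes_def ctree_def first_def)
        qed
        moreover have "finite (snd ` g ` T)" using fin TS by (meson finite_imageI finite_subset)
        ultimately have "upper_est prefix (3 * K) xa (snd ` g ` T)" using xa by (simp add: embedded_def)
        then have "upper_est comp_le (3 * K) (\<lambda>s. xa (snd s)) (g ` T)"
        proof (rule upper_est_reindex[where R' = prefix and h = snd, rotated 2])
          show "inj_on snd (g ` T)"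
          proof (rule inj_onI)
            fix s t assume "s \<in> g ` T" "t \<in> g ` T" "snd s = snd t"
            then show "s = t" using same[of s] same[of t] by (simp add: prod_eq_iff)
          qed
          show "prefix (snd s) (snd t) \<longleftrightarrow> comp_le s t" if "s \<in> g ` T" "t \<in> g ` T" for s t
            using same[OF that(1)] same[OF that(2)] by (simp add: comp_le_def)
        qed
        then show ?thesis
        proof (rule upper_est_cong[rotated])
          show "xa (snd s) = ?raw s" if "s \<in> g ` T" for s
            using same[OF that] fs[OF that] by (simp add: raw_def)
        qed
      next
        assume T2: "T = {s \<in> S. \<not> first (fst s)}"
        show ?thesis
        proof (cases "T = {}")
          case True
          then show ?thesis using K by (simp add: upper_est_empty)
        next
          case False
          define i where "i = e ! length d"
          have nf: "\<not> first (fst s) \<and> s \<in> snodes A C d \<and> fst (fst s) ! length d = i" if s: "s \<in> g ` T" for s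
          proof -
            obtain t where t: "t \<in> S" "\<not> first (fst t)" "s = g t" using s unfolding T2 by blast
            have 1: "s \<in> snodes A C d" "fst s = fst t" using g[OF t(1)] t(3) by auto
            have "strict_prefix d (fst (fst s))" using 1(1) by (auto simp: snodes_def)
            then have "length d < length (fst (fst s))" by (rule prefix_length_less)
            moreover have "prefix (fst (fst s)) e" using e[OF t(1)] 1(2) by simp
            ultimately have "fst (fst s) ! length d = i" by (auto simp: i_def prefix_def nth_append)
            then show ?thesis using 1 t(2) by simp
          qed
          have deep: "s \<in> snodes A C (d @ [i]) \<and> d @ [i] \<in> C" if "s \<in> g ` T" for s
            using deeper[of "fst s" "snd s"] nf[OF that] by simp
          have "good_set (g ` T)"
            unfolding good_set_def
          proof (intro conjI allI impI)
            show "finite (g ` T)" using fin TS by (meson finite_imageI finite_subset)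
            show "\<exists>e. \<forall>s\<in>g ` T. prefix (fst (fst s)) e" using e g TS by (intro exI[of _ e]) auto
            fix c u v assume "((c, False), u) \<in> g ` T" "((c, False), v) \<in> g ` T"
            then obtain s t where st: "s \<in> T" "t \<in> T" "((c, False), u) = g s" "((c, False), v) = g t" by auto
            then have "fst s = (c, False)" "fst t = (c, False)" using g TS by (metis fst_conv subsetD)+
            then have "s = ((c, False), snd s)" "t = ((c, False), snd t)" by (metis prod.collapse)+
            then have "s = t" using one st TS by (metis subsetD)
            then have "((c, False), u) = ((c, False), v)" using st(3,4) by (simp only:)
            then show "u = v" by simp
          qed
          moreover obtain s where "s \<in> g ` T" using False by blast
          ultimately have "upper_est comp_le (3 * K) (X i) (g ` T)"
            using X[of i] deep unfolding chain_embedded_def by blast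
          then show ?thesis
          proof (rule upper_est_cong[rotated])
            show "X i s = ?raw s" if "s \<in> g ` T" for s using nf[OF that] by (simp add: raw_def)
          qed
        qed
      qed
    qed
    have piece: "upper_est comp_le (3 * (3 * K)) y T"
      if T: "T = {s \<in> S. first (fst s) \<and> \<not> snd (fst s)} \<or> T = {s \<in> S. first (fst s) \<and> snd (fst s)} \<or> T = {s \<in> S. \<not> first (fst s)}" for T
    proof -
      have TS: "T \<subseteq> S" using T by blast
      have "?h s \<in> snodes A C d \<and> fst (?h s) = fst s" "?h' s \<in> snodes A C d \<and> fst (?h' s) = fst s" if "s \<in> S" for s
        using sel1[of "fst s" "snd s"] sel2[of "fst s" "snd s"] that by (auto simp: nodes)
      then have "upper_est comp_le (3 * K) ?raw (?h ` T)" "upper_est comp_le (3 * K) ?raw (?h' ` T)"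
        using img[OF _ T, of ?h] img[OF _ T, of ?h'] by blast+
      then show ?thesis unfolding y_def
        using memS TS fin by (intro selected_upper_est[OF sel trA']) (auto intro: finite_subset)
    qed
    let ?S0 = "{s \<in> S. first (fst s) \<and> \<not> snd (fst s)}" and ?S1 = "{s \<in> S. first (fst s) \<and> snd (fst s)}"
    let ?S2 = "{s \<in> S. \<not> first (fst s)}"
    have "upper_est comp_le (3 * (3 * K) + 3 * (3 * K)) y (?S0 \<union> ?S1)"
      using fin by (intro upper_est_union piece) (auto simp: comp_le_def)
    then have "upper_est comp_le (3 * (3 * K) + 3 * (3 * K) + 3 * (3 * K)) y ((?S0 \<union> ?S1) \<union> ?S2)"
      using fin by (intro upper_est_union piece) (auto simp: comp_le_def)
    moreover have "(?S0 \<union> ?S1) \<union> ?S2 = S" by blast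
    ultimately show ?thesis by (simp add: algebra_simps)
  qed
  define \<eta> where "\<eta> s = (1/8) * (1/2::real) ^ node_code s" for s :: "(nat list \<times> bool) \<times> nat list"
  define \<G> where "\<G> = {S. S \<subseteq> snodes A C d \<and> good_set S}"
  obtain x :: "(nat list \<times> bool) \<times> nat list \<Rightarrow> 'a" where
    "\<And>S. finite S \<Longrightarrow> S \<subseteq> snodes A C d \<Longrightarrow> lower_est comp_le 1 x S"
    "\<And>S. S \<in> \<G> \<Longrightarrow> upper_est comp_le (3 * K) x S"
  proof (rule near_biorthogonal_renorming[OF el K forest_order_comp_le,
        where N = "snodes A C d" and \<theta> = "\<lambda>s. \<theta> (fst s) (p (fst s) (snd s))" and C = 4 and y = y and \<epsilon> = \<eta>
          and \<G> = \<G> and U = "9 * (3 * K)"])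
    show "linear (\<theta> (fst t) (p (fst t) (snd t)))" for t by (rule admissibleD(1)[OF adm])
    show "\<bar>\<theta> (fst t) (p (fst t) (snd t)) w\<bar> \<le> 4 * norm w" for t w by (rule admissibleD(2)[OF adm])
    show "\<bar>\<theta> (fst t) (p (fst t) (snd t)) (y s) - of_bool (comp_le s t)\<bar> \<le> \<eta> s"
      if st: "s \<in> snodes A C d" "t \<in> snodes A C d" for s t
      using near[of "snd t" "fst t" "snd s" "fst s"] st nodes[of "fst s" "snd s"] nodes[of "fst t" "snd t"]
      by (simp add: y_def \<eta>_def comp_le_def)
    show "sum \<eta> S \<le> 1/4" if "finite S" for S unfolding \<eta>_def by (rule sum_geometric_codes[OF that])
    show "finite S \<and> S \<subseteq> snodes A C d \<and> upper_est comp_le (9 * (3 * K)) y S" if "S \<in> \<G>" for S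
      using that up by (auto simp: \<G>_def good_set_def)
  qed (use K in auto)
  then have "chain_embedded A C (3 * K) d x" by (auto simp: chain_embedded_def \<G>_def)
  then show ?thesis by blast
qed

text \<open>The same constant goes in and comes out at each node, so it is independent of the rank
  of the clock.\<close>

lemma chain_embedding:
  assumes el: "K_elastic TYPE('a::banach) K" and K: "1 \<le> K"
    and infdim: "\<not> (\<exists>B :: 'a::banach set. finite B \<and> span B = UNIV)"
    and A: "tree A" "no_branch A" "spreading A"
    and E: "\<And>j. \<exists>x :: nat list \<Rightarrow> 'a::banach. embedded (subtree A [j]) (3 * K) x"
    and C: "tree C" "no_branch C" "d \<in> C"
  shows "\<exists>x :: (nat list \<times> bool) \<times> nat list \<Rightarrow> 'a::banach. chain_embedded A C (3 * K) d x"
  using C(2,1,3)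
proof (induction d rule: bar_induction)
  case (step d)
  then have "\<forall>i. \<exists>x :: (nat list \<times> bool) \<times> nat list \<Rightarrow> 'a. d @ [i] \<in> C \<longrightarrow> chain_embedded A C (3 * K) (d @ [i]) x" by blast
  then obtain X :: "nat \<Rightarrow> (nat list \<times> bool) \<times> nat list \<Rightarrow> 'a" where
    X: "\<And>i. d @ [i] \<in> C \<Longrightarrow> chain_embedded A C (3 * K) (d @ [i]) (X i)" by metis
  obtain xa :: "nat list \<Rightarrow> 'a" where "embedded (subtree A [length d]) (3 * K) xa" using E by blast
  then show ?case using chain_step[OF el K infdim A X C(1)] by blast
qed

section \<open>The clock argument, and the outer induction over well-founded spreading trees\<close>

section \<open>Boundedness and infinite sums\<close>

text \<open>The errors sum to at most 1/8 and the coefficients are at most 2 M, so a vector moves by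
  at most M/4. The new lower constant comes from M \<le> 2 (norm + M/4), which gives M \<le> 4
  norm.\<close>

lemma perturbed_estimates:
  fixes x z :: "nat \<Rightarrow> 'a::real_normed_vector"
  assumes fo: "forest_order R" and S: "finite S" and lo: "lower_est R 2 x S" and up: "upper_est R U x S" and U: "1 \<le> U"
    and close: "\<And>n. n \<in> S \<Longrightarrow> norm (x n - z n) \<le> (1/16) * (1/2) ^ n"
  shows "lower_est R 4 z S \<and> upper_est R (2 * U) z S"
proof -
  let ?x = "\<lambda>a. \<Sum>n\<in>S. a n *\<^sub>R x n" and ?z = "\<lambda>a. \<Sum>n\<in>S. a n *\<^sub>R z n"
  have diff: "norm (?x a - ?z a) \<le> M / 4"
    if M: "\<And>n. n \<in> S \<Longrightarrow> \<bar>a n\<bar> \<le> 2 * M" "0 \<le> M" for a M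
  proof -
    have "norm (?x a - ?z a) = norm (\<Sum>n\<in>S. a n *\<^sub>R (x n - z n))"
      by (simp add: scaleR_diff_right sum_subtractf)
    also have "\<dots> \<le> (\<Sum>n\<in>S. \<bar>a n\<bar> * norm (x n - z n))" by (rule order_trans[OF norm_sum]) simp
    also have "\<dots> \<le> (\<Sum>n\<in>S. (2 * M) * ((1/16) * (1/2) ^ n))" using M close by (intro sum_mono mult_mono) auto
    also have "\<dots> = (M / 8) * (\<Sum>n\<in>S. (1/2) ^ n)" by (simp add: sum_distrib_left)
    also have "(\<Sum>n\<in>S. (1/2::real) ^ n) \<le> (\<Sum>n. (1/2) ^ n)"
      using S by (intro sum_le_suminf) (auto simp: summable_geometric)
    also have "(\<Sum>n. (1/2::real) ^ n) = 2" by (simp add: suminf_geometric)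
    finally show ?thesis using M(2) by (simp add: mult_left_mono)
  qed
  show ?thesis
  proof
    show "lower_est R 4 z S"
      unfolding lower_est_def
    proof (intro allI ballI)
      fix a t assume t: "t \<in> S"
      obtain t0 where t0: "t0 \<in> S" and Mub: "\<And>s. s \<in> S \<Longrightarrow> \<bar>bsum R S a s\<bar> \<le> \<bar>bsum R S a t0\<bar>"
        and coeff: "\<And>s. s \<in> S \<Longrightarrow> \<bar>a s\<bar> \<le> 2 * \<bar>bsum R S a t0\<bar>"
        using bsum_attained[OF fo S t] by blast
      let ?M = "\<bar>bsum R S a t0\<bar>"
      have "?M \<le> 2 * norm (?x a)" using lower_estD[OF lo t0] by simp
      moreover have "norm (?x a - ?z a) \<le> ?M / 4"
        using coeff by (intro diff) auto
      moreover have "norm (?x a) \<le> norm (?z a) + norm (?x a - ?z a)"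
        by (metis add.commute norm_triangle_sub)
      ultimately show "\<bar>bsum R S a t\<bar> \<le> 4 * norm (\<Sum>s\<in>S. a s *\<^sub>R z s)" using Mub[OF t] by linarith
    qed
    show "upper_est R (2 * U) z S"
      unfolding upper_est_def
    proof (intro allI impI)
      fix a B assume B: "0 \<le> (B::real)" "\<forall>t\<in>S. \<bar>bsum R S a t\<bar> \<le> B"
      have "norm (?x a) \<le> U * B" using upper_estD[OF up B(1)] B(2) by blast
      moreover have "norm (?x a - ?z a) \<le> B / 4"
        using coeff_bound[OF fo S, of a B] B by (intro diff) auto
      moreover have "norm (?z a) \<le> norm (?x a) + norm (?x a - ?z a)"
        by (metis add.commute norm_minus_commute norm_triangle_sub)
      moreover have "1 * B \<le> U * B" using U B(1) by (rule mult_right_mono)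
      moreover have "2 * U * B = U * B + U * B" by algebra
      ultimately show "norm (\<Sum>s\<in>S. a s *\<^sub>R z s) \<le> 2 * U * B" using B(1) by linarith
    qed
  qed
qed

lemma dense_sequence:
  assumes "separable_space (euclidean :: 'a::real_normed_vector topology)"
  obtains d :: "nat \<Rightarrow> 'a::real_normed_vector" where "\<And>z e. 0 < e \<Longrightarrow> \<exists>n. norm (z - d n) < e"
proof -
  obtain D :: "'a set" where D: "countable D" "closure D = UNIV"
    using assms unfolding separable_space_def by auto
  have ne: "D \<noteq> {}" using D(2) by auto
  show ?thesis
  proof
    fix z :: 'a and e :: real assume "0 < e"
    then obtain y where y: "y \<in> D" "dist y z < e" using D(2) closure_approachable by blast
    obtain n where "y = from_nat_into D n" using y(1) range_from_nat_into[OF ne D(1)] by blast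
    then show "\<exists>n. norm (z - from_nat_into D n) < e" using y(2) by (auto simp: dist_norm norm_minus_commute)
  qed
qed

text \<open>The clock is fed with its own output: the next entry of \<open>b\<close> is the index of
  a dense vector near \<open>h (b n)\<close>. The estimates for the clocked vectors along
  \<open>b n\<close> then put the longer sequence back into \<open>C\<close>, against
  well-foundedness. Rounding is what turns the constants into 4 and \<open>2 * U\<close>.\<close>

lemma boundedness:
  fixes R :: "nat \<Rightarrow> nat \<Rightarrow> bool"
  assumes sep: "separable_space (euclidean :: 'a::real_normed_vector topology)" and fo: "forest_order R" and U: "1 \<le> U"
    and g: "\<And>C. tree C \<Longrightarrow> no_branch C \<Longrightarrow> \<exists>g :: nat list \<Rightarrow> 'a. \<forall>c\<in>C. \<forall>S. S \<subseteq> V \<inter> {..length c} \<longrightarrow>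
      lower_est R 2 (\<lambda>n. g (take n c)) S \<and> upper_est R U (\<lambda>n. g (take n c)) S"
  shows "\<exists>z :: nat \<Rightarrow> 'a. \<forall>S. finite S \<longrightarrow> S \<subseteq> V \<longrightarrow> lower_est R 4 z S \<and> upper_est R (2 * U) z S"
proof -
  obtain d :: "nat \<Rightarrow> 'a" where d: "\<And>z e. 0 < e \<Longrightarrow> \<exists>n. norm (z - d n) < e"
    using dense_sequence[OF sep] by blast
  define C where "C = {l. \<forall>S. S \<subseteq> V \<inter> {..<length l} \<longrightarrow>
    lower_est R 4 (\<lambda>n. d (l ! n)) S \<and> upper_est R (2 * U) (\<lambda>n. d (l ! n)) S}"
  have tr: "tree C"
    unfolding tree_def
  proof (intro allI impI)
    fix u v assume uv: "u @ v \<in> C"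
    show "u \<in> C"
      unfolding C_def
    proof (intro CollectI allI impI)
      fix S assume S: "S \<subseteq> V \<inter> {..<length u}"
      then have "S \<subseteq> V \<inter> {..<length (u @ v)}" by auto
      then have "lower_est R 4 (\<lambda>n. d ((u @ v) ! n)) S" "upper_est R (2 * U) (\<lambda>n. d ((u @ v) ! n)) S"
        using uv unfolding C_def by blast+
      moreover have "d ((u @ v) ! n) = d (u ! n)" if "n \<in> S" for n using S that by (auto simp: nth_append)
      ultimately show "lower_est R 4 (\<lambda>n. d (u ! n)) S \<and> upper_est R (2 * U) (\<lambda>n. d (u ! n)) S"
        using lower_est_cong[of S "\<lambda>n. d ((u @ v) ! n)" "\<lambda>n. d (u ! n)"]
          upper_est_cong[of S "\<lambda>n. d ((u @ v) ! n)" "\<lambda>n. d (u ! n)"] by simp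
    qed
  qed
  show ?thesis
  proof (cases "no_branch C")
    case False
    then obtain f where f: "\<And>n. map f [0..<n] \<in> C" unfolding no_branch_def by blast
    have "lower_est R 4 (\<lambda>n. d (f n)) S \<and> upper_est R (2 * U) (\<lambda>n. d (f n)) S" if S: "finite S" "S \<subseteq> V" for S
    proof -
      obtain n where n: "\<forall>m\<in>S. m < n" using finite_nat_set_iff_bounded S(1) by blast
      then have "S \<subseteq> V \<inter> {..<length (map f [0..<n])}" using S by auto
      then have "lower_est R 4 (\<lambda>m. d (map f [0..<n] ! m)) S" "upper_est R (2 * U) (\<lambda>m. d (map f [0..<n] ! m)) S"
        using f[of n] unfolding C_def by blast+
      moreover have "d (map f [0..<n] ! m) = d (f m)" if "m \<in> S" for m using n that by simp
      ultimately show ?thesis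
        using lower_est_cong[of S "\<lambda>m. d (map f [0..<n] ! m)" "\<lambda>n. d (f n)"]
          upper_est_cong[of S "\<lambda>m. d (map f [0..<n] ! m)" "\<lambda>n. d (f n)"] by simp
    qed
    then show ?thesis by blast
  next
    case True
    obtain h :: "nat list \<Rightarrow> 'a" where h: "\<And>c S. c \<in> C \<Longrightarrow> S \<subseteq> V \<inter> {..length c} \<Longrightarrow>
      lower_est R 2 (\<lambda>n. h (take n c)) S \<and> upper_est R U (\<lambda>n. h (take n c)) S"
      using g[OF tr True] by blast
    have "\<forall>c. \<exists>i. norm (h c - d i) < (1/16) * (1/2) ^ length c" by (intro allI d) simp
    then obtain i where i: "\<And>c. norm (h c - d (i c)) < (1/16) * (1/2) ^ length c" by metis
    define b where "b = rec_nat [] (\<lambda>_ l. l @ [i l])"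
    have b0: "b 0 = []" and bS: "b (Suc n) = b n @ [i (b n)]" for n by (simp_all add: b_def)
    have bmap: "b n = map (\<lambda>k. i (b k)) [0..<n]" for n
      by (induction n) (simp_all add: b0 bS)
    have btake: "take k (b n) = b k" if "k \<le> n" for k n
    proof -
      have "take k (map (\<lambda>k. i (b k)) [0..<n]) = map (\<lambda>k. i (b k)) [0..<k]" using that by (simp add: take_map)
      then show ?thesis using bmap[of n] bmap[of k] by simp
    qed
    have blen: "length (b n) = n" for n using arg_cong[OF bmap[of n], of length] by simp
    have bnth: "b n ! k = i (b k)" if "k < n" for k n
      using arg_cong[OF bmap[of n], of "\<lambda>l. l ! k"] that by simp
    have "b n \<in> C" for n
    proof (induction n)
      case 0
      then show ?case by (auto simp: b0 C_def lower_est_def upper_est_empty U intro!: upper_est_empty) (use U in linarith)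
    next
      case (Suc n)
      show ?case
        unfolding C_def
      proof (intro CollectI allI impI)
        fix S assume S: "S \<subseteq> V \<inter> {..<length (b (Suc n))}"
        then have le: "m \<le> n" if "m \<in> S" for m using that blen by fastforce
        have fin: "finite S" using S finite_subset by blast
        \<comment> \<open>A reading of length n supplies n + 1 vectors, at its prefixes of length 0
          to n. The extra one allows a sequence of length n + 1 to be tested by a reading of length
          n.\<close>
        have "S \<subseteq> V \<inter> {..length (b n)}" using S le blen by auto
        then have est: "lower_est R 2 (\<lambda>m. h (take m (b n))) S" "upper_est R U (\<lambda>m. h (take m (b n))) S"
          using h[OF Suc] by blast+
        show "lower_est R 4 (\<lambda>m. d (b (Suc n) ! m)) S \<and> upper_est R (2 * U) (\<lambda>m. d (b (Suc n) ! m)) S"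
        proof (rule perturbed_estimates[OF fo fin est U])
          fix m assume m: "m \<in> S"
          have "take m (b n) = b m" "b (Suc n) ! m = i (b m)" using le[OF m] btake bnth by auto
          then show "norm (h (take m (b n)) - d (b (Suc n) ! m)) \<le> (1/16) * (1/2) ^ m"
            using i[of "b m"] blen[of m] by simp
        qed
      qed
    qed
    then have "\<not> no_branch C" using bS by (intro branch_of_chain[OF tr, of b]) auto
    then show ?thesis using True by blast
  qed
qed

text \<open>A lower estimate with any constant provides exact dual functionals, so the renorming
  applies with error 0. This keeps constants from growing in the outer induction.\<close>

lemma exact_renorming:
  fixes z :: "'i \<Rightarrow> 'a::banach"
  assumes el: "K_elastic TYPE('a) K" and K: "1 \<le> K" and fo: "forest_order R" and L: "0 \<le> L" and U: "0 < U"
    and est: "\<And>S. finite S \<Longrightarrow> S \<subseteq> V \<Longrightarrow> lower_est R L z S \<and> upper_est R U z S"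
  shows "\<exists>x :: 'i \<Rightarrow> 'a. \<forall>S. finite S \<longrightarrow> S \<subseteq> V \<longrightarrow> lower_est R 1 x S \<and> upper_est R (3 * K) x S"
proof -
  have "\<forall>t\<in>V. \<exists>f. linear f \<and> (\<forall>w. \<bar>f w\<bar> \<le> L * norm w) \<and> (\<forall>s\<in>V. f (z s) = of_bool (R s t))"
    by (intro ballI, rule lower_est_functional[OF fo _ L, of V z]) (use est in auto)
  then obtain \<theta> where \<theta>: "\<And>t. t \<in> V \<Longrightarrow> linear (\<theta> t)" "\<And>t w. t \<in> V \<Longrightarrow> \<bar>\<theta> t w\<bar> \<le> L * norm w"
    "\<And>s t. s \<in> V \<Longrightarrow> t \<in> V \<Longrightarrow> \<theta> t (z s) = of_bool (R s t)" by metis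
  obtain x :: "'i \<Rightarrow> 'a" where "\<And>S. finite S \<Longrightarrow> S \<subseteq> V \<Longrightarrow> lower_est R 1 x S"
    "\<And>S. S \<in> {S. finite S \<and> S \<subseteq> V} \<Longrightarrow> upper_est R (3 * K) x S"
  proof (rule near_biorthogonal_renorming[OF el K fo, where N = V and \<theta> = \<theta> and C = L and y = z
        and \<epsilon> = "\<lambda>_. 0" and \<G> = "{S. finite S \<and> S \<subseteq> V}" and U = U])
    show "\<bar>\<theta> t (z s) - of_bool (R s t)\<bar> \<le> 0" if "s \<in> V" "t \<in> V" for s t using \<theta>(3)[OF that] by simp
  qed (use \<theta>(1,2) est U in auto)
  then show ?thesis by blast
qed

text \<open>\<open>R'\<close> is \<open>R\<close> with the minimal nodes in \<open>D\<close> made incomparable to the nodes above them.\<close>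

lemma decoupled_estimates:
  assumes fo: "forest_order R" and S: "finite S"
    and min: "\<And>n m. n \<in> S \<Longrightarrow> n \<in> D \<Longrightarrow> m \<in> S \<Longrightarrow> R m n \<Longrightarrow> m = n"
    and R': "\<And>n m. n \<in> S \<Longrightarrow> m \<in> S \<Longrightarrow> R' n m \<longleftrightarrow> R n m \<and> (n \<in> D \<longrightarrow> n = m)"
  shows "lower_est R' 1 x S \<Longrightarrow> lower_est R 2 x S" "upper_est R' U x S \<Longrightarrow> upper_est R (2 * U) x S"
proof -
  have eqD: "bsum R' S a n = bsum R S a n" if n: "n \<in> S" "n \<in> D" for a n
    unfolding bsum_def using min[OF n] R' n by (intro sum.cong) auto
  \<comment> \<open>At most one other node of \<open>D\<close> lies below \<open>t\<close>. So the
    two branch sums at \<open>t\<close> differ by at most the sum at one such node, on which both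
    orders agree; this is the source of both factors 2.\<close>
  have cases: "bsum R S a t = bsum R' S a t \<or> (\<exists>n\<in>S. bsum R S a n = bsum R' S a n \<and> bsum R S a t = bsum R S a n + bsum R' S a t)"
    if t: "t \<in> S" for a t
  proof (cases "\<exists>n\<in>S. n \<in> D \<and> n \<noteq> t \<and> R n t")
    case False
    then have "{s \<in> S. R s t} = {s \<in> S. R' s t}" using R' t by blast
    then show ?thesis by (simp add: bsum_def)
  next
    case True
    then obtain n where n: "n \<in> S" "n \<in> D" "n \<noteq> t" "R n t" by blast
    have "m = n" if "m \<in> S" "m \<in> D" "R m t" for m
      using forest_orderD(4)[OF fo that(3) n(4)] min[OF n(1,2) that(1)] min[OF that(1,2) n(1)] by blast
    then have "{s \<in> S. R s t} = insert n {s \<in> S. R' s t}" using R' t n by blast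
    moreover have "n \<notin> {s \<in> S. R' s t}" using R' n t by blast
    ultimately have "bsum R S a t = a n + bsum R' S a t" using S by (simp add: bsum_def)
    moreover have "{s \<in> S. R s n} = {n}" using min[OF n(1,2)] n(1) forest_orderD(1)[OF fo] by blast
    then have "bsum R S a n = a n" by (simp add: bsum_def)
    ultimately show ?thesis using eqD[OF n(1,2)] by (intro disjI2 bexI[of _ n] n(1)) simp_all
  qed
  show "lower_est R 2 x S" if lo: "lower_est R' 1 x S"
    unfolding lower_est_def
  proof (intro allI ballI)
    fix a t assume t: "t \<in> S"
    have "\<bar>bsum R' S a n\<bar> \<le> norm (\<Sum>s\<in>S. a s *\<^sub>R x s)" if "n \<in> S" for n using lower_estD[OF lo that] by simp
    note b = this
    from cases[OF t, of a] show "\<bar>bsum R S a t\<bar> \<le> 2 * norm (\<Sum>s\<in>S. a s *\<^sub>R x s)"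
    proof (elim disjE bexE)
      assume "bsum R S a t = bsum R' S a t"
      then show ?thesis using b[OF t] by linarith
    next
      fix n assume "n \<in> S" "bsum R S a n = bsum R' S a n \<and> bsum R S a t = bsum R S a n + bsum R' S a t"
      then show ?thesis using b[OF t] b[of n] by linarith
    qed
  qed
  show "upper_est R (2 * U) x S" if up: "upper_est R' U x S"
    unfolding upper_est_def
  proof (intro allI impI)
    fix a B assume B: "0 \<le> (B::real)" "\<forall>t\<in>S. \<bar>bsum R S a t\<bar> \<le> B"
    have "norm (\<Sum>s\<in>S. a s *\<^sub>R x s) \<le> U * (2 * B)"
    proof (rule upper_estD[OF up])
      show "\<bar>bsum R' S a t\<bar> \<le> 2 * B" if t: "t \<in> S" for t
        using cases[OF t, of a]
      proof (elim disjE bexE)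
        assume "bsum R S a t = bsum R' S a t"
        then show ?thesis using B t by auto
      next
        fix n assume n: "n \<in> S" "bsum R S a n = bsum R' S a n \<and> bsum R S a t = bsum R S a n + bsum R' S a t"
        have "\<bar>bsum R S a t\<bar> \<le> B" "\<bar>bsum R S a n\<bar> \<le> B" using B(2) t n(1) by auto
        then show ?thesis using n(2) by linarith
      qed
    qed (use B in simp)
    then show "norm (\<Sum>s\<in>S. a s *\<^sub>R x s) \<le> 2 * U * B" by (simp add: mult.assoc mult.left_commute)
  qed
qed

lemma tree_insert_root: "tree C \<Longrightarrow> tree (insert [] ((#) a ` C))"
  unfolding tree_def by (auto simp: append_eq_Cons_conv image_iff)

lemma no_branch_insert_root:
  assumes "no_branch C"
  shows "no_branch (insert [] ((#) a ` C))"
  unfolding no_branch_def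
proof (rule notI, elim exE)
  fix f assume f: "\<forall>n. map f [0..<n] \<in> insert [] ((#) a ` C)"
  have "map (\<lambda>i. f (Suc i)) [0..<n] \<in> C" for n
  proof -
    have "map f [0..<Suc n] = f 0 # map (\<lambda>i. f (Suc i)) [0..<n]"
      by (simp only: upt_conv_Cons[OF zero_less_Suc] map_Suc_upt[symmetric] list.map map_map comp_def)
    then show ?thesis using f[rule_format, of "Suc n"] by auto
  qed
  then show False using assms unfolding no_branch_def by (metis (no_types))
qed

text \<open>After \<open>n\<close> readings the clock has to provide the vector of the node coded by
  \<open>n\<close>. If this node begins with \<open>j\<close>, it is placed in a component at the
  prefix of length \<open>j + 1\<close> of the reading. Thus everything strictly above
  \<open>[j]\<close> comes from one component, and the places along a chain form a good set.\<close>

lemma embedding_step: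
  assumes sep: "separable_space (euclidean :: 'a::banach topology)"
    and el: "K_elastic TYPE('a::banach) K" and K: "1 \<le> K"
    and infdim: "\<not> (\<exists>B :: 'a::banach set. finite B \<and> span B = UNIV)"
    and A: "tree A" "no_branch A" "spreading A"
    and E: "\<And>j. \<exists>x :: nat list \<Rightarrow> 'a::banach. embedded (subtree A [j]) (3 * K) x"
  shows "\<exists>x :: nat list \<Rightarrow> 'a::banach. embedded A (3 * K) x"
proof -
  define V where "V = {n. list_decode n \<in> A - {[]}}"
  define R where "R n m \<longleftrightarrow> prefix (list_decode n) (list_decode m)" for n m :: nat
  have fo: "forest_order R"
    using forest_orderD[OF forest_order_prefix[where 'b = nat]] unfolding forest_order_def R_def
    by (metis list_decode_eq)
  have "\<exists>z :: nat \<Rightarrow> 'a. \<forall>S. finite S \<longrightarrow> S \<subseteq> V \<longrightarrow> lower_est R 4 z S \<and> upper_est R (2 * (2 * (3 * K))) z S"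
  proof (rule boundedness[OF sep fo])
    show "1 \<le> 2 * (3 * K)" using K by simp
    fix C assume C: "tree C" "no_branch C"
    \<comment> \<open>With the added entry, the prefix used for \<open>j = 0\<close> is also a
      strict extension of the root.\<close>
    define C' where "C' = insert [] ((#) 0 ` C)"
    obtain x :: "(nat list \<times> bool) \<times> nat list \<Rightarrow> 'a" where x: "chain_embedded A C' (3 * K) [] x"
      using chain_embedding[OF el K infdim A E, of C' "[]"] tree_insert_root[OF C(1)] no_branch_insert_root[OF C(2)]
      unfolding C'_def by blast
    \<comment> \<open>A node \<open>[j]\<close> takes the candidate \<open>[0]\<close> of the
      \<open>False\<close> component, an arbitrary but fixed choice; all other nodes go by their
      tail into the copy of the subtree.\<close>
    define h where "h c n = ((take (Suc (hd (list_decode n))) (0 # c), tl (list_decode n) \<noteq> []),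
      if tl (list_decode n) = [] then [0] else tl (list_decode n))" for c :: "nat list" and n
    show "\<exists>g :: nat list \<Rightarrow> 'a. \<forall>c\<in>C. \<forall>S. S \<subseteq> V \<inter> {..length c} \<longrightarrow>
      lower_est R 2 (\<lambda>n. g (take n c)) S \<and> upper_est R (2 * (3 * K)) (\<lambda>n. g (take n c)) S"
    proof (intro exI[of _ "\<lambda>c. x (h c (length c))"] ballI allI impI)
      fix c S assume c: "c \<in> C" and S: "S \<subseteq> V \<inter> {..length c}"
      have fin: "finite S" using S finite_subset by blast
      have dec: "\<exists>j u. list_decode n = j # u \<and> j \<le> n \<and> j \<le> length c \<and> n \<le> length c \<and> j # u \<in> A" if n: "n \<in> S" for n
      proof -
        have "n \<in> V" "n \<le> length c" using S n by auto
        then obtain j u where ju: "list_decode n = j # u" "j # u \<in> A" by (auto simp: V_def neq_Nil_conv)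
        then have "n = list_encode (j # u)" by (metis list_decode_inverse)
        \<comment> \<open>The code dominates the first entry, so the place of the node depends only
          on the first \<open>n\<close> readings.\<close>
        then have "j \<le> n" using le_prod_encode_1[of j "list_encode u"] by simp
        then show ?thesis using ju \<open>n \<le> length c\<close> by auto
      qed
      have hn: "h (take n c) (length (take n c)) = h c n" if n: "n \<in> S" for n
      proof -
        obtain j u where "list_decode n = j # u" "j \<le> n" "n \<le> length c" using dec[OF n] by blast
        then show ?thesis by (simp add: h_def min_absorb1 min_absorb2 take_Cons')
      qed
      have hnode: "h c n \<in> snodes A C' []" if n: "n \<in> S" for n
      proof -
        obtain j u where ju: "list_decode n = j # u" "j \<le> length c" "j # u \<in> A" using dec[OF n] by blast
        have "take j c \<in> C" by (rule tree_prefix[OF C(1) c take_is_prefix])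
        then show ?thesis using ju by (auto simp: h_def snodes_def C'_def ctree_def subtree_def min_absorb2 strict_prefix_def)
      qed
      have good: "good_set (h c ` S)"
        unfolding good_set_def
      proof (intro conjI allI impI)
        show "finite (h c ` S)" using fin by simp
        show "\<exists>e. \<forall>s\<in>h c ` S. prefix (fst (fst s)) e"
          by (intro exI[of _ "0 # c"]) (auto simp: h_def take_is_prefix simp del: take_Suc_Cons)
        show "u = v" if "((e, False), u) \<in> h c ` S" "((e, False), v) \<in> h c ` S" for e u v
          using that by (auto simp: h_def split: if_splits)
      qed
      define D where "D = {n. length (list_decode n) = 1}"
      have key: "comp_le (h c n) (h c m) \<longleftrightarrow> R n m \<and> (n \<in> D \<longrightarrow> n = m)" and injk: "h c n = h c m \<longleftrightarrow> n = m"
        if nm: "n \<in> S" "m \<in> S" for n m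
      proof -
        obtain j u where ju: "list_decode n = j # u" "j \<le> length c" using dec[OF nm(1)] by blast
        obtain j' u' where ju': "list_decode m = j' # u'" "j' \<le> length c" using dec[OF nm(2)] by blast
        have tk: "take j c = take j' c \<longleftrightarrow> j = j'"
          using ju(2) ju'(2) by (metis length_take min.absorb2)
        have eq: "n = m \<longleftrightarrow> j = j' \<and> u = u'" using ju(1) ju'(1) by (metis list.inject list_decode_eq)
        show "comp_le (h c n) (h c m) \<longleftrightarrow> R n m \<and> (n \<in> D \<longrightarrow> n = m)"
          unfolding eq using ju(1) ju'(1) tk by (auto simp: h_def comp_le_def R_def D_def)
        show "h c n = h c m \<longleftrightarrow> n = m"
          unfolding eq using ju(1) ju'(1) tk by (auto simp: h_def)
      qed
      have inj: "inj_on (h c) S" using injk by (auto intro: inj_onI)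
      define R' where "R' n m \<longleftrightarrow> R n m \<and> (n \<in> D \<longrightarrow> n = m)" for n m
      have hsub: "h c ` S \<subseteq> snodes A C' []" using hnode by blast
      have lo: "lower_est R' 1 (\<lambda>n. x (h c n)) S"
        using x fin hsub key by (intro lower_est_reindex[OF inj, where R' = comp_le]) (auto simp: R'_def chain_embedded_def)
      have up: "upper_est R' (3 * K) (\<lambda>n. x (h c n)) S"
        using x good hsub key by (intro upper_est_reindex[OF inj, where R' = comp_le]) (auto simp: R'_def chain_embedded_def)
      have min: "m = n" if nm: "n \<in> S" "n \<in> D" "m \<in> S" "R m n" for n m
      proof -
        obtain j u where ju: "list_decode n = j # u" using dec[OF nm(1)] by blast
        obtain j' u' where ju': "list_decode m = j' # u'" using dec[OF nm(3)] by blast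
        show ?thesis using nm(2,4) ju ju' by (simp add: D_def R_def) (metis list_decode_eq)
      qed
      have cong: "x (h c n) = x (h (take n c) (length (take n c)))" if "n \<in> S" for n using hn[OF that] by simp
      show "lower_est R 2 (\<lambda>n. x (h (take n c) (length (take n c)))) S \<and>
        upper_est R (2 * (3 * K)) (\<lambda>n. x (h (take n c) (length (take n c)))) S"
        using lower_est_cong[OF cong decoupled_estimates(1)[OF fo fin min _ lo]]
          upper_est_cong[OF cong decoupled_estimates(2)[OF fo fin min _ up]] by (simp add: R'_def)
    qed
  qed
  then obtain z :: "nat \<Rightarrow> 'a" where "\<And>S. finite S \<Longrightarrow> S \<subseteq> V \<Longrightarrow> lower_est R 4 z S \<and> upper_est R (2 * (2 * (3 * K))) z S" by blast
  then obtain y :: "nat \<Rightarrow> 'a" where y: "\<And>S. finite S \<Longrightarrow> S \<subseteq> V \<Longrightarrow> lower_est R 1 y S \<and> upper_est R (3 * K) y S"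
    using exact_renorming[OF el K fo, of 4 "2 * (2 * (3 * K))" V z] K by auto
  have "embedded A (3 * K) (\<lambda>u. y (list_encode u))"
    unfolding embedded_def
  proof (intro allI impI conjI)
    fix S assume S: "finite S" "S \<subseteq> A - {[]}"
    have inj: "inj_on list_encode S" by (simp add: inj_on_def list_encode_eq)
    have img: "finite (list_encode ` S)" "list_encode ` S \<subseteq> V" using S by (auto simp: V_def)
    show "lower_est prefix 1 (\<lambda>u. y (list_encode u)) S"
      using y[OF img] by (intro lower_est_reindex[OF inj, where R' = R]) (auto simp: R_def)
    show "upper_est prefix (3 * K) (\<lambda>u. y (list_encode u)) S"
      using y[OF img] by (intro upper_est_reindex[OF inj, where R' = R]) (auto simp: R_def)
  qed
  then show ?thesis by blast
qed

lemma embedded_empty: "0 \<le> U \<Longrightarrow> A \<subseteq> {[]} \<Longrightarrow> embedded A U x"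
  unfolding embedded_def lower_est_def using upper_est_empty[of U prefix x]
  by (auto simp: subset_iff) (metis all_not_in_conv)

text \<open>Bar induction over the subtrees of \<open>A\<close>. Since \<open>3 * K\<close>
  reproduces itself, it does not depend on the rank of \<open>A\<close>.\<close>

lemma all_embedded:
  assumes sep: "separable_space (euclidean :: 'a::banach topology)"
    and el: "K_elastic TYPE('a::banach) K" and K: "1 \<le> K"
    and infdim: "\<not> (\<exists>B :: 'a::banach set. finite B \<and> span B = UNIV)"
    and A: "tree A" "no_branch A" "spreading A"
  shows "\<exists>x :: nat list \<Rightarrow> 'a::banach. embedded A (3 * K) x"
proof (cases "[] \<in> A")
  case False
  then have "A \<subseteq> {[]}" using treeD[OF A(1), of "[]"] by auto
  then show ?thesis using embedded_empty[of "3 * K"] K by auto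
next
  case True
  have "\<exists>x :: nat list \<Rightarrow> 'a. embedded (subtree A s) (3 * K) x" if "s \<in> A" for s
    using A(2,1) that
  proof (induction s rule: bar_induction)
    case (step s)
    have "\<exists>x :: nat list \<Rightarrow> 'a. embedded (subtree (subtree A s) [j]) (3 * K) x" for j
    proof (cases "s @ [j] \<in> A")
      case True
      have "subtree (subtree A s) [j] = subtree A (s @ [j])" by (simp add: subtree_def)
      then show ?thesis using step(2)[OF True] by simp
    next
      case False
      have "subtree (subtree A s) [j] \<subseteq> {[]}" using False treeD[OF A(1), of "s @ [j]"] by (auto simp: subtree_def)
      then show ?thesis using embedded_empty[of "3 * K"] K by auto
    qed
    from embedding_step[OF sep el K infdim tree_subtree[OF A(1)] no_branch_subtree[OF A(1,2)] spreading_subtree[OF A(3)] this]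
    show ?case .
  qed
  from this[OF True] show ?thesis by (simp add: subtree_def)
qed

section \<open>An infinitely branching tree on the natural numbers and its places in well-founded
  trees\<close>

section \<open>The full tree\<close>

text \<open>Each number except 0 is a coded pair of parent and label, shifted by one. This makes the
  naturals a tree with root 0, infinitely many children at each node, and parents smaller than
  children.\<close>

definition par :: "nat \<Rightarrow> nat" where
  "par n = fst (prod_decode (n - 1))"

lemma par_less: "0 < n \<Longrightarrow> par n < n"
  using le_prod_encode_1[of "fst (prod_decode (n - 1))" "snd (prod_decode (n - 1))"] by (simp add: par_def)

definition child :: "nat \<Rightarrow> nat \<Rightarrow> nat" where
  "child m b = Suc (prod_encode (m, b))"

lemma par_child [simp]: "par (child m b) = m"
  by (simp add: par_def child_def)

lemma child_eq [simp]: "child m b = child m' b' \<longleftrightarrow> m = m' \<and> b = b'"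
  by (simp add: child_def)

lemma less_child: "m < child m b"
  using le_prod_encode_1[of m b] by (simp add: child_def)

function anc :: "nat \<Rightarrow> nat \<Rightarrow> bool" where
  "anc n k \<longleftrightarrow> n = k \<or> (if k = 0 then False else anc n (par k))"
  by auto
termination by (relation "Wellfounded.measure snd") (auto intro: par_less)

declare anc.simps [simp del]

lemma anc_iff: "anc n k \<longleftrightarrow> n = k \<or> (0 < k \<and> anc n (par k))"
  by (subst anc.simps) auto

text \<open>\<open>pos c n\<close> is where the node \<open>n\<close> of the full tree is placed when the clock shows \<open>c\<close>: it dominates
  \<open>0 # take n c\<close> pointwise, and the shift by \<open>n\<close> makes the places of siblings incomparable.\<close>

function pos :: "nat list \<Rightarrow> nat \<Rightarrow> nat list" where
  "pos c n = (if n = 0 then [0] else pos c (par n) @ map (\<lambda>i. i + n) (drop (par n) (take n c)))"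
  by auto
termination by (relation "Wellfounded.measure snd") (auto intro: par_less)

declare pos.simps [simp del]

lemma pos_0: "pos c 0 = [0]"
  by (simp add: pos.simps)

lemma pos_pos: "0 < n \<Longrightarrow> pos c n = pos c (par n) @ map (\<lambda>i. i + n) (drop (par n) (take n c))"
  by (subst pos.simps) simp

lemma length_pos: "n \<le> length c \<Longrightarrow> length (pos c n) = Suc n"
proof (induction n rule: less_induct)
  case (less n)
  show ?case
  proof (cases "n = 0")
    case False
    then have "par n < n" by (simp add: par_less)
    then show ?thesis using less False by (simp add: pos_pos[of n])
  qed (simp add: pos_0)
qed

text \<open>The shift \<open>q\<close> is the number of the node on the path to \<open>n\<close>
  that wrote this entry, so it cannot exceed \<open>n\<close>; this is what separates
  branches.\<close>

lemma pos_entry: "n \<le> length c \<Longrightarrow> l < n \<Longrightarrow> \<exists>q. l < q \<and> q \<le> n \<and> pos c n ! Suc l = c ! l + q"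
proof (induction n rule: less_induct)
  case (less n)
  then have p: "par n < n" "0 < n" using par_less by auto
  show ?case
  proof (cases "l < par n")
    case True
    then obtain q where "l < q" "q \<le> par n" "pos c (par n) ! Suc l = c ! l + q" using less p by fastforce
    then show ?thesis using True p less.prems length_pos[of "par n" c]
      by (intro exI[of _ q]) (simp add: pos_pos[of n] nth_append)
  next
    case False
    then show ?thesis using p less.prems length_pos[of "par n" c]
      by (intro exI[of _ n]) (simp add: pos_pos[of n] nth_append nth_drop)
  qed
qed

lemma pos_ge: "n \<le> length c \<Longrightarrow> list_all2 (\<le>) (0 # take n c) (pos c n)"
  unfolding list_all2_conv_all_nth
proof (intro conjI allI impI)
  fix i assume n: "n \<le> length c" and i: "i < length (0 # take n c)"
  show "(0 # take n c) ! i \<le> pos c n ! i"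
  proof (cases i)
    case 0 then show ?thesis by simp
  next
    case (Suc l)
    then show ?thesis using pos_entry[OF n, of l] i n by auto
  qed
qed (simp add: length_pos)

lemma pos_take: "n \<le> k \<Longrightarrow> pos (take k c) n = pos c n"
proof (induction n rule: less_induct)
  case (less n)
  show ?case
  proof (cases "n = 0")
    case False
    then have "par n < n" by (simp add: par_less)
    then show ?thesis using less False by (simp add: pos_pos[of n] min_absorb1)
  qed (simp add: pos_0)
qed

text \<open>Suppose n < k and \<open>pos c n\<close> is a prefix of \<open>pos c k\<close> but not
  of the place of \<open>par k\<close>. At position \<open>par k + 1\<close> both contain the same
  clock entry, shifted by \<open>k\<close> in one and by at most \<open>n\<close> in the other, a
  contradiction.\<close>

lemma prefix_pos: "n \<le> length c \<Longrightarrow> k \<le> length c \<Longrightarrow> prefix (pos c n) (pos c k) \<longleftrightarrow> anc n k"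
proof (induction k rule: less_induct)
  case (less k)
  show ?case
  proof (cases "k = 0")
    case True
    have "prefix (pos c n) (pos c 0) \<Longrightarrow> n = 0"
      using prefix_length_le[of "pos c n" "pos c 0"] length_pos less.prems by (simp add: pos_0)
    then show ?thesis using True by (subst anc_iff) auto
  next
    case False
    define m where "m = par k"
    have m: "m < k" "0 < k" using False par_less by (auto simp: m_def)
    have eq: "pos c k = pos c m @ map (\<lambda>i. i + k) (drop m (take k c))" using pos_pos[OF m(2)] by (simp add: m_def)
    have IH: "prefix (pos c n) (pos c m) \<longleftrightarrow> anc n m" using less m by simp
    have an: "anc n k \<longleftrightarrow> n = k \<or> anc n m" using m(2) by (subst anc_iff) (simp add: m_def)
    show ?thesis
      unfolding an IH[symmetric]
    proof
      assume pre: "prefix (pos c n) (pos c k)"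
      then have nk: "n \<le> k" using prefix_length_le[OF pre] length_pos less.prems by simp
      show "n = k \<or> prefix (pos c n) (pos c m)"
      proof (rule ccontr)
        assume no: "\<not> ?thesis"
        then have lt: "n < k" using nk by simp
        have "m < n"
        proof (rule ccontr)
          assume "\<not> m < n"
          then have "length (pos c n) \<le> length (pos c m)" using length_pos less.prems m by simp
          then have "prefix (pos c n) (pos c m)"
            using pre eq by (metis prefix_length_prefix prefixI)
          then show False using no by simp
        qed
        then obtain q where q: "q \<le> n" "pos c n ! Suc m = c ! m + q" using pos_entry[OF less.prems(1), of m] by blast
        have "pos c n ! Suc m = pos c k ! Suc m"
          using pre \<open>m < n\<close> length_pos[OF less.prems(1)] by (auto simp: prefix_def nth_append)
        also have "\<dots> = c ! m + k" unfolding eq using length_pos[of m c] m less.prems by (simp add: nth_append)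
        finally show False using q lt by simp
      qed
    next
      assume "n = k \<or> prefix (pos c n) (pos c m)"
      then show "prefix (pos c n) (pos c k)" using eq by (elim disjE) (simp, simp)
    qed
  qed
qed

lemma pos_inj: "n \<le> length c \<Longrightarrow> k \<le> length c \<Longrightarrow> pos c n = pos c k \<longleftrightarrow> n = k"
  using length_pos by (metis nat.inject)

text \<open>The axioms are inherited from the prefix order through \<open>pos\<close>, with a clock
  of zeros long enough for the nodes involved.\<close>

lemma forest_order_anc: "forest_order anc"
  unfolding forest_order_def
proof (intro conjI allI impI)
  define c where "c r s t = replicate (r + s + t) (0::nat)" for r s t :: nat
  have P: "anc a b \<longleftrightarrow> prefix (pos (c r s t) a) (pos (c r s t) b)"
    if "a \<le> r + s + t" "b \<le> r + s + t" for a b r s t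
    using that by (simp add: prefix_pos c_def)
  show "anc s s" for s by (subst anc_iff) simp
  show "s = t" if "anc s t" "anc t s" for s t
    using that P[of s s t 0 t] P[of t s t 0 s] pos_inj[of s "c s t 0" t]
    by (auto simp: c_def dest: prefix_order.antisym)
  show "anc r t" if "anc r s" "anc s t" for r s t
    using that P[of r r s t s] P[of s r s t t] P[of r r s t t] by (auto intro: prefix_order.trans)
  show "anc r s \<or> anc s r" if "anc r t" "anc s t" for r s t
    using that P[of r r s t t] P[of s r s t t] P[of r r s t s] P[of s r s t r] by (auto dest: prefix_same_cases)
qed

text \<open>For a clock \<open>C\<close>, all places \<open>pos c n\<close> lie in the spread of
  \<open>C\<close> with a root entry added, which is still well-founded. Embedding that tree yields
  the clocked system that boundedness asks for.\<close>

lemma full_tree_embedding: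
  assumes sep: "separable_space (euclidean :: 'a::banach topology)"
    and el: "K_elastic TYPE('a::banach) K" and K: "1 \<le> K"
    and infdim: "\<not> (\<exists>B :: 'a::banach set. finite B \<and> span B = UNIV)"
  shows "\<exists>z :: nat \<Rightarrow> 'a::banach. \<forall>S. finite S \<longrightarrow> lower_est anc 4 z S \<and> upper_est anc (2 * (3 * K)) z S"
proof -
  have "\<exists>z :: nat \<Rightarrow> 'a. \<forall>S. finite S \<longrightarrow> S \<subseteq> UNIV \<longrightarrow> lower_est anc 4 z S \<and> upper_est anc (2 * (3 * K)) z S"
  proof (rule boundedness[OF sep forest_order_anc])
    show "1 \<le> 3 * K" using K by simp
    fix C assume C: "tree C" "no_branch C"
    define A where "A = spread (insert [] ((#) 0 ` C))"
    obtain x :: "nat list \<Rightarrow> 'a" where x: "embedded A (3 * K) x"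
      using all_embedded[OF sep el K infdim, of A] tree_spread[OF tree_insert_root[OF C(1)]]
        no_branch_spread[OF tree_insert_root[OF C(1)] no_branch_insert_root[OF C(2)]] spreading_spread
      unfolding A_def by blast
    show "\<exists>g :: nat list \<Rightarrow> 'a. \<forall>c\<in>C. \<forall>S. S \<subseteq> UNIV \<inter> {..length c} \<longrightarrow>
      lower_est anc 2 (\<lambda>n. g (take n c)) S \<and> upper_est anc (3 * K) (\<lambda>n. g (take n c)) S"
    proof (intro exI[of _ "\<lambda>c. x (pos c (length c))"] ballI allI impI)
      fix c S assume c: "c \<in> C" and S: "S \<subseteq> UNIV \<inter> {..length c}"
      have fin: "finite S" using S finite_subset by blast
      have le: "n \<le> length c" if "n \<in> S" for n using that S by auto
      have inj: "inj_on (pos c) S" using pos_inj le by (auto intro: inj_onI)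
      have key: "prefix (pos c n) (pos c k) \<longleftrightarrow> anc n k" if "n \<in> S" "k \<in> S" for n k
        using that by (simp add: prefix_pos le)
      have "pos c n \<in> A - {[]}" if n: "n \<in> S" for n
      proof -
        have "take n c \<in> C" by (rule tree_prefix[OF C(1) c take_is_prefix])
        then have "pos c n \<in> A" using pos_ge[OF le[OF n]] unfolding A_def spread_def by blast
        moreover have "pos c n \<noteq> []" using length_pos[OF le[OF n]] by auto
        ultimately show ?thesis by simp
      qed
      then have img: "finite (pos c ` S)" "pos c ` S \<subseteq> A - {[]}" using fin by auto
      have est: "lower_est prefix 1 x (pos c ` S)" "upper_est prefix (3 * K) x (pos c ` S)"
        using x img unfolding embedded_def by blast+
      have lo: "lower_est anc 1 (\<lambda>n. x (pos c n)) S" by (rule lower_est_reindex[OF inj key est(1)])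
      have lo2: "lower_est anc 2 (\<lambda>n. x (pos c n)) S"
        unfolding lower_est_def
      proof (intro allI ballI)
        fix a t assume t: "t \<in> S"
        show "\<bar>bsum anc S a t\<bar> \<le> 2 * norm (\<Sum>s\<in>S. a s *\<^sub>R x (pos c s))"
          using lower_estD[OF lo t, of a] by (smt (verit) norm_ge_zero)
      qed
      have up: "upper_est anc (3 * K) (\<lambda>n. x (pos c n)) S" by (rule upper_est_reindex[OF inj key est(2)])
      have eq: "x (pos c n) = x (pos (take n c) (length (take n c)))" if "n \<in> S" for n
        using le[OF that] by (simp add: pos_take min_absorb2)
      show "lower_est anc 2 (\<lambda>n. x (pos (take n c) (length (take n c)))) S \<and>
        upper_est anc (3 * K) (\<lambda>n. x (pos (take n c) (length (take n c)))) S"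
        using lower_est_cong[OF eq lo2] upper_est_cong[OF eq up] by simp
    qed
  qed
  then show ?thesis by simp
qed

section \<open>Dyadic cells in the full tree and the passage to continuous functions\<close>

section \<open>From the full tree to C[0,1]\<close>

lemma anc_le: "anc n k \<Longrightarrow> n \<le> k"
proof (induction k rule: less_induct)
  case (less k)
  then show ?case using par_less[of k] by (metis anc_iff less_imp_le order_refl order_trans)
qed

lemma anc_child: "anc m (child m b)"
  by (subst anc_iff) (simp add: child_def[of m b, symmetric] anc_iff[of m m], simp add: child_def)

lemma anc_children_disjoint:
  assumes "anc (child m b) t" "anc (child m b') t"
  shows "b = b'"
proof (rule ccontr)
  assume ne: "b \<noteq> b'"
  have no: "\<not> anc (child m i) (child m j)" if "i \<noteq> j" for i j
  proof
    assume "anc (child m i) (child m j)"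
    then have "anc (child m i) m" using that by (subst (asm) anc_iff) simp
    then show False using anc_le[of "child m i" m] less_child[of m i] by simp
  qed
  show False using forest_orderD(4)[OF forest_order_anc assms] no[OF ne] no[OF ne[symmetric]] by blast
qed

text \<open>A dyadic splitting: the cell \<open>(m, b)\<close> is divided into the part above
  \<open>child m b\<close>, which becomes the left half, and the remainder
  \<open>(m, Suc b)\<close>, the right half. The supply of children is never exhausted and
  \<open>m\<close> stays in the remainder, so no cell is empty.\<close>

fun cell :: "nat \<Rightarrow> nat \<Rightarrow> nat \<times> nat" where
  "cell 0 k = (0, 0)"
| "cell (Suc n) k = (let (m, b) = cell n (k div 2) in if even k then (child m b, 0) else (m, Suc b))"

definition cell_val :: "(nat \<Rightarrow> 'v::real_vector) \<Rightarrow> nat \<times> nat \<Rightarrow> 'v" where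
  "cell_val f c = f (fst c) - (\<Sum>j<snd c. f (child (fst c) j))"

definition cell_nodes :: "nat \<times> nat \<Rightarrow> nat set" where
  "cell_nodes c = insert (fst c) (child (fst c) ` {..<snd c})"

lemma cell_val_split:
  "cell_val f (cell n k) = cell_val f (cell (Suc n) (2 * k)) + cell_val f (cell (Suc n) (2 * k + 1))"
  by (cases "cell n k") (simp add: cell_val_def)

text \<open>Applied to the Kronecker delta at \<open>s\<close>, \<open>cell_val\<close> yields the
  coefficient of the node \<open>s\<close> in the cell. This translates sums over cells into sums
  over nodes.\<close>

lemma cell_val_sum:
  assumes "finite S" "cell_nodes c \<subseteq> S"
  shows "(\<Sum>s\<in>S. cell_val (\<lambda>r. of_bool (s = r) :: real) c *\<^sub>R f s) = cell_val f c"
proof -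
  have delta: "(\<Sum>s\<in>S. (of_bool (s = r) :: real) *\<^sub>R f s) = f r" if "r \<in> S" for r
  proof -
    have "(\<Sum>s\<in>S. (of_bool (s = r) :: real) *\<^sub>R f s) = (\<Sum>s\<in>S. if s = r then f s else 0)"
      by (intro sum.cong) auto
    also have "\<dots> = f r" using assms(1) that by simp
    finally show ?thesis .
  qed
  have "(\<Sum>s\<in>S. cell_val (\<lambda>r. of_bool (s = r) :: real) c *\<^sub>R f s)
    = (\<Sum>s\<in>S. (of_bool (s = fst c) :: real) *\<^sub>R f s) - (\<Sum>s\<in>S. \<Sum>j<snd c. (of_bool (s = child (fst c) j) :: real) *\<^sub>R f s)"
    by (simp only: cell_val_def scaleR_diff_left scaleR_sum_left sum_subtractf)
  also have "(\<Sum>s\<in>S. \<Sum>j<snd c. (of_bool (s = child (fst c) j) :: real) *\<^sub>R f s)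
    = (\<Sum>j<snd c. \<Sum>s\<in>S. (of_bool (s = child (fst c) j) :: real) *\<^sub>R f s)" by (rule sum.swap)
  also have "\<dots> = (\<Sum>j<snd c. f (child (fst c) j))"
    using assms(2) by (intro sum.cong refl delta) (auto simp: cell_nodes_def)
  also have "(\<Sum>s\<in>S. (of_bool (s = fst c) :: real) *\<^sub>R f s) = f (fst c)"
    using assms(2) by (intro delta) (auto simp: cell_nodes_def)
  finally show ?thesis by (simp add: cell_val_def)
qed

lemma sum_even_odd: "(\<Sum>k<2 * N. g k) = (\<Sum>k<N. g (2 * k) + g (2 * k + 1))" for g :: "nat \<Rightarrow> 'v::comm_monoid_add"
  by (induction N) (simp_all add: add.assoc)

lemma cell_sum_refine1:
  "(\<Sum>k<2 ^ n. \<beta> k *\<^sub>R cell_val f (cell n k)) = (\<Sum>k<2 ^ Suc n. \<beta> (k div 2) *\<^sub>R cell_val f (cell (Suc n) k))"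
proof -
  have "(\<Sum>k<2 ^ Suc n. \<beta> (k div 2) *\<^sub>R cell_val f (cell (Suc n) k))
    = (\<Sum>k<2 ^ n. \<beta> k *\<^sub>R cell_val f (cell (Suc n) (2 * k)) + \<beta> k *\<^sub>R cell_val f (cell (Suc n) (2 * k + 1)))"
    unfolding power_Suc sum_even_odd by simp
  also have "\<dots> = (\<Sum>k<2 ^ n. \<beta> k *\<^sub>R cell_val f (cell n k))"
    by (simp only: scaleR_add_right[symmetric] cell_val_split[symmetric])
  finally show ?thesis by simp
qed

lemma cell_sum_refine:
  "(\<Sum>k<2 ^ n. \<beta> k *\<^sub>R cell_val f (cell n k)) = (\<Sum>k<2 ^ (n + d). \<beta> (k div 2 ^ d) *\<^sub>R cell_val f (cell (n + d) k))"
proof (induction d)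
  case (Suc d)
  have "(\<Sum>k<2 ^ (n + d). \<beta> (k div 2 ^ d) *\<^sub>R cell_val f (cell (n + d) k))
    = (\<Sum>k<2 ^ Suc (n + d). \<beta> (k div 2 div 2 ^ d) *\<^sub>R cell_val f (cell (Suc (n + d)) k))"
    by (rule cell_sum_refine1)
  then show ?case using Suc by (simp only: add_Suc_right div_mult2_eq power_Suc)
qed simp

text \<open>At the point \<open>t\<close> of the tree, a cell \<open>(m, b)\<close> is the indicator of the nodes above \<open>m\<close>
  that are not above one of the first \<open>b\<close> children of \<open>m\<close>.\<close>

lemma cell_val_indicator:
  "cell_val (\<lambda>s. of_bool (anc s t) :: real) (m, b) = of_bool (anc m t \<and> (\<forall>j<b. \<not> anc (child m j) t))"
proof (induction b)
  case 0
  then show ?case by (simp add: cell_val_def)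
next
  case (Suc b)
  have "cell_val (\<lambda>s. of_bool (anc s t) :: real) (m, Suc b)
    = cell_val (\<lambda>s. of_bool (anc s t) :: real) (m, b) - of_bool (anc (child m b) t)" by (simp add: cell_val_def)
  also have "\<dots> = of_bool (anc m t \<and> (\<forall>j<Suc b. \<not> anc (child m j) t))"
  proof (cases "anc (child m b) t")
    case True
    then have "anc m t" using forest_orderD(3)[OF forest_order_anc anc_child] by blast
    moreover have "\<forall>j<b. \<not> anc (child m j) t" using anc_children_disjoint True by blast
    ultimately show ?thesis using Suc True by (auto simp: less_Suc_eq)
  next
    case False
    then show ?thesis using Suc by (auto simp: less_Suc_eq)
  qed
  finally show ?case .
qed

lemma cell_val_nonneg: "0 \<le> cell_val (\<lambda>s. of_bool (anc s t) :: real) c"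
  using cell_val_indicator[of t "fst c" "snd c"] by simp

lemma cell_val_self: "cell_val (\<lambda>s. of_bool (anc s (fst c)) :: real) c = 1"
proof -
  have "\<not> anc (child (fst c) j) (fst c)" for j
    using anc_le[of "child (fst c) j" "fst c"] less_child[of "fst c" j] by auto
  moreover have "anc (fst c) (fst c)" by (rule forest_orderD(1)[OF forest_order_anc])
  ultimately show ?thesis using cell_val_indicator[of "fst c" "fst c" "snd c"] by simp
qed

lemma cell_partition: "(\<Sum>k<2 ^ n. cell_val (\<lambda>s. of_bool (anc s t) :: real) (cell n k)) \<le> 1"
proof -
  have "cell_val f (0, 0) = (\<Sum>k<2 ^ n. cell_val f (cell n k))" for f :: "nat \<Rightarrow> real"
    using cell_sum_refine[of "\<lambda>_. 1" f 0 n] by simp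
  from this[symmetric] show ?thesis by (simp only:) (simp add: cell_val_indicator)
qed

text \<open>Branch sums are the values of a step function. Cells of one level are disjoint, so a
  value is at most the largest coefficient, and at the base node of the k-th cell, which lies in no
  other cell, it is the k-th coefficient.\<close>

lemma cell_estimates:
  fixes z :: "nat \<Rightarrow> 'a::real_normed_vector"
  assumes est: "\<And>S. finite S \<Longrightarrow> lower_est anc L z S \<and> upper_est anc U z S"
  shows "0 \<le> B \<Longrightarrow> (\<And>k. k < 2 ^ n \<Longrightarrow> \<bar>\<beta> k\<bar> \<le> B) \<Longrightarrow> norm (\<Sum>k<2 ^ n. \<beta> k *\<^sub>R cell_val z (cell n k)) \<le> U * B"
    and "k < 2 ^ n \<Longrightarrow> \<bar>\<beta> k\<bar> \<le> L * norm (\<Sum>k<2 ^ n. \<beta> k *\<^sub>R cell_val z (cell n k))"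
proof -
  define S where "S = (\<Union>k<2 ^ n. cell_nodes (cell n k))"
  have S: "finite S" "\<And>k. k < 2 ^ n \<Longrightarrow> cell_nodes (cell n k) \<subseteq> S" by (auto simp: S_def cell_nodes_def)
  define a where "a s = (\<Sum>k<2 ^ n. \<beta> k * cell_val (\<lambda>r. of_bool (s = r) :: real) (cell n k))" for s
  have app: "(\<Sum>s\<in>S. a s *\<^sub>R f s) = (\<Sum>k<2 ^ n. \<beta> k *\<^sub>R cell_val f (cell n k))" for f :: "nat \<Rightarrow> 'v::real_vector"
  proof -
    have "(\<Sum>s\<in>S. a s *\<^sub>R f s) = (\<Sum>s\<in>S. \<Sum>k<2 ^ n. \<beta> k *\<^sub>R (cell_val (\<lambda>r. of_bool (s = r) :: real) (cell n k) *\<^sub>R f s))"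
      by (simp add: a_def scaleR_sum_left)
    also have "\<dots> = (\<Sum>k<2 ^ n. \<Sum>s\<in>S. \<beta> k *\<^sub>R (cell_val (\<lambda>r. of_bool (s = r) :: real) (cell n k) *\<^sub>R f s))" by (rule sum.swap)
    also have "\<dots> = (\<Sum>k<2 ^ n. \<beta> k *\<^sub>R cell_val f (cell n k))"
      using S by (intro sum.cong refl) (simp only: scaleR_sum_right[symmetric] cell_val_sum lessThan_iff)
    finally show ?thesis .
  qed
  let ?e = "\<lambda>t k. cell_val (\<lambda>s. of_bool (anc s t) :: real) (cell n k)"
  have bs: "bsum anc S a t = (\<Sum>k<2 ^ n. \<beta> k * ?e t k)" for t
  proof -
    have "bsum anc S a t = (\<Sum>s\<in>S. a s *\<^sub>R (of_bool (anc s t) :: real))"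
      unfolding bsum_def using S(1) by (intro sum.mono_neutral_cong_left) auto
    then show ?thesis by (simp only: app) simp
  qed
  show "norm (\<Sum>k<2 ^ n. \<beta> k *\<^sub>R cell_val z (cell n k)) \<le> U * B"
    if B: "0 \<le> B" and \<beta>: "\<And>k. k < 2 ^ n \<Longrightarrow> \<bar>\<beta> k\<bar> \<le> B"
    unfolding app[symmetric]
  proof (rule upper_estD[OF _ B])
    show "upper_est anc U z S" using est S(1) by blast
    fix t
    have "\<bar>bsum anc S a t\<bar> \<le> (\<Sum>k<2 ^ n. \<bar>\<beta> k * ?e t k\<bar>)" unfolding bs by (rule sum_abs)
    also have "\<dots> \<le> (\<Sum>k<2 ^ n. B * ?e t k)"
      using \<beta> cell_val_nonneg by (intro sum_mono) (auto simp: abs_mult mult_right_mono)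
    also have "\<dots> = B * (\<Sum>k<2 ^ n. ?e t k)" by (simp add: sum_distrib_left)
    also have "\<dots> \<le> B * 1" using B cell_partition by (rule mult_left_mono[rotated])
    finally show "\<bar>bsum anc S a t\<bar> \<le> B" by simp
  qed
  show "\<bar>\<beta> k\<bar> \<le> L * norm (\<Sum>k<2 ^ n. \<beta> k *\<^sub>R cell_val z (cell n k))" if k: "k < 2 ^ n"
  proof -
    let ?t = "fst (cell n k)"
    have "(\<Sum>j<2 ^ n. ?e ?t j) = ?e ?t k + (\<Sum>j\<in>{..<2 ^ n} - {k}. ?e ?t j)" using k by (intro sum.remove) auto
    then have "(\<Sum>j\<in>{..<2 ^ n} - {k}. ?e ?t j) \<le> 0"
      using cell_partition[where t = ?t and n = n] cell_val_self[of "cell n k"] by linarith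
    moreover have "0 \<le> (\<Sum>j\<in>{..<2 ^ n} - {k}. ?e ?t j)" by (intro sum_nonneg cell_val_nonneg)
    ultimately have "(\<Sum>j\<in>{..<2 ^ n} - {k}. ?e ?t j) = 0" by linarith
    then have zero: "?e ?t j = 0" if "j \<in> {..<2 ^ n} - {k}" for j
      using that cell_val_nonneg by (subst (asm) sum_nonneg_eq_0_iff) auto
    have "bsum anc S a ?t = \<beta> k * ?e ?t k + (\<Sum>j\<in>{..<2 ^ n} - {k}. \<beta> j * ?e ?t j)"
      unfolding bs using k by (intro sum.remove) auto
    also have "(\<Sum>j\<in>{..<2 ^ n} - {k}. \<beta> j * ?e ?t j) = 0" using zero by (intro sum.neutral) simp
    finally have "bsum anc S a ?t = \<beta> k" using cell_val_self[of "cell n k"] by simp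
    moreover have "?t \<in> S" using S(2)[OF k] by (auto simp: cell_nodes_def)
    ultimately show ?thesis unfolding app[symmetric] using lower_estD[of anc L z S ?t a] est[OF S(1)] by simp
  qed
qed

lemma C01_diff: "f \<in> C01 \<Longrightarrow> g \<in> C01 \<Longrightarrow> (\<lambda>x. f x + (-1) * g x) \<in> C01"
  unfolding C01_def by (auto intro!: continuous_intros)

lemma C01_abs_le_supnorm:
  assumes "f \<in> C01" "x \<in> {0..1}"
  shows "\<bar>f x\<bar> \<le> supnorm01 f"
proof -
  have "compact ((\<lambda>x. \<bar>f x\<bar>) ` {0..1::real})"
    using assms(1) unfolding C01_def by (intro compact_continuous_image) (auto intro!: continuous_intros)
  then have "bdd_above ((\<lambda>x. \<bar>f x\<bar>) ` {0..1::real})" by (intro bounded_imp_bdd_above compact_imp_bounded)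
  then show ?thesis unfolding supnorm01_def using assms(2) by (intro cSUP_upper)
qed

lemma C01_supnorm_le: "(\<And>x. x \<in> {0..1} \<Longrightarrow> \<bar>f x\<bar> \<le> B) \<Longrightarrow> supnorm01 f \<le> B"
  unfolding supnorm01_def by (intro cSUP_least) auto

lemma C01_dyadic_oscillation:
  assumes "f \<in> C01" "0 < e"
  obtains n where "\<And>x y. x \<in> {0..1} \<Longrightarrow> y \<in> {0..1} \<Longrightarrow> \<bar>x - y\<bar> \<le> (1/2) ^ n \<Longrightarrow> \<bar>f x - f y\<bar> < e"
proof -
  have "uniformly_continuous_on {0..1} f"
    using assms(1) unfolding C01_def by (intro compact_uniformly_continuous) auto
  then obtain d where d: "0 < d" "\<And>x y. x \<in> {0..1} \<Longrightarrow> y \<in> {0..1} \<Longrightarrow> dist y x < d \<Longrightarrow> dist (f y) (f x) < e"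
    using assms(2) unfolding uniformly_continuous_on_def by metis
  obtain n where "(1/2::real) ^ n < d" using real_arch_pow_inv[OF d(1), of "1/2"] by auto
  then have "\<bar>f x - f y\<bar> < e" if "x \<in> {0..1}" "y \<in> {0..1}" "\<bar>x - y\<bar> \<le> (1/2) ^ n" for x y
    using d(2)[of y x] that by (simp add: dist_real_def)
  then show ?thesis using that by blast
qed

lemma dyadic_approximation:
  assumes x: "x \<in> {0..1::real}"
  shows "\<exists>k<2 ^ n. \<bar>real k / 2 ^ n - x\<bar> \<le> (1/2) ^ n"
proof (cases "x = 1")
  case True
  \<comment> \<open>At \<open>x = 1\<close> rounding down would give \<open>2 ^ n\<close>, which is
    out of range; the last grid point is within the tolerance.\<close>
  then show ?thesis
    by (intro exI[of _ "2 ^ n - 1"]) (auto simp: of_nat_diff divide_simps power_divide abs_if)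
next
  case False
  define k where "k = nat \<lfloor>x * 2 ^ n\<rfloor>"
  have rk: "real k = of_int \<lfloor>x * 2 ^ n\<rfloor>" using x by (simp add: k_def)
  have k: "real k \<le> x * 2 ^ n" "x * 2 ^ n < real k + 1" unfolding rk by linarith+
  have "x * 2 ^ n < 1 * 2 ^ n" using x False by (intro mult_strict_right_mono) auto
  then have "real k < 2 ^ n" using k by linarith
  then have "k < 2 ^ n" using of_nat_less_iff[of k "2 ^ n", where 'a = real] by simp
  moreover have "real k / 2 ^ n - x = (real k - x * 2 ^ n) / 2 ^ n" by (simp add: diff_divide_distrib)
  then have "\<bar>real k / 2 ^ n - x\<bar> = \<bar>real k - x * 2 ^ n\<bar> / 2 ^ n" by (simp add: abs_divide)
  moreover have "\<bar>real k - x * 2 ^ n\<bar> / 2 ^ n \<le> 1 / 2 ^ n" using k by (intro divide_right_mono) auto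
  ultimately show ?thesis by (auto simp: power_one_over)
qed

text \<open>\<open>Q f n\<close> represents the step function with the values of \<open>f\<close> at
  left end points of dyadic intervals of level \<open>n\<close>. Refining cells compares two levels
  in the finer one, and uniform continuity makes the sequence Cauchy. Closedness of the range
  follows from the lower bound and completeness under uniform limits.\<close>

lemma C01_embedding:
  fixes z :: "nat \<Rightarrow> 'a::banach"
  assumes est: "\<And>S. finite S \<Longrightarrow> lower_est anc L z S \<and> upper_est anc U z S" and L: "0 < L" and U: "0 < U"
  shows "\<exists>T :: (real \<Rightarrow> real) \<Rightarrow> 'a. linear_on_C01 T \<and> closed (T ` C01) \<and>
           (\<exists>a b. 0 < a \<and> (\<forall>f\<in>C01. a * supnorm01 f \<le> norm (T f) \<and> norm (T f) \<le> b * supnorm01 f))"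
proof -
  define Q where "Q f n = (\<Sum>k<2 ^ n. f (real k / 2 ^ n) *\<^sub>R cell_val z (cell n k))" for f :: "real \<Rightarrow> real" and n
  have grid: "real k / 2 ^ n \<in> {0..1}" if "k < 2 ^ n" for k n
  proof -
    have "real k \<le> 2 ^ n" using that of_nat_le_iff[of k "2 ^ n", where 'a = real] by simp
    then show ?thesis by simp
  qed
  have Qup: "norm (Q f n) \<le> U * B" if "0 \<le> B" "\<And>x. x \<in> {0..1} \<Longrightarrow> \<bar>f x\<bar> \<le> B" for f n B
    unfolding Q_def using that grid by (intro cell_estimates(1)[OF est]) auto
  have Qlo: "\<bar>f (real k / 2 ^ n)\<bar> \<le> L * norm (Q f n)" if "k < 2 ^ n" for f k n
    unfolding Q_def using cell_estimates(2)[OF est that, of "\<lambda>k. f (real k / 2 ^ n)"] .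
  have conv: "convergent (Q f)" if f: "f \<in> C01" for f
  proof -
    have "Cauchy (Q f)"
      unfolding Cauchy_altdef2
    proof (intro allI impI)
      fix e :: real assume e: "0 < e"
      then have "0 < e / (2 * U)" using U by simp
      then obtain n where n: "\<And>x y. x \<in> {0..1} \<Longrightarrow> y \<in> {0..1} \<Longrightarrow> \<bar>x - y\<bar> \<le> (1/2) ^ n \<Longrightarrow> \<bar>f x - f y\<bar> < e / (2 * U)"
        using C01_dyadic_oscillation[OF f] by blast
      have "dist (Q f (n + d)) (Q f n) < e" for d
      proof -
        have "Q f n = (\<Sum>k<2 ^ (n + d). f (real (k div 2 ^ d) / 2 ^ n) *\<^sub>R cell_val z (cell (n + d) k))"
          unfolding Q_def by (rule cell_sum_refine[where \<beta> = "\<lambda>k. f (real k / 2 ^ n)"])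
        then have "Q f (n + d) - Q f n = (\<Sum>k<2 ^ (n + d).
            (f (real k / 2 ^ (n + d)) - f (real (k div 2 ^ d) / 2 ^ n)) *\<^sub>R cell_val z (cell (n + d) k))"
          by (simp add: Q_def scaleR_diff_left sum_subtractf)
        moreover have "norm \<dots> \<le> U * (e / (2 * U))"
        proof (rule cell_estimates(1)[OF est])
          fix k :: nat assume k: "k < 2 ^ (n + d)"
          have kd: "k div 2 ^ d < 2 ^ n" using k by (simp add: less_mult_imp_div_less power_add)
          have "real (k div 2 ^ d * 2 ^ d + k mod 2 ^ d) = real (k div 2 ^ d) * 2 ^ d + real (k mod 2 ^ d)"
            by (simp only: of_nat_add of_nat_mult of_nat_power of_nat_numeral)
          then have "real k = real (k div 2 ^ d) * 2 ^ d + real (k mod 2 ^ d)" by (simp only: div_mult_mod_eq)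
          then have "real k / 2 ^ (n + d) - real (k div 2 ^ d) / 2 ^ n = real (k mod 2 ^ d) / 2 ^ (n + d)"
            by (simp add: power_add field_simps)
          moreover have "real (k mod 2 ^ d) / 2 ^ (n + d) \<le> (1/2) ^ n"
          proof -
            have "k mod 2 ^ d \<le> 2 ^ d" by (simp add: less_imp_le)
            then have "real (k mod 2 ^ d) \<le> 2 ^ d" using of_nat_le_iff[of "k mod 2 ^ d" "2 ^ d", where 'a = real] by simp
            then show ?thesis by (simp add: power_add power_one_over field_simps)
          qed
          ultimately have "\<bar>real k / 2 ^ (n + d) - real (k div 2 ^ d) / 2 ^ n\<bar> \<le> (1/2) ^ n" by simp
          then show "\<bar>f (real k / 2 ^ (n + d)) - f (real (k div 2 ^ d) / 2 ^ n)\<bar> \<le> e / (2 * U)"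
            using n[OF grid[OF k] grid[OF kd]] by simp
        qed (use e U in simp_all)
        ultimately show ?thesis using e U by (simp add: dist_norm)
      qed
      then show "\<exists>N. \<forall>m\<ge>N. dist (Q f m) (Q f N) < e" by (metis le_Suc_ex)
    qed
    then show ?thesis by (rule Cauchy_convergent)
  qed
  define T where "T f = lim (Q f)" for f
  have T: "Q f \<longlonglongrightarrow> T f" if "f \<in> C01" for f
    unfolding T_def using conv[OF that] by (simp add: convergent_LIMSEQ_iff)
  have Tadd: "T (\<lambda>x. f x + g x) = T f + T g" if "f \<in> C01" "g \<in> C01" for f g
  proof -
    have "Q (\<lambda>x. f x + g x) = (\<lambda>n. Q f n + Q g n)" by (simp add: fun_eq_iff Q_def scaleR_add_left sum.distrib)
    then show ?thesis unfolding T_def[of "\<lambda>x. f x + g x"] using tendsto_add[OF T[OF that(1)] T[OF that(2)]] by (simp add: limI)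
  qed
  have Tscale: "T (\<lambda>x. c * f x) = c *\<^sub>R T f" if "f \<in> C01" for c f
  proof -
    have "Q (\<lambda>x. c * f x) = (\<lambda>n. c *\<^sub>R Q f n)" by (simp add: fun_eq_iff Q_def scaleR_sum_right)
    then show ?thesis unfolding T_def[of "\<lambda>x. c * f x"] using tendsto_scaleR[OF tendsto_const T[OF that]] by (simp add: limI)
  qed
  have Tdiff: "T (\<lambda>x. f x + (-1) * g x) = T f - T g" if fg: "f \<in> C01" "g \<in> C01" for f g
  proof -
    have neg: "(\<lambda>x. (-1) * g x) \<in> C01" using fg(2) unfolding C01_def by (auto intro!: continuous_intros)
    show ?thesis unfolding Tadd[OF fg(1) neg] Tscale[OF fg(2)] by simp
  qed
  have Tup: "norm (T f) \<le> U * B" if f: "f \<in> C01" and B: "0 \<le> B" "\<And>x. x \<in> {0..1} \<Longrightarrow> \<bar>f x\<bar> \<le> B" for f B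
    using tendsto_norm[OF T[OF f]] Qup[OF B] by (intro LIMSEQ_le_const2) auto
  have Tlo: "\<bar>f x\<bar> \<le> L * norm (T f)" if f: "f \<in> C01" and x: "x \<in> {0..1}" for f x
  proof -
    have dy: "\<bar>f (real k / 2 ^ n)\<bar> \<le> L * norm (T f)" if k: "k < 2 ^ n" for k n
    proof (rule LIMSEQ_le_const)
      \<comment> \<open>Grid points persist: \<open>k / 2 ^ n\<close> is number
        \<open>k * 2 ^ d\<close> at level \<open>d + n\<close>, so the lower bound there survives
        the limit.\<close>
      show "(\<lambda>d. L * norm (Q f (d + n))) \<longlonglongrightarrow> L * norm (T f)"
        by (intro tendsto_mult tendsto_const tendsto_norm LIMSEQ_ignore_initial_segment T f)
      have "\<bar>f (real k / 2 ^ n)\<bar> \<le> L * norm (Q f (d + n))" for d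
      proof -
        have "k * 2 ^ d < 2 ^ (d + n)" using k by (simp add: power_add)
        from Qlo[OF this, of f] show ?thesis by (simp add: power_add)
      qed
      then show "\<exists>N. \<forall>d\<ge>N. \<bar>f (real k / 2 ^ n)\<bar> \<le> L * norm (Q f (d + n))" by blast
    qed
    show ?thesis
    proof (rule field_le_epsilon)
      fix e :: real assume "0 < e"
      then obtain n where n: "\<And>x y. x \<in> {0..1} \<Longrightarrow> y \<in> {0..1} \<Longrightarrow> \<bar>x - y\<bar> \<le> (1/2) ^ n \<Longrightarrow> \<bar>f x - f y\<bar> < e"
        using C01_dyadic_oscillation[OF f] by blast
      obtain k where k: "k < 2 ^ n" "\<bar>real k / 2 ^ n - x\<bar> \<le> (1/2) ^ n" using dyadic_approximation[OF x] by blast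
      have "\<bar>f (real k / 2 ^ n) - f x\<bar> < e" using n[OF grid[OF k(1)] x k(2)] .
      then show "\<bar>f x\<bar> \<le> L * norm (T f) + e" using dy[OF k(1)] by linarith
    qed
  qed
  have lin: "linear_on_C01 T" using Tadd Tscale by (simp add: linear_on_C01_def)
  have bounds: "(1 / L) * supnorm01 f \<le> norm (T f) \<and> norm (T f) \<le> U * supnorm01 f" if f: "f \<in> C01" for f
  proof
    have "supnorm01 f \<le> L * norm (T f)" by (rule C01_supnorm_le[OF Tlo[OF f]])
    then show "(1 / L) * supnorm01 f \<le> norm (T f)" using L by (simp add: field_simps)
    have "0 \<le> supnorm01 f" using C01_abs_le_supnorm[OF f, of 0] by simp
    then show "norm (T f) \<le> U * supnorm01 f" 
      by (rule Tup[OF f]) (rule C01_abs_le_supnorm[OF f])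
  qed
  have "closed (T ` C01)"
    unfolding closed_sequential_limits
  proof (intro allI impI, elim conjE)
    fix y l assume y: "\<forall>n. y n \<in> T ` C01" and lim: "y \<longlonglongrightarrow> l"
    then have "\<forall>n. \<exists>f. f \<in> C01 \<and> y n = T f" by blast
    then obtain f where f: "\<And>n. f n \<in> C01" "\<And>n. y n = T (f n)" by metis
    have diff: "\<bar>f n x - f m x\<bar> \<le> L * norm (y n - y m)" if "x \<in> {0..1}" for n m x
      using Tlo[OF C01_diff[OF f(1)[of n] f(1)[of m]] that] unfolding Tdiff[OF f(1) f(1)] f(2) by simp
    have "uniformly_Cauchy_on {0..1} f"
      unfolding uniformly_Cauchy_on_def
    proof (intro allI impI)
      fix e :: real assume e: "0 < e"
      then have "0 < e / L" using L by simp
      then obtain M where M: "\<And>m n. m \<ge> M \<Longrightarrow> n \<ge> M \<Longrightarrow> norm (y m - y n) < e / L"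
        using LIMSEQ_imp_Cauchy[OF lim] unfolding Cauchy_iff by metis
      have "dist (f m x) (f n x) < e" if "x \<in> {0..1}" "m \<ge> M" "n \<ge> M" for x m n
      proof -
        have "L * norm (y m - y n) < L * (e / L)" using M[OF that(2,3)] L by (intro mult_strict_left_mono)
        then show ?thesis using diff[OF that(1), of m n] L by (simp add: dist_real_def)
      qed
      then show "\<exists>M. \<forall>x\<in>{0..1}. \<forall>m\<ge>M. \<forall>n\<ge>M. dist (f m x) (f n x) < e" by blast
    qed
    then obtain g where g: "uniform_limit {0..1} f g sequentially"
      using Cauchy_uniformly_convergent unfolding uniformly_convergent_on_def by blast
    \<comment> \<open>The limit is only determined on the interval, while members of
      \<open>C01\<close> have to vanish outside it.\<close>
    define h where "h x = (if x \<in> {0..1} then g x else 0)" for x :: real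
    have "continuous_on {0..1} g"
      using f(1) by (intro uniform_limit_theorem[OF _ g]) (auto simp: C01_def)
    then have "continuous_on {0..1} h" by (rule continuous_on_eq) (simp add: h_def)
    then have h: "h \<in> C01" by (simp add: C01_def) (simp add: h_def)
    have "y \<longlonglongrightarrow> T h"
    proof (rule metric_LIMSEQ_I)
      fix e :: real assume e: "0 < e"
      then have e': "0 < e / (2 * U)" using U by simp
      have "\<forall>\<^sub>F n in sequentially. \<forall>x\<in>{0..1}. dist (f n x) (g x) < e / (2 * U)"
        using uniform_limitD[OF g e'] .
      then obtain N where N: "\<And>n x. n \<ge> N \<Longrightarrow> x \<in> {0..1} \<Longrightarrow> dist (f n x) (g x) < e / (2 * U)"
        unfolding eventually_sequentially by blast
      have "dist (y n) (T h) < e" if n: "n \<ge> N" for n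
      proof -
        have "norm (T (\<lambda>x. f n x + (-1) * h x)) \<le> U * (e / (2 * U))"
        proof (rule Tup[OF C01_diff[OF f(1) h]])
          show "\<bar>f n x + - 1 * h x\<bar> \<le> e / (2 * U)" if "x \<in> {0..1}" for x
            using N[OF n that] that by (simp add: h_def dist_real_def)
        qed (use e' in simp)
        then show ?thesis unfolding Tdiff[OF f(1) h] using e U by (simp add: f(2) dist_norm)
      qed
      then show "\<exists>no. \<forall>n\<ge>no. dist (y n) (T h) < e" by blast
    qed
    then have "l = T h" using lim LIMSEQ_unique by blast
    then show "l \<in> T ` C01" using h by blast
  qed
  then show ?thesis using lin bounds L by (intro exI[of _ T] conjI exI[of _ "1 / L"] exI[of _ U]) auto
qed

lemma K_elastic_mono:
  assumes "K_elastic TYPE('a::banach) K" "K \<le> K'"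
  shows "K_elastic TYPE('a) K'"
  unfolding K_elastic_def
proof (intro allI impI)
  fix S :: "'a set" and N
  assume SN: "closed S \<and> subspace S \<and> is_norm_on S N \<and> (\<exists>a b. 0 < a \<and> (\<forall>x\<in>S. a * norm x \<le> N x \<and> N x \<le> b * norm x))"
  obtain T :: "'a \<Rightarrow> 'a" where T: "linear_on S T" "\<And>y. y \<in> S \<Longrightarrow> N y \<le> norm (T y) \<and> norm (T y) \<le> K * N y"
    using assms(1)[unfolded K_elastic_def, rule_format, OF SN] by blast
  have "K * N y \<le> K' * N y" if "y \<in> S" for y
    using SN that assms(2) by (intro mult_right_mono) (auto simp: is_norm_on_def)
  then show "\<exists>T :: 'a \<Rightarrow> 'a. linear_on S T \<and> (\<forall>y\<in>S. N y \<le> norm (T y) \<and> norm (T y) \<le> K' * N y)"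
    using T order_trans by blast
qed

theorem theorem1p1:
  assumes sep: "separable_space (euclidean :: 'a::banach topology)"
    and infdim: "\<not> (\<exists>B :: 'a set. finite B \<and> span B = UNIV)"
    and el: "elastic TYPE('a)"
  shows "\<exists>T :: (real \<Rightarrow> real) \<Rightarrow> 'a. linear_on_C01 T \<and> closed (T ` C01) \<and>
           (\<exists>a b. 0 < a \<and> (\<forall>f\<in>C01. a * supnorm01 f \<le> norm (T f) \<and> norm (T f) \<le> b * supnorm01 f))"
proof -
  obtain K0 where "K_elastic TYPE('a) K0" using el unfolding elastic_def by blast
  \<comment> \<open>The construction compares \<open>K\<close> with 1, for instance to fit unit
    vectors under the bound \<open>3 * K\<close>.\<close>
  then have K: "K_elastic TYPE('a) (max K0 1)" by (rule K_elastic_mono) simp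
  obtain z :: "nat \<Rightarrow> 'a" where "\<And>S. finite S \<Longrightarrow> lower_est anc 4 z S \<and> upper_est anc (2 * (3 * max K0 1)) z S"
    using full_tree_embedding[OF sep K _ infdim] by auto
  then show ?thesis by (rule C01_embedding) auto
qed

end
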